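(* One has $$\mathcal M(\Gamma(8))_{\frac12\mathbb M}=\mathcal M(8)_{\langle\frac12^*,\chi_8\rangle}=\bigoplus_{a,b,c\in\{0,1\}}\mathcal M(4)_{\langle w_2\rangle}\,(\eta^{\natural})^a(\eta^{\flat})^b(\eta^{\sharp})^c ,$$ $$\mathcal S(\Gamma(8))_{\frac12\mathbb M}=\mathcal M(\Gamma(8))_{\frac12\mathbb M}\,\eta^3.$$ Here the sums are internal direct sums, and the first equality means $\mathcal M(\Gamma(8))_{k/2}=\bigoplus_{j\in\{0,1\}}\mathcal M(8)_{(k/2,\xi_8^k\chi_8^j)}$ for every integer $k\ge0$.
   Context: $\mathbb M=\{0,1,2,\dots\}$; $\mathcal H$ is the upper half plane, $q^r=e^{2\pi i r\tau}$. $\Gamma(N)$ is the principal congruence subgroup; $\Gamma_0(N)$ (resp. $\Gamma^0(N)$) is the group of $\begin{pmatrix}a&b\\c&d\end{pmatrix}\in\mathrm{SL}_2(\mathbb Z)$ with $N\mid c$ (resp. $N\mid b$). For $\gamma=\begin{pmatrix}a&b\\c&d\end{pmatrix}\in\mathrm{SL}_2(\mathbb Z)$ put $J_{k/2}(\gamma,\tau)=\left(\frac cd\right)^k\big(\sqrt{c\tau+d}\,\big)^k$ for $k\in\mathbb M$, where $\sqrt{\cdot}$ has argument in $(-\frac\pi2,\frac\pi2]$ and $\left(\frac nm\right)$ is the Kronecker symbol: multiplicative in $m$, Legendre symbol for odd primes $m$, $\left(\frac n2\right)=1,-1,0$ according as $n\equiv\pm1\ (8)$, $n\equiv\pm3\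 (8)$, $n$ even, $\left(\frac n1\right)=1$, $\left(\frac n{-1}\right)=1$ if $n\ge0$ and $-1$ otherwise, $\left(\frac n0\right)=1$ if $n=\pm1$ and $-1$ otherwise. Put $(f|_{k/2}\gamma)(\tau)=f(\gamma\tau)/J_{k/2}(\gamma,\tau)$. For a congruence subgroup $\varGamma$ and a map $\chi:\varGamma\to\mathbb C^\times$, $\mathcal M(\varGamma)_{(k/2,\chi)}$ is the space of holomorphic $f$ on $\mathcal H$ with $f|_{k/2}\gamma=\chi(\gamma)f$ for all $\gamma\in\varGamma$ and $f|_{k/2}\alpha$ bounded as $\operatorname{Im}\tau\to\infty$ for all $\alpha\in\mathrm{SL}_2(\mathbb Z)$; $\mathcal S(\varGamma)_{(k/2,\chi)}$ is the subspace where $f|_{k/2}\alpha\to0$ as $\operatorname{Im}\tau\to\infty$ for all such $\alpha$. $\mathcal M(\varGamma)_{k/2}$, $\mathcal S(\varGamma)_{k/2}$ are the case $\chi=1$; $\mathcal M(\varGamma)_{\frac12\mathbb M}=\bigoplus_{k\in\mathbb M}\mathcal M(\varGamma)_{k/2}$, similarly $\mathcal S$. Functions of $d$ are regarded as functions of $\gamma$ via its lower right entry $d$. For odd $d$: $\chi_8(d)=1$ if $d\equiv\pm1\ (8)$, $-1$ if $d\equiv\pm3\ (8)$; $\chi_4(d)=(-1)^{(d-1)/2}$; $\xi_8(d)=e^{2\pi i(d-1)/8}$. $\mathcal M(N)$ abbreviates $\mathcal M(\Gamma_0(N)\cap\Gamma^0(N))$. Set $\mathcal M(8)_{\langle\frac12^*,\chi_8\rangle}=\bigoplus_{k\in\mathbb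 M}\bigoplus_{j\in\{0,1\}}\mathcal M(8)_{(k/2,\,\xi_8^k\chi_8^j)}$ and $\mathcal M(4)_{\langle w_2\rangle}=\bigoplus_{k\in\mathbb M}\mathcal M(4)_{(k/2,\,(\xi_8\chi_8)^k)}$, where $w_2=(\frac12,\xi_8\chi_8)$. $\eta(\tau)=q^{1/24}\prod_{n\ge1}(1-q^n)$, $\eta^{\flat}(\tau)=\eta(\tau/2)^2/\eta(\tau)$, $\eta^{\sharp}(\tau)=\eta(2\tau)^2/\eta(\tau)$, $\eta^{\natural}(\tau)=\eta(\tau)^5/\big(\eta(\tau/2)^2\eta(2\tau)^2\big)$. *)

theory Defs
  imports
    "HOL-Complex_Analysis.Complex_Analysis"
    "HOL-Number_Theory.Residues"
    "HOL-Library.Function_Algebras"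
begin

definition kronecker_prime :: "int \<Rightarrow> nat \<Rightarrow> int" where
  "kronecker_prime n p =
     (if p = 2 then (if n mod 8 \<in> {1, 7} then 1 else if n mod 8 \<in> {3, 5} then -1 else 0)
      else Legendre n (int p))"

(* The value at m = 0 is the convention used here (elsewhere it is often 0 for n other than 1, -1);
   the weight factor below only evaluates the symbol at coprime n, m, where both agree. *)
definition kronecker :: "int \<Rightarrow> int \<Rightarrow> int" where
  "kronecker n m =
     (if m = 0 then (if n = 1 \<or> n = -1 then 1 else -1)
      else (if m < 0 \<and> n < 0 then -1 else 1)
         * (\<Prod>p\<in>#prime_factorization (nat \<bar>m\<bar>). kronecker_prime n p))"

definition upper_half_plane :: "complex set" where
  "upper_half_plane = {\<tau>. 0 < Im \<tau>}"

definition SL2Z :: "(int^2^2) set" where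
  "SL2Z = {\<gamma>. det \<gamma> = 1}"

definition Gamma_principal :: "int \<Rightarrow> (int^2^2) set" where
  "Gamma_principal N = {\<gamma>\<in>SL2Z. [\<gamma>$1$1 = 1] (mod N) \<and> [\<gamma>$1$2 = 0] (mod N)
                      \<and> [\<gamma>$2$1 = 0] (mod N) \<and> [\<gamma>$2$2 = 1] (mod N)}"

definition Gamma_lower :: "int \<Rightarrow> (int^2^2) set"  ("Gamma\<^sub>0") where
  "Gamma\<^sub>0 N = {\<gamma>\<in>SL2Z. N dvd \<gamma>$2$1}"

definition Gamma_upper :: "int \<Rightarrow> (int^2^2) set"  ("Gamma\<^sup>0") where
  "Gamma\<^sup>0 N = {\<gamma>\<in>SL2Z. N dvd \<gamma>$1$2}"

definition moebius :: "int^2^2 \<Rightarrow> complex \<Rightarrow> complex" where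
  "moebius \<gamma> \<tau> = (of_int (\<gamma>$1$1) * \<tau> + of_int (\<gamma>$1$2)) / (of_int (\<gamma>$2$1) * \<tau> + of_int (\<gamma>$2$2))"

(* In the following, the natural number k stands for the weight k/2. *)

definition weight_factor :: "nat \<Rightarrow> int^2^2 \<Rightarrow> complex \<Rightarrow> complex" where
  "weight_factor k \<gamma> \<tau> =
     of_int (kronecker (\<gamma>$2$1) (\<gamma>$2$2)) ^ k * csqrt (of_int (\<gamma>$2$1) * \<tau> + of_int (\<gamma>$2$2)) ^ k"

definition slash :: "nat \<Rightarrow> (complex \<Rightarrow> complex) \<Rightarrow> int^2^2 \<Rightarrow> complex \<Rightarrow> complex" where
  "slash k f \<gamma> \<tau> = f (moebius \<gamma> \<tau>) / weight_factor k \<gamma> \<tau>"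

definition at_i_infinity :: "complex filter" where
  "at_i_infinity = filtercomap Im at_top"

(* Functions on the upper half plane are represented by functions on the complex plane that
   vanish outside it, so that equality of representatives is equality on the half plane. *)
definition modular_forms :: "(int^2^2) set \<Rightarrow> nat \<Rightarrow> (int^2^2 \<Rightarrow> complex) \<Rightarrow> (complex \<Rightarrow> complex) set" where
  "modular_forms G k \<psi> =
     {f. f holomorphic_on upper_half_plane \<and> (\<forall>\<tau>. \<tau> \<notin> upper_half_plane \<longrightarrow> f \<tau> = 0) \<and>
         (\<forall>\<gamma>\<in>G. \<forall>\<tau>\<in>upper_half_plane. slash k f \<gamma> \<tau> = \<psi> \<gamma> * f \<tau>) \<and>
         (\<forall>\<alpha>\<in>SL2Z. Bfun (slash k f \<alpha>) at_i_infinity)}"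

definition cusp_forms :: "(int^2^2) set \<Rightarrow> nat \<Rightarrow> (int^2^2 \<Rightarrow> complex) \<Rightarrow> (complex \<Rightarrow> complex) set" where
  "cusp_forms G k \<psi> =
     {f\<in>modular_forms G k \<psi>. \<forall>\<alpha>\<in>SL2Z. (slash k f \<alpha> \<longlongrightarrow> 0) at_i_infinity}"

definition fun_scale :: "complex \<Rightarrow> (complex \<Rightarrow> complex) \<Rightarrow> complex \<Rightarrow> complex" where
  "fun_scale c f = (\<lambda>\<tau>. c * f \<tau>)"

interpretation cfun: vector_space fun_scale
  by unfold_locales (auto simp: fun_scale_def fun_eq_iff algebra_simps)

(* The ambient space W is the internal direct sum of its subspaces V i. *)
definition internal_direct_sum ::
    "'i set \<Rightarrow> ('i \<Rightarrow> (complex \<Rightarrow> complex) set) \<Rightarrow> (complex \<Rightarrow> complex) set \<Rightarrow> bool" where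
  "internal_direct_sum I V W \<longleftrightarrow>
     (\<forall>i\<in>I. cfun.subspace (V i)) \<and>
     W = cfun.span (\<Union>i\<in>I. V i) \<and>
     (\<forall>K f. finite K \<and> K \<subseteq> I \<and> (\<forall>i\<in>K. f i \<in> V i) \<and> (\<Sum>i\<in>K. f i) = 0 \<longrightarrow> (\<forall>i\<in>K. f i = 0))"

definition chi8 :: "int \<Rightarrow> complex" where
  "chi8 d = (if d mod 8 \<in> {1, 7} then 1 else if d mod 8 \<in> {3, 5} then -1 else 0)"

definition xi8 :: "int \<Rightarrow> complex" where
  "xi8 d = exp (2 * of_real pi * \<i> * of_int (d - 1) / 8)"

definition forms_Gamma8 :: "nat \<Rightarrow> (complex \<Rightarrow> complex) set" where
  "forms_Gamma8 k = modular_forms (Gamma_principal 8) k (\<lambda>_. 1)"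

definition cusps_Gamma8 :: "nat \<Rightarrow> (complex \<Rightarrow> complex) set" where
  "cusps_Gamma8 k = cusp_forms (Gamma_principal 8) k (\<lambda>_. 1)"

definition forms8 :: "nat \<Rightarrow> nat \<Rightarrow> (complex \<Rightarrow> complex) set" where
  "forms8 k j = modular_forms (Gamma\<^sub>0 8 \<inter> Gamma\<^sup>0 8) k (\<lambda>\<gamma>. xi8 (\<gamma>$2$2) ^ k * chi8 (\<gamma>$2$2) ^ j)"

definition forms4_w2 :: "nat \<Rightarrow> (complex \<Rightarrow> complex) set" where
  "forms4_w2 k = modular_forms (Gamma\<^sub>0 4 \<inter> Gamma\<^sup>0 4) k (\<lambda>\<gamma>. (xi8 (\<gamma>$2$2) * chi8 (\<gamma>$2$2)) ^ k)"

(* Total spaces: sums, inside the space of functions, of the graded pieces. *)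

definition all_forms_Gamma8 :: "(complex \<Rightarrow> complex) set" where
  "all_forms_Gamma8 = cfun.span (\<Union>k. forms_Gamma8 k)"

definition all_cusps_Gamma8 :: "(complex \<Rightarrow> complex) set" where
  "all_cusps_Gamma8 = cfun.span (\<Union>k. cusps_Gamma8 k)"

definition all_forms8 :: "(complex \<Rightarrow> complex) set" where
  "all_forms8 = cfun.span (\<Union>k. \<Union>j\<in>{0, 1}. forms8 k j)"

definition all_forms4_w2 :: "(complex \<Rightarrow> complex) set" where
  "all_forms4_w2 = cfun.span (\<Union>k. forms4_w2 k)"

definition dedekind_eta :: "complex \<Rightarrow> complex" where
  "dedekind_eta \<tau> = exp (2 * of_real pi * \<i> * \<tau> / 24)
            * prodinf (\<lambda>n. 1 - exp (2 * of_real pi * \<i> * of_nat (Suc n) * \<tau>))"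

definition eta_flat :: "complex \<Rightarrow> complex" where
  "eta_flat \<tau> = dedekind_eta (\<tau> / 2) ^ 2 / dedekind_eta \<tau>"

definition eta_sharp :: "complex \<Rightarrow> complex" where
  "eta_sharp \<tau> = dedekind_eta (2 * \<tau>) ^ 2 / dedekind_eta \<tau>"

definition eta_natural :: "complex \<Rightarrow> complex" where
  "eta_natural \<tau> = dedekind_eta \<tau> ^ 5 / (dedekind_eta (\<tau> / 2) ^ 2 * dedekind_eta (2 * \<tau>) ^ 2)"

end

theory Submission
  imports Defs "HOL-Number_Theory.Number_Theory" "HOL-Real_Asymp.Real_Asymp"
begin

text \<open>
  A form f of weight k/2 is compared with the k-th power of theta(\<tau>) = eta_natural
  (2\<tau>), the classical theta series. Theta has no zeros, and under Gamma_0(4) it acquires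
  the factor xi8(d) chi8(d) (c/d) sqrt(c\<tau> + d) (theorem theta_transformation). Hence F = f
  / theta^k turns every transformation law of the statement into F \<circ> \<gamma> =
  \<plusminus>F with a sign character: the character is trivial for the forms of weight multiple
  of w_2, it is a power of chi8 for the forms on Gamma_0(8) \<inter> Gamma^0(8), and for
  Gamma(8) one gets plain invariance. The subtleties of half-integral weight are confined to the
  one law for theta.

  The group Gamma_0(4) \<inter> Gamma^0(4) is \<plusminus>Gamma(4), and modulo
  \<plusminus>Gamma(8) it is elementary abelian of order 8. The quotients of eta_natural,
  eta_flat and eta_sharp by theta are multiplied by sign characters that form a basis of the
  dual of this group. The dual basis consists of classes of conjugates of T^4, one for each eta
  quotient x: it is represented by stabilisers of precisely those cusps at which x vanishes. If
  f is odd under the element belonging to x and invariant under the others, its expansion at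
  these cusps contains only odd powers of exp(\<pi>i\<tau>/4), so f vanishes there at least as
  fast as x, and f / x is again a modular form, of weight smaller by 1/2 (theorem
  theta_forms_split). Splitting successively for the three eta quotients produces the eight
  summands. They are independent because the sign characters separate them within each weight,
  and different weights are separated by the infinitely many values of the automorphy factor at
  a given point. The decomposition by powers of chi8 is the same splitting for the quotient of
  Gamma_0(8) \<inter> Gamma^0(8) by \<plusminus>Gamma(8), which has order 2.

  The cube of eta is the product of the three eta quotients; it has no zeros and vanishes at
  every cusp to the order of exp(\<pi>i\<tau>/4), which is the smallest positive order for
  Gamma(8). So every cusp form of weight at least 3/2 is divisible by it. In smaller weight k/2,
  the function f^3 / eta^(3k) is invariant under Gamma(8), vanishes at all cusps, and is
  therefore zero, since by the maximum principle a bounded invariant function is constant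
  (theorem Gamma8_invariant_bounded_constant).

  Two facts feed the law for theta. The inversion formula eta(-1/\<tau>) = sqrt(-i\<tau>)
  eta(\<tau>) comes from a comparison of two theta products: up to an explicit exponential their
  quotient is an elliptic function without poles, hence constant, and its values at 0 and at the
  three half periods determine eta(-1/\<tau>)^6. On the arithmetic side, the factor xi8(d)
  chi8(d) (c/d) sqrt(c\<tau> + d) is compatible with right multiplication by the generators of
  Gamma_0(4): for the translation this says that (c/d) depends only on d modulo c when 4 divides
  c, which is quadratic reciprocity, and for the other generator the sign convention of the
  Kronecker symbol matches the branch of the square root.
\<close>

(* The dollar sign denotes vector components only; reading it also as coefficient extraction
   makes matrix expressions ambiguous. *)
no_notation fps_nth (infixl "$" 75)

section \<open>Jacobi and Kronecker symbols\<close>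

lemma Legendre_cong:
  assumes "[a = b] (mod p)"
  shows "Legendre a p = Legendre b p"
proof -
  have "[a = 0] (mod p) \<longleftrightarrow> [b = 0] (mod p)" "QuadRes p a \<longleftrightarrow> QuadRes p b"
    using assms unfolding QuadRes_def by (meson cong_sym cong_trans)+
  thus ?thesis by (simp add: Legendre_def)
qed

lemma Legendre_in: "Legendre a p \<in> {-1, 0, 1}"
  by (auto simp: Legendre_def)

lemma Legendre_mult:
  fixes p :: nat
  assumes "prime p" "2 < p"
  shows "Legendre (a * b) (int p) = Legendre a (int p) * Legendre b (int p)"
proof -
  have "[Legendre (a * b) p = (a * b) ^ ((p - 1) div 2)] (mod p)"
    by (rule euler_criterion[OF assms])
  also have "(a * b) ^ ((p - 1) div 2) = a ^ ((p - 1) div 2) * b ^ ((p - 1) div 2)"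
    by (simp add: power_mult_distrib)
  also have "[a ^ ((p - 1) div 2) * b ^ ((p - 1) div 2) = Legendre a p * Legendre b p] (mod p)"
    by (intro cong_mult cong_sym[OF euler_criterion[OF assms]])
  finally have "int p dvd Legendre (a * b) p - Legendre a p * Legendre b p"
    by (simp add: cong_iff_dvd_diff)
  moreover have "\<bar>Legendre (a * b) p - Legendre a p * Legendre b p\<bar> \<le> 2"
    using Legendre_in[of "a*b" p] Legendre_in[of a p] Legendre_in[of b p] by auto
  ultimately show ?thesis
    using assms(2) zdvd_imp_le[of "int p" "\<bar>Legendre (a * b) p - Legendre a p * Legendre b p\<bar>"]
    by (cases "Legendre (a * b) p - Legendre a p * Legendre b p = 0") auto
qed

lemma Legendre_minus_one:
  fixes p :: nat
  assumes "prime p" "2 < p"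
  shows "Legendre (-1) (int p) = (if p mod 4 = 1 then 1 else -1)"
proof -
  have "odd p" using assms prime_odd_nat by auto
  have "[Legendre (-1) p = (-1) ^ ((p - 1) div 2)] (mod p)"
    by (rule euler_criterion[OF assms])
  moreover have "even ((p - 1) div 2) \<longleftrightarrow> p mod 4 = 1"
    using \<open>odd p\<close> by presburger
  ultimately have "[Legendre (-1) p = (if p mod 4 = 1 then 1 else -1)] (mod p)"
    by (auto split: if_splits)
  hence "int p dvd Legendre (-1) p - (if p mod 4 = 1 then 1 else -1)"
    by (simp add: cong_iff_dvd_diff)
  moreover have "\<bar>Legendre (-1) p - (if p mod 4 = 1 then 1 else -1)\<bar> \<le> 2"
    using Legendre_in[of "-1" p] by auto
  ultimately show ?thesis
    using assms(2) zdvd_imp_le[of "int p" "\<bar>Legendre (-1) p - (if p mod 4 = 1 then 1 else -1)\<bar>"]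
    by (cases "Legendre (-1) p - (if p mod 4 = 1 then 1 else -1) = 0") auto
qed

definition sgn8 :: "int \<Rightarrow> int" where
  "sgn8 d = (if d mod 8 \<in> {1, 7} then 1 else if d mod 8 \<in> {3, 5} then -1 else 0)"

text \<open>
  By the lemma of Gauss the symbol is determined by the number of even integers 2x with (p-1)/2
  < 2x < p.
\<close>
lemma Legendre_two:
  fixes p :: nat
  assumes "prime p" "2 < p"
  shows "Legendre 2 (int p) = sgn8 (int p)"
proof -
  have oddp: "odd p" using assms prime_odd_nat by auto
  interpret GAUSS p 2
    using assms by unfold_locales (auto simp: cong_0_iff zdvd_not_zless)
  define h where "h = (int p - 1) div 2"
  have p_eq: "int p = 2 * h + 1" using oddp unfolding h_def by presburger
  have h_pos: "h > 0" using assms p_eq by simp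
  have "C = (\<lambda>x. (x * 2) mod int p) ` {0<..h}"
    by (simp add: C_def B_def A_def h_def image_image)
  also have "\<dots> = (\<lambda>x. x * 2) ` {0<..h}"
    by (rule image_cong[OF refl]) (auto simp: p_eq)
  finally have C_eq: "C = (\<lambda>x. x * 2) ` {0<..h}" .
  have "E = (\<lambda>x. x * 2) ` {h div 2<..h}"
    unfolding E_def C_eq h_def[symmetric] using h_pos by auto
  hence "card E = card {h div 2<..h}"
    by (simp add: card_image inj_on_def)
  also have "\<dots> = nat (h - h div 2)" by simp
  finally have cE: "card E = nat (h - h div 2)" .
  have ev: "even (card E) \<longleftrightarrow> (h mod 4 \<in> {0, 3})"
    unfolding cE using h_pos by (simp add: even_nat_iff) presburger
  have "int p mod 8 = (2 * (h mod 4) + 1)" unfolding p_eq by presburger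
  moreover have "h mod 4 \<in> {0, 1, 2, 3}" by auto
  ultimately show ?thesis
    using gauss_lemma ev by (auto simp: sgn8_def)
qed

text \<open>
  The sign in quadratic reciprocity. Written through residues modulo 4 it extends to odd
  integers of either sign and is multiplicative in each argument.
\<close>
definition recip_sign :: "int \<Rightarrow> int \<Rightarrow> int" where
  "recip_sign m n = (if m mod 4 = 3 \<and> n mod 4 = 3 then -1 else 1)"

lemma recip_sign_commute: "recip_sign m n = recip_sign n m" by (auto simp: recip_sign_def)

lemma odd_mod4: "odd (m::int) \<Longrightarrow> m mod 4 = 1 \<or> m mod 4 = 3" by presburger
lemma odd_mod8: "odd (m::int) \<Longrightarrow> m mod 8 = 1 \<or> m mod 8 = 3 \<or> m mod 8 = 5 \<or> m mod 8 = 7" by presburger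

lemma recip_sign_mult_left:
  assumes "odd m" "odd m'"
  shows "recip_sign (m * m') n = recip_sign m n * recip_sign m' n"
  using odd_mod4[OF assms(1)] odd_mod4[OF assms(2)] mod_mult_eq[of m 4 m', symmetric]
  by (elim disjE) (simp_all only: recip_sign_def, simp_all)

lemma recip_sign_mult_right: "odd m \<Longrightarrow> odd m' \<Longrightarrow> recip_sign n (m * m') = recip_sign n m * recip_sign n m'"
  using recip_sign_mult_left recip_sign_commute by metis

lemma sgn8_mult:
  assumes "odd m" "odd n"
  shows "sgn8 (m * n) = sgn8 m * sgn8 n"
  using odd_mod8[OF assms(1)] odd_mod8[OF assms(2)] mod_mult_eq[of m 8 n, symmetric]
  by (elim disjE) (simp_all only: sgn8_def, simp_all)

lemma Legendre_reciprocity: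
  fixes p q :: nat
  assumes "prime p" "2 < p" "prime q" "2 < q"
  shows "Legendre (int p) (int q) = recip_sign (int p) (int q) * Legendre (int q) (int p)"
proof (cases "p = q")
  case True
  thus ?thesis by (simp add: Legendre_def cong_def)
next
  case False
  have odd: "odd p" "odd q" using assms prime_odd_nat by auto
  have nd: "\<not> [int q = 0] (mod int p)"
    using assms False by (auto simp: cong_0_iff primes_dvd_imp_eq)
  hence sq: "Legendre (int q) (int p) * Legendre (int q) (int p) = 1"
    by (simp add: Legendre_def)
  have "Legendre p q * Legendre q p = (-1::int) ^ ((p - 1) div 2 * ((q - 1) div 2))"
    using Quadratic_Reciprocity[of p q] assms False by simp
  also have "\<dots> = recip_sign (int p) (int q)"
  proof -
    have "even ((p - 1) div 2 * ((q - 1) div 2)) \<longleftrightarrow> \<not> (p mod 4 = 3 \<and> q mod 4 = 3)"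
    proof -
      have "odd ((p - 1) div 2) \<longleftrightarrow> p mod 4 = 3" "odd ((q - 1) div 2) \<longleftrightarrow> q mod 4 = 3"
        using odd by presburger+
      thus ?thesis by (auto simp del: One_nat_def)
    qed
    moreover have "int p mod 4 = 3 \<longleftrightarrow> p mod 4 = 3" "int q mod 4 = 3 \<longleftrightarrow> q mod 4 = 3"
      by presburger+
    ultimately show ?thesis
      by (auto simp: recip_sign_def)
  qed
  finally have "Legendre p q * Legendre q p = recip_sign (int p) (int q)" .
  hence "Legendre p q * (Legendre q p * Legendre q p) = recip_sign (int p) (int q) * Legendre q p"
    by (simp add: mult_ac)
  thus ?thesis by (simp add: sq)
qed

text \<open>
  The part of the Kronecker symbol that does not see signs; for odd m it is the Jacobi symbol.
\<close>
definition jacobi :: "int \<Rightarrow> nat \<Rightarrow> int" where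
  "jacobi n m = (\<Prod>p\<in>#prime_factorization m. kronecker_prime n p)"

lemma kronecker_odd:
  assumes "odd m"
  shows "kronecker n m = (if m < 0 \<and> n < 0 then -1 else 1) * jacobi n (nat \<bar>m\<bar>)"
  using assms by (auto simp: kronecker_def jacobi_def)

lemma jacobi_1 [simp]: "jacobi n (Suc 0) = 1" by (simp add: jacobi_def)

lemma jacobi_mult_right: "m > 0 \<Longrightarrow> m' > 0 \<Longrightarrow> jacobi n (m * m') = jacobi n m * jacobi n m'"
  by (simp add: jacobi_def prime_factorization_mult)

lemma jacobi_prime: "prime p \<Longrightarrow> 2 < p \<Longrightarrow> jacobi n p = Legendre n (int p)"
  by (simp add: jacobi_def kronecker_prime_def prime_factorization_prime)

text \<open>
  Multiplicative identities for odd numbers follow by splitting off one odd prime at a time.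
\<close>
lemma odd_nat_induct [consumes 1, case_names one prime]:
  fixes m :: nat
  assumes "odd m" "P (Suc 0)"
    "\<And>p m. prime p \<Longrightarrow> 2 < p \<Longrightarrow> odd p \<Longrightarrow> odd m \<Longrightarrow> P m \<Longrightarrow> P (p * m)"
  shows "P m"
  using assms(1)
proof (induction m rule: prime_divisors_induct)
  case (factor p x)
  hence "odd p" "odd x" by auto
  moreover from this factor.hyps have "2 < p"
    using prime_ge_2_nat[of p] by (cases "p = 2") auto
  ultimately show ?case using factor assms(3) by auto
qed (use assms(2) in auto)

lemma jacobi_prime_mult:
  "prime p \<Longrightarrow> 2 < p \<Longrightarrow> odd m \<Longrightarrow> jacobi n (p * m) = Legendre n (int p) * jacobi n m"
  by (subst jacobi_mult_right) (auto simp: jacobi_prime odd_pos)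

lemma jacobi_mult_left: "odd m \<Longrightarrow> jacobi (a * b) m = jacobi a m * jacobi b m"
  by (induction m rule: odd_nat_induct) (simp_all add: jacobi_prime_mult Legendre_mult)

lemma jacobi_cong: "odd m \<Longrightarrow> [a = b] (mod int m) \<Longrightarrow> jacobi a m = jacobi b m"
proof (induction m rule: odd_nat_induct)
  case (prime p m)
  have "[a = b] (mod int p)" "[a = b] (mod int m)"
    using prime.prems cong_modulus_mult[of a b "int p" "int m"]
      cong_modulus_mult[of a b "int m" "int p"] by (auto simp: mult.commute)
  thus ?case using prime by (simp add: jacobi_prime_mult Legendre_cong[of a b])
qed auto

lemma jacobi_nonzero: "odd m \<Longrightarrow> coprime a (int m) \<Longrightarrow> \<bar>jacobi a m\<bar> = 1"
proof (induction m rule: odd_nat_induct)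
  case (prime p m)
  have "coprime a (int p)" "coprime a (int m)" using prime.prems by auto
  moreover have "\<not> [a = 0] (mod int p)"
    using coprime_common_divisor[OF \<open>coprime a (int p)\<close>, of "int p"] \<open>prime p\<close>
    by (auto simp: cong_0_iff)
  ultimately show ?case using prime by (auto simp: jacobi_prime_mult abs_mult Legendre_def)
qed auto

lemma jacobi_minus_one: "odd m \<Longrightarrow> jacobi (-1) m = (if m mod 4 = 1 then 1 else -1)"
proof (induction m rule: odd_nat_induct)
  case (prime p m)
  have "p mod 4 = 1 \<or> p mod 4 = 3" "m mod 4 = 1 \<or> m mod 4 = 3"
    using prime.hyps by presburger+
  hence "p * m mod 4 = (if p mod 4 = m mod 4 then 1 else 3)"
    using mod_mult_eq[of p 4 m, symmetric] by (elim disjE) (simp_all only:, simp_all)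
  with \<open>p mod 4 = 1 \<or> p mod 4 = 3\<close> \<open>m mod 4 = 1 \<or> m mod 4 = 3\<close>
  show ?case using prime by (auto simp: jacobi_prime_mult Legendre_minus_one)
qed auto

lemma jacobi_two: "odd m \<Longrightarrow> jacobi 2 m = sgn8 (int m)"
  by (induction m rule: odd_nat_induct)
     (simp_all add: jacobi_prime_mult Legendre_two sgn8_mult, simp add: sgn8_def)

lemma jacobi_one_left: "odd m \<Longrightarrow> jacobi 1 m = 1"
proof (induction m rule: odd_nat_induct)
  case (prime p m)
  have "[1 ^ 2 = (1::int)] (mod int p)" by simp
  hence "QuadRes (int p) 1" unfolding QuadRes_def by blast
  moreover have "\<not> [1 = (0::int)] (mod int p)" using prime.hyps by (simp add: cong_def)
  ultimately show ?case using prime by (simp add: jacobi_prime_mult Legendre_def)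
qed auto

lemma Legendre_jacobi_reciprocity:
  assumes "odd m" "prime q" "2 < q"
  shows "Legendre (int m) (int q) = recip_sign (int m) (int q) * jacobi (int q) m"
  using assms(1)
proof (induction m rule: odd_nat_induct)
  case one
  have "Legendre 1 (int q) = 1"
    using assms jacobi_one_left[of q] jacobi_prime[of q 1] prime_odd_nat by auto
  thus ?case by (simp add: recip_sign_def)
next
  case (prime p m)
  thus ?case
    using assms Legendre_mult[of q "int p" "int m"] Legendre_reciprocity[of p q]
    by (simp add: jacobi_prime_mult recip_sign_mult_left)
qed

text \<open>
  Both sides are multiplicative in each argument, which reduces the law to primes; when the
  arguments have a common factor, both sides vanish.
\<close>
lemma jacobi_reciprocity:
  assumes "odd n" "odd m"
  shows "jacobi (int m) n = recip_sign (int m) (int n) * jacobi (int n) m"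
  using assms(1)
proof (induction n rule: odd_nat_induct)
  case one
  thus ?case using jacobi_one_left[OF assms(2)] by (simp add: recip_sign_def)
next
  case (prime p n)
  thus ?case
    using assms(2) by (simp add: jacobi_prime_mult jacobi_mult_left recip_sign_mult_right
       Legendre_jacobi_reciprocity)
qed

lemma jacobi_uminus:
  assumes "odd m" shows "jacobi (-a) m = (if m mod 4 = 1 then 1 else -1) * jacobi a m"
  using jacobi_mult_left[OF assms, of "-1" a] jacobi_minus_one[OF assms] by simp

text \<open>
  The sign that the Kronecker symbol carries for two negative arguments cancels the extra sign
  of the Jacobi symbol of a negative numerator, so that one formula covers all signs.
\<close>
lemma kronecker_reciprocity:
  assumes "odd n" "odd m"
  shows "kronecker n m = recip_sign n m * jacobi m (nat \<bar>n\<bar>)"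
proof -
  define N M where "N = nat \<bar>n\<bar>" and "M = nat \<bar>m\<bar>"
  have odd: "odd N" "odd M" using assms by (auto simp: N_def M_def even_nat_iff)
  note rec = jacobi_reciprocity[OF odd(2,1)]
  have NM: "n = int N \<or> n = - int N" "m = int M \<or> m = - int M"
    using assms by (auto simp: N_def M_def)
  have r: "N mod 4 = 1 \<or> N mod 4 = 3" "M mod 4 = 1 \<or> M mod 4 = 3"
    using odd by presburger+
  have pos: "N > 0" "M > 0" using odd odd_pos by auto
  have md: "int N mod 4 = int (N mod 4)" "int M mod 4 = int (M mod 4)"
    "(- int N) mod 4 = (if N mod 4 = 1 then 3 else 1)" "(- int M) mod 4 = (if M mod 4 = 1 then 3 else 1)"
    using r by presburger+
  have "(if m < 0 \<and> n < 0 then -1 else 1) * jacobi n M = recip_sign n m * jacobi m N"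
    using NM pos r
    by (elim disjE; simp only: jacobi_uminus[OF odd(1)] jacobi_uminus[OF odd(2)] rec recip_sign_def md; simp)
  thus ?thesis using assms by (simp add: kronecker_odd N_def M_def)
qed

lemma kronecker_mult_left_pos:
  assumes "odd m" "a > 0"
  shows "kronecker (a * n) m = jacobi a (nat \<bar>m\<bar>) * kronecker n m"
  using assms by (simp add: kronecker_odd jacobi_mult_left even_nat_iff mult_less_0_iff)

lemma sgn8_abs: "sgn8 \<bar>m\<bar> = sgn8 m"
proof -
  have "(- m) mod 8 = 1 \<or> (- m) mod 8 = 7 \<longleftrightarrow> m mod 8 = 1 \<or> m mod 8 = 7"
       "(- m) mod 8 = 3 \<or> (- m) mod 8 = 5 \<longleftrightarrow> m mod 8 = 3 \<or> m mod 8 = 5"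
    by presburger+
  thus ?thesis
    by (cases "m < 0") (simp_all only: sgn8_def abs_if insert_iff empty_iff if_True if_False simp_thms)
qed

lemma kronecker_two_mult:
  assumes "odd m"
  shows "kronecker (2 * n) m = sgn8 m * kronecker n m"
  using assms kronecker_mult_left_pos[of m 2 n] jacobi_two[of "nat \<bar>m\<bar>"] sgn8_abs[of m]
  by (simp add: even_nat_iff)

lemma sgn8_odd_sq: "odd m \<Longrightarrow> sgn8 m * sgn8 m = 1"
  using odd_mod8[of m] by (auto simp: sgn8_def)

lemma kronecker_four_mult:
  assumes "odd m"
  shows "kronecker (4 * n) m = kronecker n m"
proof -
  have "kronecker (2 * (2 * n)) m = (sgn8 m * sgn8 m) * kronecker n m"
    using kronecker_two_mult[OF assms, of "2 * n"] kronecker_two_mult[OF assms, of n] by simp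
  thus ?thesis using sgn8_odd_sq[OF assms] by simp
qed

lemma kronecker_two_power_mult:
  assumes "odd m"
  shows "kronecker (2 ^ e * n) m = sgn8 m ^ e * kronecker n m"
proof (induction e)
  case (Suc e)
  thus ?case using kronecker_two_mult[OF assms, of "2 ^ e * n"] by (simp add: mult_ac)
qed auto

text \<open>
  Write c = 2^e c' with c' odd. By reciprocity (c/d) equals sgn8(d)^e times a function of d
  modulo 4 and modulo c'. If e = 2, the power of sgn8 is 1; if e is larger, d + c and d agree
  modulo 8.
\<close>
lemma kronecker_add_right:
  assumes "4 dvd c" "odd d"
  shows "kronecker c (d + c) = kronecker c d"
proof (cases "c = 0")
  case False
  then obtain c' where ec': "c = 2 ^ multiplicity 2 c * c'" "odd c'"
    using multiplicity_decompose'[of c "2::int"] by auto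
  define e where "e = multiplicity 2 c"
  have ec: "c = 2 ^ e * c'" "odd c'"
    using ec' unfolding e_def by blast+
  have e2: "e \<ge> 2"
  proof (rule ccontr)
    assume "\<not> e \<ge> 2"
    hence "e = 0 \<or> e = 1" by auto
    thus False using ec assms(1) by (elim disjE) (simp, presburger)+
  qed
  have odd': "odd (d + c)" using assms by auto
  have K: "kronecker c m = sgn8 m ^ e * recip_sign c' m * jacobi m (nat \<bar>c'\<bar>)" if "odd m" for m
    using that ec kronecker_two_power_mult[of m e c'] kronecker_reciprocity[of c' m] by simp
  have "(d + c) mod 4 = d mod 4" using assms(1) by auto
  hence 1: "recip_sign c' (d + c) = recip_sign c' d" by (simp add: recip_sign_def)
  have 2: "jacobi (d + c) (nat \<bar>c'\<bar>) = jacobi d (nat \<bar>c'\<bar>)"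
    using ec by (intro jacobi_cong) (auto simp: even_nat_iff cong_iff_dvd_diff)
  have 3: "sgn8 (d + c) ^ e = sgn8 d ^ e"
  proof (cases "e = 2")
    case True
    thus ?thesis using sgn8_odd_sq[OF odd'] sgn8_odd_sq[OF assms(2)] by (simp add: power2_eq_square)
  next
    case False
    hence "(2::int) ^ 3 dvd 2 ^ e" using e2 by (intro le_imp_power_dvd) auto
    hence "8 dvd c" using ec by auto
    hence "(d + c) mod 8 = d mod 8" by auto
    thus ?thesis by (simp add: sgn8_def)
  qed
  show ?thesis using K[OF odd'] K[OF assms(2)] 1 2 3 by simp
qed auto

text \<open>
  The Jacobi part depends only on c modulo d, and the convention for two negative arguments
  contributes the sign. The square root in the factor of automorphy of theta changes its branch
  in exactly the same situation.
\<close>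
lemma kronecker_add_left:
  assumes "odd d"
  shows "kronecker (c + k * d) d =
    (if d < 0 \<and> (c < 0 \<longleftrightarrow> c + k * d \<ge> 0) then -1 else 1) * kronecker c d"
proof -
  have "jacobi (c + k * d) (nat \<bar>d\<bar>) = jacobi c (nat \<bar>d\<bar>)"
    using assms by (intro jacobi_cong) (auto simp: even_nat_iff cong_iff_dvd_diff)
  thus ?thesis using assms by (auto simp: kronecker_odd)
qed

lemma kronecker_abs:
  assumes "coprime n m" shows "\<bar>kronecker n m\<bar> = 1"
proof (cases "m = 0")
  case True thus ?thesis by (simp add: kronecker_def)
next
  case False
  have *: "\<bar>kronecker_prime n p\<bar> = 1" if "p \<in># prime_factorization (nat \<bar>m\<bar>)" for p
  proof -
    have p: "prime p" "int p dvd m" using that False by (auto simp: in_prime_factors_iff)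
    have nd: "\<not> int p dvd n"
      using p coprime_common_divisor[OF assms, of "int p"] by auto
    show ?thesis
    proof (cases "p = 2")
      case True
      thus ?thesis using odd_mod8[of n] nd by (auto simp: kronecker_prime_def)
    next
      case False
      thus ?thesis using nd by (auto simp: kronecker_prime_def Legendre_def cong_0_iff)
    qed
  qed
  have "\<bar>\<Prod>p\<in>#A. kronecker_prime n p\<bar> = 1" if "\<And>p. p \<in># A \<Longrightarrow> \<bar>kronecker_prime n p\<bar> = 1" for A
    using that by (induction A) (auto simp: abs_mult)
  from this[OF *] show ?thesis using False by (auto simp: kronecker_def abs_mult)
qed

text \<open>
  Conjugates of T^4 have lower row (-4c^2, 1 + 4ac); this value makes their factor of automorphy
  a mere square root.
\<close>
lemma kronecker_neg_square:
  assumes "m mod 4 = 1" "coprime c m"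
  shows "kronecker (- 4 * c\<^sup>2) m = 1"
proof (cases "c = 0")
  case True
  hence "m = 1 \<or> m = -1" using assms(2) by auto
  thus ?thesis using True by (auto simp: kronecker_odd)
next
  case False
  define M where "M = nat \<bar>m\<bar>"
  have oddm: "odd m" using assms(1) by presburger
  hence oddM: "odd M" by (simp add: M_def even_nat_iff)
  have cop: "coprime (2 * c) (int M)" using assms(2) oddm by (auto simp: M_def)
  have eq: "- 4 * c\<^sup>2 = - (2 * c * (2 * c))" by (simp add: power2_eq_square)
  have "jacobi (- 4 * c\<^sup>2) M = (if M mod 4 = 1 then 1 else -1) * (jacobi (2 * c) M * jacobi (2 * c) M)"
    unfolding eq by (simp only: jacobi_uminus[OF oddM] jacobi_mult_left[OF oddM])
  also have "jacobi (2 * c) M * jacobi (2 * c) M = 1"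
    using jacobi_nonzero[OF oddM cop] by (metis abs_mult_self_eq mult_1)
  finally have J: "jacobi (- 4 * c\<^sup>2) M = (if M mod 4 = 1 then 1 else -1)" by simp
  have neg: "- 4 * c\<^sup>2 < 0" using False by simp
  have "\<bar>m\<bar> mod 4 = 1 \<longleftrightarrow> m > 0"
    using assms(1) by presburger
  moreover have "int M = \<bar>m\<bar>" by (simp add: M_def)
  hence "int (M mod 4) = \<bar>m\<bar> mod 4" using zmod_int[of M 4] by simp
  ultimately have "M mod 4 = 1 \<longleftrightarrow> m > 0" by auto
  thus ?thesis using J neg oddm unfolding kronecker_odd[OF oddm] M_def[symmetric] by auto
qed

section \<open>Infinite products in q\<close>

lemma holomorphic_prodinf:
  fixes g :: "nat \<Rightarrow> complex \<Rightarrow> complex"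
  assumes S: "open S" and hol: "\<And>n. g n holomorphic_on S"
    and bound: "\<And>x. x \<in> S \<Longrightarrow> \<exists>r>0. cball x r \<subseteq> S \<and>
                  (\<exists>M. summable M \<and> (\<forall>n. \<forall>y\<in>cball x r. norm (g n y) \<le> M n))"
  shows "(\<lambda>x. \<Prod>n. 1 + g n x) holomorphic_on S"
proof (rule holomorphic_uniform_sequence[OF S])
  show "(\<lambda>x. \<Prod>n<N. 1 + g n x) holomorphic_on S" for N
    by (intro holomorphic_intros hol)
next
  fix x assume "x \<in> S"
  from bound[OF this] obtain r M where r: "r > 0" "cball x r \<subseteq> S" and M: "summable M"
    "\<And>n y. y \<in> cball x r \<Longrightarrow> norm (g n y) \<le> M n" by blast
  have "uniformly_convergent_on (cball x r) (\<lambda>N y. \<Sum>n<N. norm (g n y))"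
    by (rule Weierstrass_m_test'[OF _ M(1)]) (use M(2) in auto)
  moreover have "continuous_on (cball x r) (g n)" for n
    using hol holomorphic_on_imp_continuous_on holomorphic_on_subset r(2) by blast
  ultimately have "uniformly_convergent_on (cball x r) (\<lambda>N y. \<Prod>n<N. 1 + g n y)"
    by (intro uniformly_convergent_on_prod) auto
  then obtain l where l: "uniform_limit (cball x r) (\<lambda>N y. \<Prod>n<N. 1 + g n y) l sequentially"
    by (auto simp: uniformly_convergent_on_def)
  have "l y = (\<Prod>n. 1 + g n y)" if y: "y \<in> cball x r" for y
  proof -
    have "summable (\<lambda>n. norm (g n y))"
      by (rule summable_comparison_test'[OF M(1), of 0]) (use M(2) y in auto)
    hence "convergent_prod (\<lambda>n. 1 + g n y)"
      by (intro abs_convergent_prod_imp_convergent_prod) (simp add: abs_convergent_prod_conv_summable)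
    hence "(\<lambda>n. \<Prod>i<n. 1 + g i y) \<longlonglongrightarrow> (\<Prod>n. 1 + g n y)"
      using convergent_prod_LIMSEQ LIMSEQ_lessThan_iff_atMost[of "\<lambda>A. \<Prod>i\<in>A. 1 + g i y"] by auto
    moreover have "(\<lambda>n. \<Prod>i<n. 1 + g i y) \<longlonglongrightarrow> l y"
      using tendsto_uniform_limitI[OF l y] .
    ultimately show ?thesis using LIMSEQ_unique by blast
  qed
  hence "uniform_limit (cball x r) (\<lambda>N y. \<Prod>n<N. 1 + g n y) (\<lambda>y. \<Prod>n. 1 + g n y) sequentially"
    using l unfolding uniform_limit_iff by simp
  thus "\<exists>d>0. cball x d \<subseteq> S \<and> uniform_limit (cball x d) (\<lambda>N y. \<Prod>n<N. 1 + g n y) (\<lambda>y. \<Prod>n. 1 + g n y) sequentially"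
    using r by blast
qed

definition qpoch :: "complex \<Rightarrow> complex \<Rightarrow> complex" where
  "qpoch q w = (\<Prod>n. 1 - q ^ n * w)"

lemma qpoch_convergent:
  fixes q w :: complex
  assumes "norm q < 1"
  shows "convergent_prod (\<lambda>n. 1 - q ^ n * w)"
proof (rule abs_convergent_prod_imp_convergent_prod)
  have "summable (\<lambda>n. norm q ^ n * norm w)"
    using assms by (intro summable_mult2 summable_geometric) auto
  thus "abs_convergent_prod (\<lambda>n. 1 - q ^ n * w)"
    by (simp add: abs_convergent_prod_conv_summable norm_mult norm_power)
qed

lemma qpoch_LIMSEQ:
  assumes "norm q < 1"
  shows "(\<lambda>n. \<Prod>i<n. 1 - q ^ i * w) \<longlonglongrightarrow> qpoch q w"
  using convergent_prod_LIMSEQ[OF qpoch_convergent[OF assms, of w]]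
    LIMSEQ_lessThan_iff_atMost[of "\<lambda>A. \<Prod>i\<in>A. 1 - q ^ i * w"] by (auto simp: qpoch_def)

lemma qpoch_rec:
  assumes "norm q < 1"
  shows "qpoch q w = (1 - w) * qpoch q (q * w)"
proof -
  have "(\<lambda>n. \<Prod>i<Suc n. 1 - q ^ i * w) \<longlonglongrightarrow> qpoch q w"
    using qpoch_LIMSEQ[OF assms] by (rule LIMSEQ_Suc)
  also have "(\<lambda>n. \<Prod>i<Suc n. 1 - q ^ i * w) = (\<lambda>n. (1 - w) * (\<Prod>i<n. 1 - q ^ i * (q * w)))"
    by (subst prod.lessThan_Suc_shift) (simp add: mult_ac)
  finally show ?thesis
    by (rule LIMSEQ_unique) (intro tendsto_mult tendsto_const qpoch_LIMSEQ assms)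
qed

text \<open>
  The factors with even and with odd exponent of q are collected separately.
\<close>
lemma qpoch_split:
  assumes "norm q < 1"
  shows "qpoch q w = qpoch (q\<^sup>2) w * qpoch (q\<^sup>2) (q * w)"
proof -
  have q2: "norm (q\<^sup>2) < 1" using assms by (simp add: norm_power power_less_one_iff)
  have "(\<Prod>i<2 * n. 1 - q ^ i * w) = (\<Prod>i<n. 1 - (q\<^sup>2) ^ i * w) * (\<Prod>i<n. 1 - (q\<^sup>2) ^ i * (q * w))" for n
    by (induction n) (simp_all add: power_mult[symmetric] mult_ac)
  moreover have "(\<lambda>n. \<Prod>i<2 * n. 1 - q ^ i * w) \<longlonglongrightarrow> qpoch q w"
    using LIMSEQ_subseq_LIMSEQ[OF qpoch_LIMSEQ[OF assms, of w], of "\<lambda>n. 2 * n"]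
    by (simp add: strict_mono_def o_def)
  ultimately have "(\<lambda>n. (\<Prod>i<n. 1 - (q\<^sup>2) ^ i * w) * (\<Prod>i<n. 1 - (q\<^sup>2) ^ i * (q * w))) \<longlonglongrightarrow> qpoch q w"
    by simp
  thus ?thesis
    by (rule LIMSEQ_unique) (intro tendsto_mult qpoch_LIMSEQ q2)
qed

lemma qpoch_mult_minus:
  assumes "norm q < 1"
  shows "qpoch q w * qpoch q (-w) = qpoch (q\<^sup>2) (w\<^sup>2)"
proof -
  have "qpoch q w * qpoch q (-w) = (\<Prod>n. (1 - q ^ n * w) * (1 - q ^ n * (-w)))"
    unfolding qpoch_def by (intro prodinf_mult qpoch_convergent assms)
  also have "\<dots> = qpoch (q\<^sup>2) (w\<^sup>2)"
    unfolding qpoch_def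
    by (intro prodinf_cong) (simp add: algebra_simps power2_eq_square power_mult_distrib)
  finally show ?thesis .
qed

lemma qpoch_eq_0_iff:
  assumes "norm q < 1"
  shows "qpoch q w = 0 \<longleftrightarrow> (\<exists>n. q ^ n * w = 1)"
proof -
  have "qpoch q w = 0 \<longleftrightarrow> 0 \<in> range (\<lambda>n. 1 - q ^ n * w)"
    unfolding qpoch_def
    by (rule has_prod_eq_0_iff[OF convergent_prod_has_prod[OF qpoch_convergent[OF assms]]])
  also have "\<dots> \<longleftrightarrow> (\<exists>n. q ^ n * w = 1)"
    unfolding image_iff by (metis UNIV_I eq_iff_diff_eq_0)
  finally show ?thesis .
qed

lemma qpoch_holomorphic:
  assumes "norm q < 1"
  shows "qpoch q holomorphic_on UNIV"
proof -
  have "(\<lambda>w. \<Prod>n. 1 + (- (q ^ n * w))) holomorphic_on UNIV"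
  proof (rule holomorphic_prodinf)
    fix x :: complex
    have "summable (\<lambda>n. norm q ^ n * (norm x + 1))"
      using assms by (intro summable_mult2 summable_geometric) auto
    moreover have "norm (- (q ^ n * y)) \<le> norm q ^ n * (norm x + 1)" if "y \<in> cball x 1" for n y
    proof -
      have "norm y \<le> norm x + 1"
        using that norm_triangle_ineq2[of y x] by (simp add: dist_norm norm_minus_commute)
      thus ?thesis by (simp add: norm_mult norm_power mult_left_mono)
    qed
    ultimately show "\<exists>r>0. cball x r \<subseteq> UNIV \<and> (\<exists>M. summable M \<and> (\<forall>n. \<forall>y\<in>cball x r. norm (- (q ^ n * y)) \<le> M n))"
      by (intro exI[of _ 1] conjI exI[of _ "\<lambda>n. norm q ^ n * (norm x + 1)"]) simp_all
  next
    show "open (UNIV::complex set)" by simp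
    show "(\<lambda>w. - (q ^ n * w)) holomorphic_on UNIV" for n by (intro holomorphic_intros)
  qed
  moreover have "qpoch q = (\<lambda>w. \<Prod>n. 1 + (- (q ^ n * w)))" unfolding qpoch_def by simp
  ultimately show ?thesis by (simp only:)
qed

lemma qpoch_holomorphic' [holomorphic_intros]:
  assumes "norm q < 1" "f holomorphic_on A"
  shows "(\<lambda>z. qpoch q (f z)) holomorphic_on A"
proof -
  have "(qpoch q \<circ> f) holomorphic_on A"
    by (rule holomorphic_on_compose_gen[OF assms(2) qpoch_holomorphic[OF assms(1)]]) simp
  thus ?thesis by (simp only: o_def)
qed

text \<open>
  Up to the factor exp(\<pi>i\<tau>/12) this is eta; it has nothing to do with the totient
  function.
\<close>
definition euler_phi :: "complex \<Rightarrow> complex" where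
  "euler_phi q = qpoch q q"

lemma euler_phi_holomorphic: "euler_phi holomorphic_on ball 0 1"
proof -
  have "(\<lambda>w. \<Prod>n. 1 + (- (w ^ n * w))) holomorphic_on ball 0 1"
  proof (rule holomorphic_prodinf)
    fix x :: complex assume x: "x \<in> ball 0 1"
    then obtain r where r: "r > 0" "cball x r \<subseteq> ball 0 1"
      by (metis open_ball open_contains_cball)
    have "compact (norm ` cball x r)" by (intro compact_continuous_image continuous_intros) auto
    moreover have "norm ` cball x r \<noteq> {}" using r by auto
    ultimately obtain s where s: "s \<in> cball x r" "\<And>y. y \<in> cball x r \<Longrightarrow> norm y \<le> norm s"
      using compact_attains_sup[of "norm ` cball x r"] by blast
    have "norm s < 1" using s(1) r(2) by auto
    hence "summable (\<lambda>n. norm s ^ n * 1)"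
      by (intro summable_mult2 summable_geometric) auto
    moreover have "norm (- (y ^ n * y)) \<le> norm s ^ n * 1" if y: "y \<in> cball x r" for n y
    proof -
      have "norm y < 1" using y r(2) by auto
      thus ?thesis using mult_mono[of "norm y ^ n" "norm s ^ n" "norm y" 1] s(2)[OF y] power_mono[of "norm y" "norm s" n]
        by (simp add: norm_mult norm_power)
    qed
    ultimately show "\<exists>r>0. cball x r \<subseteq> ball 0 1 \<and> (\<exists>M. summable M \<and> (\<forall>n. \<forall>y\<in>cball x r. norm (- (y ^ n * y)) \<le> M n))"
      using r by blast
  next
    show "open (ball (0::complex) 1)" by simp
    show "(\<lambda>w. - (w ^ n * w)) holomorphic_on ball 0 1" for n by (intro holomorphic_intros)
  qed
  moreover have "euler_phi = (\<lambda>w. \<Prod>n. 1 + (- (w ^ n * w)))"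
    by (rule ext) (simp add: qpoch_def euler_phi_def)
  ultimately show ?thesis by (simp only:)
qed

lemma euler_phi_0 [simp]: "euler_phi 0 = 1"
proof -
  have "qpoch 0 0 = (\<Prod>n::nat. 1)" unfolding qpoch_def by (intro prodinf_cong) auto
  thus ?thesis by (simp add: euler_phi_def)
qed

lemma euler_phi_nonzero: "norm q < 1 \<Longrightarrow> euler_phi q \<noteq> 0"
proof -
  assume q: "norm q < 1"
  have "norm (q ^ n * q) < 1" for n
    using q power_less_one_iff[of "norm q" "Suc n"] by (simp add: norm_mult norm_power mult.commute)
  hence "q ^ n * q \<noteq> 1" for n by (metis less_irrefl norm_one)
  thus ?thesis using qpoch_eq_0_iff[OF q, of q] by (simp add: euler_phi_def)
qed

text \<open>
  This is the product of (1 + q^n)(1 - q^(n-1/2))(1 + q^(n-1/2)) over all positive n. Multiplied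
  by the product of 1 - q^n it reproduces that product, because q-powers with odd and even
  exponents combine.
\<close>
lemma qpoch_half_periods_product:
  assumes "norm q < 1" "p\<^sup>2 = q"
  shows "qpoch q (-q) * qpoch q p * qpoch q (-p) = 1"
proof -
  have q2: "norm (q\<^sup>2) < 1" using assms by (simp add: norm_power power_less_one_iff)
  have "qpoch q (-q) * (qpoch q p * qpoch q (-p)) * euler_phi q
       = qpoch q q * qpoch q (-q) * (qpoch q p * qpoch q (-p))"
    by (simp add: euler_phi_def mult_ac)
  also have "\<dots> = qpoch (q\<^sup>2) (q\<^sup>2) * qpoch (q\<^sup>2) q"
    by (simp add: qpoch_mult_minus assms)
  also have "\<dots> = euler_phi q"
    using qpoch_split[OF assms(1), of q] by (simp add: euler_phi_def power2_eq_square mult_ac)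
  finally show ?thesis using euler_phi_nonzero[OF assms(1)] by (simp add: mult_ac)
qed

text \<open>
  In terms of eta this relates the values at \<tau>/2, (\<tau>+1)/2, 2\<tau> and \<tau>, and so
  gives the effect of a translation on functions of \<tau>/2.
\<close>
lemma euler_phi_neg_sqrt:
  assumes "norm q < 1" "p\<^sup>2 = q"
  shows "euler_phi p * euler_phi (-p) * euler_phi (q\<^sup>2) = euler_phi q ^ 3"
proof -
  have p: "norm p < 1" using assms by (metis norm_power power_less_one_iff norm_ge_zero zero_neq_numeral)
  have 1: "euler_phi p = qpoch q p * euler_phi q"
    using qpoch_split[OF p, of p] assms(2) by (simp add: euler_phi_def power2_eq_square)
  have 2: "euler_phi (-p) = qpoch q (-p) * euler_phi q"
    using qpoch_split[of "-p" "-p"] p assms(2) by (simp add: euler_phi_def power2_eq_square)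
  have 3: "euler_phi q = qpoch (q\<^sup>2) q * euler_phi (q\<^sup>2)"
    using qpoch_split[OF assms(1), of q] by (simp add: euler_phi_def power2_eq_square)
  have 4: "qpoch q p * qpoch q (-p) = qpoch (q\<^sup>2) q"
    by (simp add: qpoch_mult_minus assms)
  have "euler_phi p * euler_phi (-p) * euler_phi (q\<^sup>2) =
        (qpoch q p * qpoch q (-p)) * euler_phi (q\<^sup>2) * euler_phi q ^ 2"
    unfolding 1 2 by (simp add: power2_eq_square)
  also have "\<dots> = euler_phi q ^ 3"
    unfolding 4 3[symmetric] by (simp add: power2_eq_square power3_eq_cube)
  finally show ?thesis .
qed

text \<open>
  Up to an elementary factor this is the product side of the Jacobi triple product. It is used
  for its zeros, which are the powers of q, and its quasi-periodicity under w \<rightarrow> qw.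
\<close>
definition jtheta :: "complex \<Rightarrow> complex \<Rightarrow> complex" where
  "jtheta q w = qpoch q w * qpoch q (q / w)"

lemma jtheta_shift:
  assumes "norm q < 1" "q \<noteq> 0" "w \<noteq> 0"
  shows "jtheta q (q * w) = - jtheta q w / w"
proof -
  have "qpoch q (1 / w) = (1 - 1 / w) * qpoch q (q / w)"
    using qpoch_rec[OF assms(1), of "1 / w"] by simp
  moreover have "qpoch q w = (1 - w) * qpoch q (q * w)"
    by (rule qpoch_rec[OF assms(1)])
  ultimately show ?thesis
    using assms by (simp add: jtheta_def) (simp add: field_simps)
qed

lemma jtheta_eq_0:
  assumes "norm q < 1" "q \<noteq> 0" "w \<noteq> 0" "jtheta q w = 0"
  shows "\<exists>n::int. w = q powi n"
proof -
  from assms(4) consider "qpoch q w = 0" | "qpoch q (q / w) = 0"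
    by (auto simp: jtheta_def)
  thus ?thesis
  proof cases
    case 1
    then obtain n where "q ^ n * w = 1" using qpoch_eq_0_iff[OF assms(1)] by auto
    hence "w = q powi (- int n)" using assms by (simp add: power_int_minus field_simps)
    thus ?thesis by blast
  next
    case 2
    then obtain n where "q ^ n * (q / w) = 1" using qpoch_eq_0_iff[OF assms(1)] by auto
    hence "w = q powi (int (Suc n))" using assms by (simp add: power_int_def field_simps nat_add_distrib)
    thus ?thesis by blast
  qed
qed

section \<open>Inversion of the theta product\<close>

abbreviation ee :: "complex \<Rightarrow> complex" where
  "ee z \<equiv> exp (2 * of_real pi * \<i> * z)"

lemma ee_add: "ee (z + w) = ee z * ee w"
  by (simp add: exp_add ring_distribs)

lemma norm_ee: "norm (ee z) = exp (- 2 * pi * Im z)"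
  by (simp add: norm_exp_eq_Re)

lemma norm_ee_less_1: "Im z > 0 \<Longrightarrow> norm (ee z) < 1"
  by (simp add: norm_ee)

lemma ee_eq_1_iff: "ee z = 1 \<longleftrightarrow> z \<in> \<int>"
proof
  assume "ee z = 1"
  then obtain n :: int where "Re (2 * of_real pi * \<i> * z) = 0" "Im (2 * of_real pi * \<i> * z) = of_int (2 * n) * pi"
    by (auto simp: exp_eq_1)
  hence "Im z = 0" "Re z = of_int n" by auto
  hence "z = of_int n" by (simp add: complex_eq_iff)
  thus "z \<in> \<int>" by simp
next
  assume "z \<in> \<int>"
  then obtain n where "z = of_int n" by (auto elim: Ints_cases)
  thus "ee z = 1" unfolding exp_eq_1 by (auto intro!: exI[of _ n])
qed

lemma Im_neg_inverse_pos:
  assumes "Im \<tau> > 0" shows "Im (- 1 / \<tau>) > 0"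
proof -
  have "Im (- 1 / \<tau>) = Im \<tau> / ((Re \<tau>)\<^sup>2 + (Im \<tau>)\<^sup>2)"
    by (simp add: Im_divide)
  moreover have "(Re \<tau>)\<^sup>2 + (Im \<tau>)\<^sup>2 > 0"
    using assms by (simp add: add_nonneg_pos)
  ultimately show ?thesis using assms by simp
qed

lemma periodic_int_shift:
  fixes f :: "complex \<Rightarrow> 'a"
  assumes "\<And>z. f (z + a) = f z"
  shows "f (z + of_int n * a) = f z"
proof (induction n rule: int_induct[where k = 0])
  case (step1 i)
  show ?case using assms[of "z + of_int i * a"] step1 by (simp add: algebra_simps)
next
  case (step2 i)
  show ?case using assms[of "z + of_int (i - 1) * a"] step2 by (simp add: algebra_simps)
qed auto

text \<open>
  All values are attained on a compact period parallelogram, so the theorem of Liouville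
  applies.
\<close>
lemma elliptic_entire_constant:
  assumes H: "H holomorphic_on UNIV" and \<tau>: "Im \<tau> > 0"
    and H1: "\<And>z. H (z + 1) = H z" and H\<tau>: "\<And>z. H (z + \<tau>) = H z"
  shows "H z = H w"
proof -
  define P where "P = (\<lambda>(a, b). of_real a + of_real b * \<tau>) ` ({0..1::real} \<times> {0..1::real})"
  have "compact P"
    unfolding P_def by (intro compact_continuous_image compact_Times)
      (auto intro!: continuous_intros simp: case_prod_unfold)
  moreover have "continuous_on P H"
    using H holomorphic_on_imp_continuous_on continuous_on_subset by blast
  ultimately have "compact (H ` P)" by (rule compact_continuous_image[rotated])
  hence "bounded (H ` P)" by (rule compact_imp_bounded)
  moreover have "range H \<subseteq> H ` P"
  proof
    fix y assume "y \<in> range H"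
    then obtain z where y: "y = H z" by auto
    define b where "b = Im z / Im \<tau>"
    define a where "a = Re z - b * Re \<tau>"
    have z: "z = of_real a + of_real b * \<tau>"
      using \<tau> by (simp add: complex_eq_iff a_def b_def)
    define w where "w = of_real (frac a) + of_real (frac b) * \<tau>"
    have "z = w + of_int \<lfloor>a\<rfloor> * 1 + of_int \<lfloor>b\<rfloor> * \<tau>"
      unfolding z w_def frac_def by (simp add: algebra_simps)
    hence "H z = H w"
      using periodic_int_shift[of H 1 w "\<lfloor>a\<rfloor>", OF H1]
        periodic_int_shift[of H \<tau> "w + of_int \<lfloor>a\<rfloor> * 1" "\<lfloor>b\<rfloor>", OF H\<tau>] by simp
    moreover have "w \<in> P"
      unfolding P_def w_def using less_imp_le[OF frac_lt_1[of a]] less_imp_le[OF frac_lt_1[of b]]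
      by (intro image_eqI[of _ _ "(frac a, frac b)"]) auto
    ultimately show "y \<in> H ` P" using y by blast
  qed
  ultimately have "bounded (range H)" using bounded_subset by blast
  from Liouville_theorem[OF H this] show ?thesis
    by (auto simp: constant_on_def)
qed

lemma one_minus_exp_quotient_tendsto:
  fixes a b :: complex
  assumes "b \<noteq> 0"
  shows "((\<lambda>z. (1 - exp (a * z)) / (1 - exp (b * z))) \<longlongrightarrow> a / b) (at 0)"
proof -
  have *: "((\<lambda>z. (1 - exp (c * z)) / z) \<longlongrightarrow> - c) (at 0)" for c :: complex
  proof -
    have "((\<lambda>z. 1 - exp (c * z)) has_field_derivative (- c)) (at 0)"
      by (auto intro!: derivative_eq_intros)
    thus ?thesis by (simp add: has_field_derivative_iff)
  qed
  have "((\<lambda>z. ((1 - exp (a * z)) / z) / ((1 - exp (b * z)) / z)) \<longlongrightarrow> - a / - b) (at 0)"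
    by (intro tendsto_divide *) (use assms in auto)
  also have "(\<lambda>z. ((1 - exp (a * z)) / z) / ((1 - exp (b * z)) / z)) = (\<lambda>z. (1 - exp (a * z)) / (1 - exp (b * z)))"
    by (rule ext) auto
  finally show ?thesis by simp
qed

lemma entire_isCont: "f holomorphic_on UNIV \<Longrightarrow> isCont f z"
  using holomorphic_on_imp_continuous_on[of f UNIV] by (simp add: continuous_on_eq_continuous_at)

lemma jtheta_factor:
  assumes "norm q < 1"
  shows "jtheta q w = (1 - w) * (qpoch q (q * w) * qpoch q (q / w))"
  using qpoch_rec[OF assms, of w] by (simp add: jtheta_def)

text \<open>
  As functions of z, both theta products have simple zeros exactly at the points m + n\<tau>.
  The quadratic exponent Q makes the factors that they acquire under z \<rightarrow> z + 1 and z
  \<rightarrow> z + \<tau> agree, so that the quotient is a doubly periodic entire function. The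
  constant is its limit at z = 0.
\<close>
lemma jtheta_imaginary_transformation:
  assumes \<tau>: "Im \<tau> > 0"
  defines "q \<equiv> ee \<tau>" and "q' \<equiv> ee (- 1 / \<tau>)"
  defines "Q \<equiv> (\<lambda>z. - (pi * \<i> * z\<^sup>2 / \<tau>) + pi * \<i> * z * (1 - 1 / \<tau>))"
  assumes z: "jtheta q (ee z) \<noteq> 0"
  shows "exp (Q z) * jtheta q' (ee (z / \<tau>)) =
         euler_phi q' ^ 2 / (\<tau> * euler_phi q ^ 2) * jtheta q (ee z)"
proof -
  have \<tau>0: "\<tau> \<noteq> 0" using \<tau> by auto
  have q: "norm q < 1" "q \<noteq> 0" and q': "norm q' < 1" "q' \<noteq> 0"
    unfolding q_def q'_def using norm_ee_less_1[OF \<tau>] norm_ee_less_1[OF Im_neg_inverse_pos[OF \<tau>]] by auto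
  define F where "F = (\<lambda>z. jtheta q (ee z))"
  define G where "G = (\<lambda>z. jtheta q' (ee (z / \<tau>)))"
  define h where "h = (\<lambda>z. exp (Q z) * G z / F z)"
  define K where "K = euler_phi q' ^ 2 / (\<tau> * euler_phi q ^ 2)"
  define H where "H = (\<lambda>z. if F z = 0 then K else h z)"
  define U where "U = (\<lambda>z. qpoch q (q * ee z) * qpoch q (q / ee z))"
  define V where "V = (\<lambda>z. qpoch q' (q' * ee (z / \<tau>)) * qpoch q' (q' / ee (z / \<tau>)))"
  have FU: "F z = (1 - ee z) * U z" for z
    unfolding F_def U_def by (rule jtheta_factor[OF q(1)])
  have GV: "G z = (1 - ee (z / \<tau>)) * V z" for z
    unfolding G_def V_def by (rule jtheta_factor[OF q'(1)])
  have Fhol: "F holomorphic_on A" and Uhol: "U holomorphic_on A" for A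
    unfolding F_def U_def jtheta_def by (auto intro!: holomorphic_intros q)
  have Ghol: "G holomorphic_on A" and Vhol: "V holomorphic_on A" for A
    unfolding G_def V_def jtheta_def using \<tau>0 by (auto intro!: holomorphic_intros q')
  have Qhol: "Q holomorphic_on A" for A
    unfolding Q_def using \<tau>0 by (auto intro!: holomorphic_intros)
  have F1: "F (z + 1) = F z" for z
    using ee_eq_1_iff[of 1] by (simp add: F_def ee_add)
  have F\<tau>: "F (z + \<tau>) = - F z / ee z" for z
  proof -
    have "ee (z + \<tau>) = q * ee z" by (simp add: q_def ee_add)
    thus ?thesis using jtheta_shift[OF q, of "ee z"] by (simp add: F_def)
  qed
  have G\<tau>: "G (z + \<tau>) = G z" for z
  proof -
    have "(z + \<tau>) / \<tau> = z / \<tau> + 1" using \<tau>0 by (simp add: field_simps)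
    thus ?thesis using ee_eq_1_iff[of 1] by (simp only: G_def ee_add) simp
  qed
  have G1: "G (z + 1) = - ee ((z + 1) / \<tau>) * G z" for z
  proof -
    have "q' * ee ((z + 1) / \<tau>) = ee (- 1 / \<tau> + (z + 1) / \<tau>)" unfolding q'_def by (rule ee_add[symmetric])
    also have "- 1 / \<tau> + (z + 1) / \<tau> = z / \<tau>" using \<tau>0 by (simp add: field_simps)
    finally show ?thesis using jtheta_shift[OF q', of "ee ((z + 1) / \<tau>)"] by (simp add: G_def)
  qed
  have h1: "h (z + 1) = h z" for z
  proof -
    have "Q (z + 1) + 2 * of_real pi * \<i> * ((z + 1) / \<tau>) = Q z + of_real pi * \<i>"
      using \<tau>0 by (simp add: Q_def field_simps power2_eq_square)
    hence "exp (Q (z + 1)) * ee ((z + 1) / \<tau>) = - exp (Q z)"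
      by (simp add: exp_add[symmetric]) (simp add: exp_add)
    moreover have "h (z + 1) = - (exp (Q (z + 1)) * ee ((z + 1) / \<tau>)) * G z / F z"
      unfolding h_def F1 G1 by simp
    ultimately show ?thesis by (simp only: h_def minus_minus)
  qed
  have h\<tau>: "h (z + \<tau>) = h z" for z
  proof -
    have "Q (z + \<tau>) = Q z - 2 * of_real pi * \<i> * z - of_real pi * \<i>"
      using \<tau>0 by (simp add: Q_def field_simps power2_eq_square)
    hence "exp (Q (z + \<tau>)) = - exp (Q z) / ee z"
      by (simp add: exp_diff)
    thus ?thesis by (simp add: h_def F\<tau> G\<tau>)
  qed
  have H1: "H (z + 1) = H z" and H\<tau>: "H (z + \<tau>) = H z" for z
    by (simp_all add: H_def F1 F\<tau> h1 h\<tau>)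
  have U0: "U 0 = euler_phi q ^ 2" "V 0 = euler_phi q' ^ 2"
    by (simp_all add: U_def V_def euler_phi_def power2_eq_square)
  have e0: "euler_phi q \<noteq> 0" using euler_phi_nonzero q by blast
  (* near 0 the only zero of F is that of 1 - ee z, so the singularity of the quotient is removable *)
  obtain r where r: "r > 0" "r \<le> 1" "\<And>z. z \<in> ball 0 r \<Longrightarrow> U z \<noteq> 0"
  proof -
    have "continuous (at 0) U"
      using Uhol by (rule entire_isCont)
    hence "\<forall>\<^sub>F z in at 0. U z \<noteq> 0"
      using U0 e0 by (intro tendsto_imp_eventually_ne[of _ "U 0"]) (auto simp: isCont_def)
    then obtain d where "d > 0" "\<And>z. z \<noteq> 0 \<Longrightarrow> dist z 0 < d \<Longrightarrow> U z \<noteq> 0"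
      unfolding eventually_at by auto
    thus ?thesis using that[of "min d 1"] U0 e0
      by (metis dist_commute mem_ball min.cobounded2 min_less_iff_conj power_not_zero zero_less_one)
  qed
  have Fnz: "F z \<noteq> 0" if "z \<in> ball 0 r" "z \<noteq> 0" for z
  proof -
    have "z \<notin> \<int>"
    proof
      assume "z \<in> \<int>"
      then obtain n where n: "z = of_int n" by (auto elim: Ints_cases)
      with that r show False by (auto simp: n)
    qed
    thus ?thesis using FU r that ee_eq_1_iff[of z] by auto
  qed
  have "h \<midarrow>0\<rightarrow> K"
  proof -
    have cont: "U \<midarrow>0\<rightarrow> U 0" "V \<midarrow>0\<rightarrow> V 0" "(\<lambda>z. exp (Q z)) \<midarrow>0\<rightarrow> exp (Q 0)"
      using entire_isCont[OF Uhol, of 0] entire_isCont[OF Vhol, of 0]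
        entire_isCont[OF holomorphic_on_exp'[OF Qhol], of 0] by (simp_all add: isCont_def)
    have lim: "((\<lambda>z. (1 - exp (2 * of_real pi * \<i> / \<tau> * z)) / (1 - ee z)) \<longlongrightarrow>
            (2 * of_real pi * \<i> / \<tau>) / (2 * of_real pi * \<i>)) (at 0)"
      by (rule one_minus_exp_quotient_tendsto) auto
    have "((\<lambda>z. exp (Q z) * ((1 - exp (2 * of_real pi * \<i> / \<tau> * z)) / (1 - ee z)) * (V z / U z)) \<longlongrightarrow>
             exp (Q 0) * ((2 * of_real pi * \<i> / \<tau>) / (2 * of_real pi * \<i>)) * (V 0 / U 0)) (at 0)"
      by (rule tendsto_mult[OF tendsto_mult[OF cont(3) lim] tendsto_divide[OF cont(2,1)]])
         (use U0 e0 in simp)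
    also have "exp (Q 0) * ((2 * of_real pi * \<i> / \<tau>) / (2 * of_real pi * \<i>)) * (V 0 / U 0) = K"
      using \<tau>0 by (simp add: Q_def U0 K_def)
    also have "(\<lambda>z. exp (Q z) * ((1 - exp (2 * of_real pi * \<i> / \<tau> * z)) / (1 - ee z)) * (V z / U z)) = h"
      by (rule ext) (simp add: h_def FU GV mult_ac)
    finally show ?thesis .
  qed
  moreover have "h holomorphic_on ball 0 r - {0}"
    unfolding h_def using Fnz by (intro holomorphic_intros Qhol Ghol Fhol) auto
  ultimately have "(\<lambda>y. if y = 0 then K else h y) holomorphic_on ball 0 r"
    by (intro removable_singularity) auto
  hence Hball: "H holomorphic_on ball 0 r"
    by (rule holomorphic_transform) (use Fnz FU[of 0] in \<open>auto simp: H_def\<close>)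
  have F0: "F 0 = 0" by (simp add: FU)
  have lattice: "\<exists>m n::int. w = of_int m + of_int n * \<tau>" if "F w = 0" for w
  proof -
    from that jtheta_eq_0[OF q, of "ee w"] obtain n :: int where "ee w = q powi n"
      by (auto simp: F_def)
    also have "\<dots> = ee (of_int n * \<tau>)"
      unfolding q_def by (simp add: exp_power_int mult_ac)
    finally have "ee (w - of_int n * \<tau>) = 1" by (simp add: exp_diff right_diff_distrib)
    then obtain m where "w - of_int n * \<tau> = of_int m"
      using ee_eq_1_iff by (auto elim: Ints_cases)
    thus ?thesis by (metis diff_eq_eq add.commute)
  qed
  have "\<exists>A. open A \<and> w \<in> A \<and> H holomorphic_on A" for w
  proof (cases "F w = 0")
    case True
    then obtain m n :: int where w: "w = of_int m + of_int n * \<tau>" using lattice by blast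
    have per: "H z = H (z - w)" for z
      using periodic_int_shift[of H 1 "z - w" m, OF H1]
        periodic_int_shift[of H \<tau> "z - w + of_int m" n, OF H\<tau>] by (simp add: w)
    have "(\<lambda>z. z - w) ` ball w r \<subseteq> ball 0 r" by (auto simp: dist_norm norm_minus_commute)
    hence "(H \<circ> (\<lambda>z. z - w)) holomorphic_on ball w r"
      by (intro holomorphic_on_compose_gen[OF _ Hball] holomorphic_intros) auto
    moreover have "H \<circ> (\<lambda>z. z - w) = H" using per by (simp add: fun_eq_iff)
    ultimately show ?thesis using r(1) by (intro exI[of _ "ball w r"]) auto
  next
    case False
    have "open (F -` (- {0}))"
      using Fhol[of UNIV] by (intro open_vimage holomorphic_on_imp_continuous_on) auto
    moreover have "H holomorphic_on F -` (- {0})"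
    proof (rule holomorphic_transform)
      show "h holomorphic_on F -` (- {0})"
        unfolding h_def by (intro holomorphic_intros Qhol Ghol Fhol) auto
    qed (auto simp: H_def)
    ultimately show ?thesis using False by (intro exI[of _ "F -` (- {0})"]) auto
  qed
  hence "H field_differentiable (at w)" for w
    by (meson holomorphic_on_imp_differentiable_at)
  hence Hhol: "H holomorphic_on UNIV" by (simp add: holomorphic_on_def)
  have "H z = H 0"
    by (rule elliptic_entire_constant[OF Hhol \<tau> H1 H\<tau>])
  hence "h z = K" using z F0 by (simp add: H_def F_def)
  thus ?thesis using z by (simp add: h_def F_def G_def K_def field_simps)
qed

section \<open>Inversion of the eta function\<close>

lemma qpoch_nonzero:
  assumes "norm q < 1" "norm w < 1"
  shows "qpoch q w \<noteq> 0"
proof -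
  have "norm (q ^ n * w) < 1" for n
  proof -
    have "norm (q ^ n * w) \<le> 1 * norm w"
      unfolding norm_mult norm_power using assms by (intro mult_right_mono power_le_one) auto
    thus ?thesis using assms by simp
  qed
  hence "q ^ n * w \<noteq> 1" for n by (metis less_irrefl norm_one)
  thus ?thesis using qpoch_eq_0_iff[OF assms(1), of w] by simp
qed

lemma exp_half_pi_i: "exp (pi * \<i> / 2) = \<i>" "exp (- (pi * \<i> / 2)) = - \<i>"
  by (simp_all add: exp_eq_polar exp_minus)

text \<open>
  At the half periods 1/2, \<tau>/2 and (1+\<tau>)/2 the two theta products take permuted
  values, so the product of the three resulting equations contains only the cube of the constant
  K. As K is the square of a ratio of Euler products divided by \<tau>, this determines the
  sixth power of that ratio.
\<close>
lemma euler_phi_ratio_sixth_power: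
  assumes \<tau>: "Im \<tau> > 0"
  shows "euler_phi (ee (- 1 / \<tau>)) ^ 6 =
         \<i> * \<tau> ^ 3 * exp (pi * \<i> * (\<tau> + 1 / \<tau>) / 2) * euler_phi (ee \<tau>) ^ 6"
proof -
  define q q' where "q = ee \<tau>" and "q' = ee (- 1 / \<tau>)"
  define p p' where "p = exp (pi * \<i> * \<tau>)" and "p' = exp (pi * \<i> * (- 1 / \<tau>))"
  define Q where "Q = (\<lambda>z. - (pi * \<i> * z\<^sup>2 / \<tau>) + pi * \<i> * z * (1 - 1 / \<tau>))"
  define K where "K = euler_phi q' ^ 2 / (\<tau> * euler_phi q ^ 2)"
  have \<tau>0: "\<tau> \<noteq> 0" using \<tau> by auto
  have q: "norm q < 1" "q \<noteq> 0" and q': "norm q' < 1" "q' \<noteq> 0"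
    unfolding q_def q'_def using norm_ee_less_1[OF \<tau>] norm_ee_less_1[OF Im_neg_inverse_pos[OF \<tau>]] by auto
  have p: "p\<^sup>2 = q" "p'\<^sup>2 = q'" "p \<noteq> 0" "p' \<noteq> 0"
    by (simp_all add: p_def q_def p'_def q'_def exp_double[symmetric] mult_ac)
  have np: "norm p < 1"
    using \<tau> by (simp add: p_def norm_exp_eq_Re)
  have tr: "exp (Q z) * jtheta q' (ee (z / \<tau>)) = K * jtheta q (ee z)" if "jtheta q (ee z) \<noteq> 0" for z
    using jtheta_imaginary_transformation[OF \<tau>, of z] that
    by (simp add: q_def q'_def Q_def K_def)
  have jm1: "jtheta r (-1) = 2 * qpoch r (-r) ^ 2" if "norm r < 1" for r
    using jtheta_factor[OF that, of "-1"] by (simp add: power2_eq_square)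
  have jp: "jtheta q p = qpoch q p ^ 2" "jtheta q (-p) = qpoch q (-p) ^ 2"
     "jtheta q' p' = qpoch q' p' ^ 2" "jtheta q' (-p') = qpoch q' (-p') ^ 2"
    using p(3,4) by (simp_all add: jtheta_def p(1)[symmetric] p(2)[symmetric] power2_eq_square)
  have jinv: "jtheta q' (1 / p') = - (qpoch q' p' ^ 2) / p'" "jtheta q' (- 1 / p') = qpoch q' (-p') ^ 2 / p'"
  proof -
    have "q' * (1 / p') = p'" "q' * (- 1 / p') = - p'"
      using p(4) by (simp_all add: p(2)[symmetric] power2_eq_square)
    hence sh: "qpoch q' p' ^ 2 = - jtheta q' (1 / p') / (1 / p')"
              "qpoch q' (-p') ^ 2 = - jtheta q' (- 1 / p') / (- 1 / p')"
      using jtheta_shift[OF q', of "1 / p'"] jtheta_shift[OF q', of "- 1 / p'"] p(4) jp(3,4)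
      by simp_all
    show "jtheta q' (1 / p') = - (qpoch q' p' ^ 2) / p'" "jtheta q' (- 1 / p') = qpoch q' (-p') ^ 2 / p'"
      unfolding sh using p(4) by simp_all
  qed
  have ee_half: "ee (1 / 2) = -1" by (simp add: exp_eq_polar)
  have e1: "- \<i> * exp (pi * \<i> / (4 * \<tau>)) * qpoch q' p' ^ 2 = K * (2 * qpoch q (-q) ^ 2)"
  proof -
    have "jtheta q (ee (1 / 2)) \<noteq> 0"
      using q by (simp only: ee_half jm1) (simp add: qpoch_nonzero)
    from tr[OF this] have "exp (Q (1 / 2)) * jtheta q' (ee (1 / 2 / \<tau>)) = K * (2 * qpoch q (-q) ^ 2)"
      by (simp only: ee_half jm1[OF q(1)])
    also have "ee (1 / 2 / \<tau>) = 1 / p'"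
      by (simp add: p'_def exp_minus field_simps)
    also have "exp (Q (1 / 2)) * jtheta q' (1 / p') = - (exp (Q (1 / 2)) / p') * qpoch q' p' ^ 2"
      by (simp add: jinv)
    also have "exp (Q (1 / 2)) / p' = exp (pi * \<i> / 2 + pi * \<i> / (4 * \<tau>))"
      unfolding p'_def exp_diff[symmetric] Q_def using \<tau>0
      by (intro arg_cong[of _ _ exp]) (simp add: field_simps power2_eq_square)
    also have "\<dots> = \<i> * exp (pi * \<i> / (4 * \<tau>))"
      by (simp only: exp_add exp_half_pi_i)
    finally show ?thesis by simp
  qed
  have e2: "- \<i> * exp (pi * \<i> * \<tau> / 4) * (2 * qpoch q' (-q') ^ 2) = K * qpoch q p ^ 2"
  proof -
    have eq: "ee (\<tau> / 2) = p" by (simp add: p_def mult_ac)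
    have "jtheta q (ee (\<tau> / 2)) \<noteq> 0"
      unfolding eq jp using q np by (simp add: qpoch_nonzero)
    from tr[OF this] have "exp (Q (\<tau> / 2)) * jtheta q' (ee (\<tau> / 2 / \<tau>)) = K * qpoch q p ^ 2"
      by (simp only: eq jp)
    also have "\<tau> / 2 / \<tau> = 1 / 2" using \<tau>0 by simp
    also have "exp (Q (\<tau> / 2)) = exp (- (pi * \<i> / 2) + pi * \<i> * \<tau> / 4)"
      unfolding Q_def using \<tau>0
      by (intro arg_cong[of _ _ exp]) (simp add: field_simps power2_eq_square)
    also have "\<dots> = - \<i> * exp (pi * \<i> * \<tau> / 4)"
      by (simp only: exp_add exp_half_pi_i)
    finally show ?thesis by (simp only: ee_half jm1[OF q'(1)])
  qed
  have e3: "- \<i> * exp (pi * \<i> / (4 * \<tau>) + pi * \<i> * \<tau> / 4) * qpoch q' (-p') ^ 2 = K * qpoch q (-p) ^ 2"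
  proof -
    have "(1 + \<tau>) / 2 = 1 / 2 + \<tau> / 2" by simp
    hence eq: "ee ((1 + \<tau>) / 2) = - p" using ee_half by (simp only: ee_add) (simp add: p_def mult_ac)
    have "jtheta q (ee ((1 + \<tau>) / 2)) \<noteq> 0"
      unfolding eq jp using q np by (simp add: qpoch_nonzero)
    from tr[OF this] have "exp (Q ((1 + \<tau>) / 2)) * jtheta q' (ee ((1 + \<tau>) / 2 / \<tau>)) = K * qpoch q (-p) ^ 2"
      by (simp only: eq jp)
    also have "(1 + \<tau>) / 2 / \<tau> = 1 / 2 + 1 / 2 / \<tau>" using \<tau>0 by (simp add: field_simps)
    also have "ee (1 / 2 + 1 / 2 / \<tau>) = - 1 / p'"
      using ee_half by (simp only: ee_add) (simp add: p'_def exp_minus field_simps)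
    also have "exp (Q ((1 + \<tau>) / 2)) * jtheta q' (- 1 / p') = exp (Q ((1 + \<tau>) / 2)) / p' * qpoch q' (-p') ^ 2"
      unfolding jinv by simp
    also have "exp (Q ((1 + \<tau>) / 2)) / p' = exp (- (pi * \<i> / 2) + (pi * \<i> / (4 * \<tau>) + pi * \<i> * \<tau> / 4))"
      unfolding p'_def exp_diff[symmetric] Q_def using \<tau>0
      by (intro arg_cong[of _ _ exp]) (simp add: field_simps power2_eq_square)
    also have "\<dots> = - \<i> * exp (pi * \<i> / (4 * \<tau>) + pi * \<i> * \<tau> / 4)"
      by (subst exp_add) (simp only: exp_half_pi_i)
    finally show ?thesis .
  qed
  define B where "B = qpoch q (-q) * qpoch q p * qpoch q (-p)"
  define B' where "B' = qpoch q' (-q') * qpoch q' p' * qpoch q' (-p')"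
  have "B = 1" "B' = 1"
    unfolding B_def B'_def by (intro qpoch_half_periods_product q q' p)+
  (* in the product of e1, e2 and e3 the squares of the q-products combine to B and B', which are 1 *)
  have "(- \<i> * exp (pi * \<i> / (4 * \<tau>)) * qpoch q' p' ^ 2) *
        (- \<i> * exp (pi * \<i> * \<tau> / 4) * (2 * qpoch q' (-q') ^ 2)) *
        (- \<i> * exp (pi * \<i> / (4 * \<tau>) + pi * \<i> * \<tau> / 4) * qpoch q' (-p') ^ 2) =
        2 * K ^ 3 * B\<^sup>2"
    unfolding e1 e2 e3 by (simp add: B_def power2_eq_square power3_eq_cube mult_ac)
  also have "(- \<i> * exp (pi * \<i> / (4 * \<tau>)) * qpoch q' p' ^ 2) *
        (- \<i> * exp (pi * \<i> * \<tau> / 4) * (2 * qpoch q' (-q') ^ 2)) *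
        (- \<i> * exp (pi * \<i> / (4 * \<tau>) + pi * \<i> * \<tau> / 4) * qpoch q' (-p') ^ 2) =
        2 * (- \<i>) ^ 3 * (exp (pi * \<i> / (4 * \<tau>)) * exp (pi * \<i> * \<tau> / 4) * exp (pi * \<i> / (4 * \<tau>) + pi * \<i> * \<tau> / 4)) * B'\<^sup>2"
    by (simp only: B'_def power2_eq_square power3_eq_cube mult_ac)
  also have "exp (pi * \<i> / (4 * \<tau>)) * exp (pi * \<i> * \<tau> / 4) * exp (pi * \<i> / (4 * \<tau>) + pi * \<i> * \<tau> / 4) =
             exp (pi * \<i> * (\<tau> + 1 / \<tau>) / 2)"
    unfolding exp_add[symmetric] using \<tau>0
    by (intro arg_cong[of _ _ exp]) (simp add: field_simps)
  finally have K3: "K ^ 3 = \<i> * exp (pi * \<i> * (\<tau> + 1 / \<tau>) / 2)"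
    by (simp add: \<open>B = 1\<close> \<open>B' = 1\<close> power3_eq_cube)
  have "euler_phi q' ^ 2 = K * \<tau> * euler_phi q ^ 2"
    using \<tau>0 euler_phi_nonzero[OF q(1)] by (simp add: K_def)
  hence "(euler_phi q' ^ 2) ^ 3 = K ^ 3 * \<tau> ^ 3 * (euler_phi q ^ 2) ^ 3"
    by (simp add: power_mult_distrib)
  thus ?thesis unfolding K3 by (simp add: q_def q'_def mult_ac)
qed

lemma dedekind_eta_eq: "dedekind_eta \<tau> = exp (pi * \<i> * \<tau> / 12) * euler_phi (ee \<tau>)"
proof -
  have "exp (2 * of_real pi * \<i> * of_nat (Suc n) * \<tau>) = ee \<tau> ^ n * ee \<tau>" for n
  proof -
    have "ee \<tau> ^ n * ee \<tau> = ee \<tau> ^ Suc n" by simp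
    also have "\<dots> = exp (of_nat (Suc n) * (2 * of_real pi * \<i> * \<tau>))" by (rule exp_of_nat_mult[symmetric])
    finally show ?thesis by (simp only: mult_ac)
  qed
  moreover have "2 * of_real pi * \<i> * \<tau> / 24 = pi * \<i> * \<tau> / 12" by simp
  ultimately show ?thesis
    unfolding dedekind_eta_def euler_phi_def qpoch_def by (simp only:)
qed

lemma dedekind_eta_nonzero: "Im \<tau> > 0 \<Longrightarrow> dedekind_eta \<tau> \<noteq> 0"
  using euler_phi_nonzero[OF norm_ee_less_1] by (simp add: dedekind_eta_eq)

lemma dedekind_eta_holomorphic: "dedekind_eta holomorphic_on upper_half_plane"
proof -
  have "(euler_phi \<circ> (\<lambda>\<tau>. ee \<tau>)) holomorphic_on upper_half_plane"
    by (rule holomorphic_on_compose_gen[OF _ euler_phi_holomorphic])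
       (auto intro!: holomorphic_intros simp: upper_half_plane_def norm_ee_less_1)
  hence comp: "(\<lambda>\<tau>. euler_phi (ee \<tau>)) holomorphic_on upper_half_plane"
    by (simp only: o_def)
  have "(\<lambda>\<tau>. exp (pi * \<i> * \<tau> / 12) * euler_phi (ee \<tau>)) holomorphic_on upper_half_plane"
    by (intro holomorphic_intros comp) auto
  thus ?thesis by (rule holomorphic_transform) (simp add: dedekind_eta_eq)
qed

lemma dedekind_eta_add_1: "dedekind_eta (\<tau> + 1) = exp (pi * \<i> / 12) * dedekind_eta \<tau>"
proof -
  have "ee (\<tau> + 1) = ee \<tau>" using ee_eq_1_iff[of 1] by (simp add: ee_add)
  moreover have "exp (pi * \<i> * (\<tau> + 1) / 12) = exp (pi * \<i> / 12) * exp (pi * \<i> * \<tau> / 12)"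
    by (simp add: exp_add[symmetric] field_simps)
  ultimately show ?thesis by (simp only: dedekind_eta_eq) (simp add: mult_ac)
qed

lemma csqrt_Re_pos_mult:
  assumes "Re z > 0" "Re w > 0"
  shows "csqrt (z * w) = csqrt z * csqrt w"
proof -
  have nz: "z \<noteq> 0" "w \<noteq> 0" using assms by auto
  have "\<bar>Im (Ln z)\<bar> < pi / 2" "\<bar>Im (Ln w)\<bar> < pi / 2"
    using assms Re_Ln_pos_lt[of z] Re_Ln_pos_lt[of w] nz by auto
  hence "- pi < Im (Ln z + Ln w)" "Im (Ln z + Ln w) \<le> pi"
    by auto
  hence "Ln (z * w) = Ln z + Ln w" using nz by (simp add: Ln_times_simple)
  thus ?thesis using nz by (simp add: csqrt_exp_Ln exp_add[symmetric] add_divide_distrib)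
qed

text \<open>
  By the formula for sixth powers the quotient of both sides is a continuous function whose
  values are sixth roots of unity, so it is constant on the connected half plane, and it equals
  1 at the fixed point i.
\<close>
theorem dedekind_eta_S:
  assumes "Im \<tau> > 0"
  shows "dedekind_eta (- 1 / \<tau>) = csqrt (- \<i> * \<tau>) * dedekind_eta \<tau>"
proof -
  let ?H = upper_half_plane
  define r where "r = (\<lambda>\<tau>. dedekind_eta (- 1 / \<tau>) / (csqrt (- \<i> * \<tau>) * dedekind_eta \<tau>))"
  have nz: "csqrt (- \<i> * \<tau>) * dedekind_eta \<tau> \<noteq> 0" if "\<tau> \<in> ?H" for \<tau>
    using dedekind_eta_nonzero that by (auto simp: upper_half_plane_def)
  have cont: "continuous_on ?H dedekind_eta"
    using dedekind_eta_holomorphic by (rule holomorphic_on_imp_continuous_on)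
  have "continuous_on ?H (dedekind_eta \<circ> (\<lambda>\<tau>. - 1 / \<tau>))"
  proof (rule continuous_on_compose)
    show "continuous_on ?H (\<lambda>\<tau>. - 1 / \<tau>)" by (auto intro!: continuous_intros simp: upper_half_plane_def)
    show "continuous_on ((\<lambda>\<tau>. - 1 / \<tau>) ` ?H) dedekind_eta"
      by (rule continuous_on_subset[OF cont]) (use Im_neg_inverse_pos in \<open>auto simp: upper_half_plane_def\<close>)
  qed
  hence "continuous_on ?H (\<lambda>\<tau>. dedekind_eta (- 1 / \<tau>))" by (simp only: o_def)
  moreover have "continuous_on ?H (\<lambda>\<tau>. csqrt (- \<i> * \<tau>))"
    by (intro continuous_on_compose2[OF continuous_on_csqrt] continuous_intros)
       (auto simp: upper_half_plane_def complex_nonpos_Reals_iff)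
  ultimately have r_cont: "continuous_on ?H r"
    unfolding r_def using nz by (intro continuous_intros cont) auto
  have r6: "r z ^ 6 = 1" if z: "z \<in> ?H" for z
  proof -
    have Im: "Im z > 0" and z0: "z \<noteq> 0" using z by (auto simp: upper_half_plane_def)
    have "csqrt (- \<i> * z) ^ 6 = (csqrt (- \<i> * z) ^ 2) ^ 3" by (simp add: power_mult[symmetric] del: power2_csqrt)
    also have "\<dots> = \<i> * z ^ 3" by (simp add: power_mult_distrib power3_eq_cube algebra_simps)
    finally have c6: "csqrt (- \<i> * z) ^ 6 = \<i> * z ^ 3" .
    have "dedekind_eta (- 1 / z) ^ 6 = exp (6 * (pi * \<i> * (- 1 / z) / 12)) * euler_phi (ee (- 1 / z)) ^ 6"
      unfolding dedekind_eta_eq power_mult_distrib exp_of_nat_mult[symmetric] by simp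
    also have "\<dots> = exp (6 * (pi * \<i> * (- 1 / z) / 12)) * exp (pi * \<i> * (z + 1 / z) / 2) * (\<i> * z ^ 3 * euler_phi (ee z) ^ 6)"
      by (subst euler_phi_ratio_sixth_power[OF Im]) (simp only: mult_ac)
    also have "exp (6 * (pi * \<i> * (- 1 / z) / 12)) * exp (pi * \<i> * (z + 1 / z) / 2) = exp (6 * (pi * \<i> * z / 12))"
      unfolding exp_add[symmetric] using z0 by (intro arg_cong[of _ _ exp]) (simp add: field_simps)
    also have "exp (6 * (pi * \<i> * z / 12)) * (\<i> * z ^ 3 * euler_phi (ee z) ^ 6) = \<i> * z ^ 3 * dedekind_eta z ^ 6"
      unfolding dedekind_eta_eq power_mult_distrib exp_of_nat_mult[symmetric] by simp
    also have "\<dots> = (csqrt (- \<i> * z) * dedekind_eta z) ^ 6"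
      by (simp only: power_mult_distrib c6)
    finally show ?thesis using nz[OF z] by (simp add: r_def power_divide)
  qed
  have "finite (r ` ?H)"
    by (rule finite_subset[of _ "{z. z ^ 6 = 1}"]) (use r6 finite_roots_unity[of 6] in auto)
  moreover have "connected ?H"
    unfolding upper_half_plane_def by (intro convex_connected convex_halfspace_Im_gt)
  ultimately have "r constant_on ?H"
    using continuous_finite_range_constant[OF _ r_cont] by blast
  hence "r \<tau> = r \<i>" using assms by (auto simp: constant_on_def upper_half_plane_def)
  also have "r \<i> = 1" using nz[of \<i>] by (simp add: r_def upper_half_plane_def)
  finally show ?thesis using nz[of \<tau>] assms by (simp add: r_def upper_half_plane_def field_simps)
qed

section \<open>Eta quotients under translation and inversion\<close>

lemma dedekind_eta_half_shift:
  assumes "Im \<tau> > 0"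
  shows "dedekind_eta ((\<tau> + 1) / 2) * dedekind_eta (\<tau> / 2) * dedekind_eta (2 * \<tau>) =
         exp (pi * \<i> / 24) * dedekind_eta \<tau> ^ 3"
proof -
  define p q where "p = ee (\<tau> / 2)" and "q = ee \<tau>"
  have q: "norm q < 1" unfolding q_def by (rule norm_ee_less_1[OF assms])
  have pq: "p\<^sup>2 = q" unfolding p_def q_def exp_double[symmetric]
    by (intro arg_cong[of _ _ exp]) simp
  have "(\<tau> + 1) / 2 = \<tau> / 2 + 1 / 2" by (simp add: field_simps)
  moreover have "ee (1 / 2) = -1" by (simp add: exp_eq_polar)
  ultimately have e1: "ee ((\<tau> + 1) / 2) = - p"
    by (simp only: ee_add p_def) simp
  have e2: "ee (2 * \<tau>) = q\<^sup>2"
    unfolding q_def exp_double[symmetric] by (intro arg_cong[of _ _ exp]) simp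
  have "dedekind_eta ((\<tau> + 1) / 2) * dedekind_eta (\<tau> / 2) * dedekind_eta (2 * \<tau>) =
    (exp (pi * \<i> * ((\<tau> + 1) / 2) / 12) * exp (pi * \<i> * (\<tau> / 2) / 12) * exp (pi * \<i> * (2 * \<tau>) / 12)) *
    (euler_phi p * euler_phi (-p) * euler_phi (q\<^sup>2))"
    unfolding dedekind_eta_eq e1 e2 p_def[symmetric] by (simp only: mult_ac)
  also have "exp (pi * \<i> * ((\<tau> + 1) / 2) / 12) * exp (pi * \<i> * (\<tau> / 2) / 12) * exp (pi * \<i> * (2 * \<tau>) / 12) =
             exp (pi * \<i> / 24) * exp (of_nat 3 * (pi * \<i> * \<tau> / 12))"
    unfolding exp_add[symmetric] by (intro arg_cong[of _ _ exp]) (simp add: field_simps)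
  also have "exp (of_nat 3 * (pi * \<i> * \<tau> / 12)) = exp (pi * \<i> * \<tau> / 12) ^ 3"
    by (rule exp_of_nat_mult)
  also have "euler_phi p * euler_phi (-p) * euler_phi (q\<^sup>2) = euler_phi q ^ 3"
    by (rule euler_phi_neg_sqrt[OF q pq])
  finally show ?thesis by (simp add: dedekind_eta_eq q_def power_mult_distrib)
qed

lemma dedekind_eta_nonzeros:
  assumes "Im \<tau> > 0"
  shows "dedekind_eta \<tau> \<noteq> 0" "dedekind_eta (\<tau> / 2) \<noteq> 0" "dedekind_eta (2 * \<tau>) \<noteq> 0"
  using assms by (auto intro!: dedekind_eta_nonzero)

lemma eta_nonzeros:
  assumes "Im \<tau> > 0"
  shows "eta_natural \<tau> \<noteq> 0" "eta_flat \<tau> \<noteq> 0" "eta_sharp \<tau> \<noteq> 0"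
  using dedekind_eta_nonzeros[OF assms]
  by (simp_all add: eta_natural_def eta_flat_def eta_sharp_def)

lemma eta_product:
  assumes "Im \<tau> > 0"
  shows "eta_natural \<tau> * eta_flat \<tau> * eta_sharp \<tau> = dedekind_eta \<tau> ^ 3"
  using dedekind_eta_nonzeros[OF assms]
  by (simp add: eta_natural_def eta_flat_def eta_sharp_def field_simps power_numeral_reduce)

lemma eta_natural_holomorphic: "eta_natural holomorphic_on upper_half_plane"
  and eta_flat_holomorphic: "eta_flat holomorphic_on upper_half_plane"
  and eta_sharp_holomorphic: "eta_sharp holomorphic_on upper_half_plane"
proof -
  have *: "(\<lambda>\<tau>. dedekind_eta (c * \<tau>)) holomorphic_on upper_half_plane"
    if "Im c = 0" "Re c > 0" for c :: complex
  proof -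
    have "(dedekind_eta \<circ> (\<lambda>\<tau>. c * \<tau>)) holomorphic_on upper_half_plane"
      by (rule holomorphic_on_compose_gen[OF _ dedekind_eta_holomorphic])
         (use that in \<open>auto intro!: holomorphic_intros simp: upper_half_plane_def\<close>)
    thus ?thesis by (simp only: o_def)
  qed
  have h: "(\<lambda>\<tau>. dedekind_eta (2 * \<tau>)) holomorphic_on upper_half_plane"
          "(\<lambda>\<tau>. dedekind_eta (\<tau> / 2)) holomorphic_on upper_half_plane"
    using *[of 2] *[of "1/2"] by simp_all
  have nz: "dedekind_eta \<tau> \<noteq> 0" "dedekind_eta (\<tau> / 2) \<noteq> 0" "dedekind_eta (2 * \<tau>) \<noteq> 0"
    if "\<tau> \<in> upper_half_plane" for \<tau>
    using that dedekind_eta_nonzeros by (auto simp: upper_half_plane_def)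
  have "(\<lambda>\<tau>. dedekind_eta \<tau> ^ 5 / (dedekind_eta (\<tau> / 2) ^ 2 * dedekind_eta (2 * \<tau>) ^ 2)) holomorphic_on upper_half_plane"
       "(\<lambda>\<tau>. dedekind_eta (\<tau> / 2) ^ 2 / dedekind_eta \<tau>) holomorphic_on upper_half_plane"
       "(\<lambda>\<tau>. dedekind_eta (2 * \<tau>) ^ 2 / dedekind_eta \<tau>) holomorphic_on upper_half_plane"
    by (intro holomorphic_intros h dedekind_eta_holomorphic; simp add: nz)+
  thus "eta_natural holomorphic_on upper_half_plane"
    "eta_flat holomorphic_on upper_half_plane" "eta_sharp holomorphic_on upper_half_plane"
    by (simp_all only: eta_natural_def[abs_def] eta_flat_def[abs_def] eta_sharp_def[abs_def])
qed

text \<open>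
  Translation by 1 exchanges \<tau>/2 and (\<tau>+1)/2; the powers of the 48th root of unity
  cancel in the first two quotients.
\<close>
lemma eta_T:
  assumes "Im \<tau> > 0"
  shows "eta_natural (\<tau> + 1) = eta_flat \<tau>" "eta_flat (\<tau> + 1) = eta_natural \<tau>"
    "eta_sharp (\<tau> + 1) = exp (pi * \<i> / 4) * eta_sharp \<tau>"
proof -
  define z where "z = exp (pi * \<i> / 24)"
  have z: "z \<noteq> 0" "exp (pi * \<i> / 12) = z ^ 2" "exp (pi * \<i> / 4) = z ^ 6"
    by (simp_all add: z_def exp_of_nat_mult[symmetric] mult_ac)
  note nz = dedekind_eta_nonzeros[OF assms]
  have 1: "dedekind_eta (\<tau> + 1) = z ^ 2 * dedekind_eta \<tau>"
    by (simp add: dedekind_eta_add_1 z)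
  have "dedekind_eta (2 * \<tau> + 1 + 1) = z ^ 2 * (z ^ 2 * dedekind_eta (2 * \<tau>))"
    by (simp only: dedekind_eta_add_1 z)
  moreover have eq: "2 * (\<tau> + 1) = 2 * \<tau> + 1 + 1" by simp
  ultimately have 2: "dedekind_eta (2 * (\<tau> + 1)) = z ^ 4 * dedekind_eta (2 * \<tau>)"
  proof -
    have "z ^ 4 = z ^ 2 * z ^ 2" by (simp flip: power_add)
    thus ?thesis
      by (simp only: eq dedekind_eta_add_1 z mult.assoc)
  qed
  have 3: "dedekind_eta ((\<tau> + 1) / 2) = z * dedekind_eta \<tau> ^ 3 / (dedekind_eta (\<tau> / 2) * dedekind_eta (2 * \<tau>))"
    using dedekind_eta_half_shift[OF assms] nz by (simp add: z_def field_simps)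
  show "eta_natural (\<tau> + 1) = eta_flat \<tau>" "eta_flat (\<tau> + 1) = eta_natural \<tau>"
    "eta_sharp (\<tau> + 1) = exp (pi * \<i> / 4) * eta_sharp \<tau>"
    unfolding eta_natural_def eta_flat_def eta_sharp_def 1 2 3 z(3) using nz z(1)
    by (simp_all add: field_simps power_numeral_reduce)
qed

lemma csqrt_scale:
  assumes "Im \<tau> > 0"
  shows "csqrt (- \<i> * (2 * \<tau>)) = csqrt 2 * csqrt (- \<i> * \<tau>)"
    "csqrt (- \<i> * (\<tau> / 2)) = csqrt (- \<i> * \<tau>) / csqrt 2"
proof -
  have "csqrt (2 * (- \<i> * \<sigma>)) = csqrt 2 * csqrt (- \<i> * \<sigma>)" if "Im \<sigma> > 0" for \<sigma>
    using that by (intro csqrt_Re_pos_mult) auto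
  from this[OF assms] this[of "\<tau> / 2"] assms
  show "csqrt (- \<i> * (2 * \<tau>)) = csqrt 2 * csqrt (- \<i> * \<tau>)"
    "csqrt (- \<i> * (\<tau> / 2)) = csqrt (- \<i> * \<tau>) / csqrt 2"
    by (simp_all add: mult_ac)
qed

text \<open>
  Inversion exchanges the arguments \<tau>/2 and 2\<tau>.
\<close>
lemma eta_S:
  assumes "Im \<tau> > 0"
  shows "eta_natural (- 1 / \<tau>) = csqrt (- \<i> * \<tau>) * eta_natural \<tau>"
    "eta_flat (- 1 / \<tau>) = 2 * csqrt (- \<i> * \<tau>) * eta_sharp \<tau>"
    "eta_sharp (- 1 / \<tau>) = csqrt (- \<i> * \<tau>) / 2 * eta_flat \<tau>"
proof -
  define s where "s = csqrt (- \<i> * \<tau>)"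
  have s0: "s \<noteq> 0" using assms by (auto simp: s_def)
  have c2: "csqrt 2 ^ 2 = 2" "csqrt 2 \<noteq> 0" by (rule power2_csqrt) simp
  note nz = dedekind_eta_nonzeros[OF assms]
  have 1: "dedekind_eta (- 1 / \<tau>) = s * dedekind_eta \<tau>"
    unfolding s_def by (rule dedekind_eta_S[OF assms])
  have "- 1 / (2 * \<tau>) = - 1 / \<tau> / 2" by simp
  hence 2: "dedekind_eta (- 1 / \<tau> / 2) = csqrt 2 * s * dedekind_eta (2 * \<tau>)"
    using dedekind_eta_S[of "2 * \<tau>"] assms unfolding csqrt_scale(1)[OF assms] s_def by (simp add: mult.commute[of \<tau> 2])
  have "- 1 / (\<tau> / 2) = 2 * (- 1 / \<tau>)" by simp
  hence 3: "dedekind_eta (2 * (- 1 / \<tau>)) = s / csqrt 2 * dedekind_eta (\<tau> / 2)"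
    using dedekind_eta_S[of "\<tau> / 2"] assms unfolding csqrt_scale(2)[OF assms] s_def by simp
  show "eta_natural (- 1 / \<tau>) = csqrt (- \<i> * \<tau>) * eta_natural \<tau>"
    "eta_flat (- 1 / \<tau>) = 2 * csqrt (- \<i> * \<tau>) * eta_sharp \<tau>"
    "eta_sharp (- 1 / \<tau>) = csqrt (- \<i> * \<tau>) / 2 * eta_flat \<tau>"
    unfolding eta_natural_def eta_flat_def eta_sharp_def 1 2 3 s_def[symmetric] power_mult_distrib
      power_divide c2(1) using nz s0
    by (simp_all add: field_simps power_numeral_reduce)
qed

section \<open>The multiplier of theta\<close>

definition theta :: "complex \<Rightarrow> complex" where
  "theta \<tau> = eta_natural (2 * \<tau>)"

lemma theta_nonzero: "Im \<tau> > 0 \<Longrightarrow> theta \<tau> \<noteq> 0"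
  using eta_nonzeros(1)[of "2 * \<tau>"] by (simp add: theta_def)

lemma theta_holomorphic: "theta holomorphic_on upper_half_plane"
proof -
  have "(eta_natural \<circ> (\<lambda>\<tau>. 2 * \<tau>)) holomorphic_on upper_half_plane"
    by (rule holomorphic_on_compose_gen[OF _ eta_natural_holomorphic])
       (auto intro!: holomorphic_intros simp: upper_half_plane_def)
  thus ?thesis by (simp only: o_def theta_def[abs_def])
qed

lemma theta_add_1:
  assumes "Im \<tau> > 0" shows "theta (\<tau> + 1) = theta \<tau>"
proof -
  have "eta_natural (2 * \<tau> + 1 + 1) = eta_natural (2 * \<tau>)"
    using eta_T(1)[of "2 * \<tau> + 1"] eta_T(2)[of "2 * \<tau>"] assms by simp
  moreover have "2 * (\<tau> + 1) = 2 * \<tau> + 1 + 1" by simp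
  ultimately show ?thesis by (simp only: theta_def)
qed

lemma theta_add_int:
  assumes "Im \<tau> > 0" shows "theta (\<tau> + of_int n) = theta \<tau>"
proof (induction n rule: int_induct[where k = 0])
  case (step1 i)
  show ?case using theta_add_1[of "\<tau> + of_int i"] assms step1 by (simp add: algebra_simps)
next
  case (step2 i)
  show ?case using theta_add_1[of "\<tau> + of_int (i - 1)"] assms step2 by (simp add: algebra_simps)
qed auto

lemma Im_theta_U_pos: "Im \<tau> > 0 \<Longrightarrow> Im (\<tau> / (4 * \<tau> + 1)) > 0"
proof -
  assume "Im \<tau> > 0"
  have "Im (\<tau> / (4 * \<tau> + 1)) = Im \<tau> / ((4 * Re \<tau> + 1)\<^sup>2 + (4 * Im \<tau>)\<^sup>2)"
    by (simp add: Im_divide algebra_simps)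
  moreover have "(4 * Re \<tau> + 1)\<^sup>2 + (4 * Im \<tau>)\<^sup>2 > 0"
    using \<open>Im \<tau> > 0\<close> by (intro add_nonneg_pos) auto
  ultimately show ?thesis using \<open>Im \<tau> > 0\<close> by simp
qed

text \<open>
  The map U is conjugate to a translation: -1/(2U\<tau>) = -1/(2\<tau>) - 2, and eta_natural has
  period 2.
\<close>
lemma theta_U:
  assumes "Im \<tau> > 0"
  shows "theta (\<tau> / (4 * \<tau> + 1)) = csqrt (4 * \<tau> + 1) * theta \<tau>"
proof -
  have nz: "\<tau> \<noteq> 0" "4 * \<tau> + 1 \<noteq> 0" using assms by (auto simp: complex_eq_iff)
  define \<sigma> where "\<sigma> = - 1 / (2 * \<tau>) - 2"
  have Im: "Im \<sigma> > 0"
    using Im_neg_inverse_pos[of "2 * \<tau>"] assms by (simp add: \<sigma>_def)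
  have eq: "2 * (\<tau> / (4 * \<tau> + 1)) = - 1 / \<sigma>"
  proof -
    define m where "m = 4 * \<tau> + 1"
    have "\<sigma> = - (m / (2 * \<tau>))" using nz by (simp add: \<sigma>_def m_def field_simps)
    thus ?thesis using nz by (simp add: m_def[symmetric])
  qed
  have "eta_natural (\<sigma> + 1 + 1) = eta_natural \<sigma>"
    using eta_T(1)[of "\<sigma> + 1"] eta_T(2)[of \<sigma>] Im by simp
  moreover have "\<sigma> + 1 + 1 = - 1 / (2 * \<tau>)" by (simp add: \<sigma>_def)
  ultimately have "eta_natural \<sigma> = csqrt (- \<i> * (2 * \<tau>)) * theta \<tau>"
    using eta_S(1)[of "2 * \<tau>"] assms by (simp add: theta_def)
  hence "theta (\<tau> / (4 * \<tau> + 1)) = csqrt (- \<i> * \<sigma>) * csqrt (- \<i> * (2 * \<tau>)) * theta \<tau>"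
    unfolding theta_def eq eta_S(1)[OF Im] by simp
  also have "csqrt (- \<i> * \<sigma>) * csqrt (- \<i> * (2 * \<tau>)) = csqrt ((- \<i> * \<sigma>) * (- \<i> * (2 * \<tau>)))"
    using Im assms by (intro csqrt_Re_pos_mult[symmetric]) auto
  also have "(- \<i> * \<sigma>) * (- \<i> * (2 * \<tau>)) = 4 * \<tau> + 1"
    using nz by (simp add: \<sigma>_def field_simps)
  finally show ?thesis .
qed

lemma csqrt_upper:
  assumes "Im z > 0" shows "Re (csqrt z) > 0" "Im (csqrt z) > 0"
proof -
  have "Im (csqrt z ^ 2) = 2 * Re (csqrt z) * Im (csqrt z)" by (rule Im_power2)
  hence "Re (csqrt z) * Im (csqrt z) > 0" using assms unfolding power2_csqrt by linarith
  moreover have "Re (csqrt z) \<ge> 0" using csqrt_principal[of z] by auto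
  ultimately show "Re (csqrt z) > 0" "Im (csqrt z) > 0"
    unfolding zero_less_mult_iff by linarith+
qed

lemma csqrt_lower:
  assumes "Im z < 0" shows "Re (csqrt z) > 0" "Im (csqrt z) < 0"
proof -
  have "Im (csqrt z ^ 2) = 2 * Re (csqrt z) * Im (csqrt z)" by (rule Im_power2)
  hence "Re (csqrt z) * Im (csqrt z) < 0" using assms unfolding power2_csqrt by linarith
  moreover have "Re (csqrt z) \<ge> 0" using csqrt_principal[of z] by auto
  ultimately show "Re (csqrt z) > 0" "Im (csqrt z) < 0"
    unfolding mult_less_0_iff by linarith+
qed

text \<open>
  The square of the left-hand side is wz, so only the sign is at stake. It is read off from the
  quadrant of the product of the two principal roots: its imaginary part is positive if w lies
  in the upper half plane or on the negative axis, and then the sign of the real part is the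
  sign of Im (wz).
\<close>
lemma csqrt_mult_upper:
  assumes z: "Im z > 0" and w: "w \<noteq> 0"
  shows "csqrt w * csqrt z =
    (if (Im w > 0 \<or> Im w = 0 \<and> Re w < 0) \<and> Im (w * z) < 0 then -1 else 1) * csqrt (w * z)"
proof -
  define u where "u = csqrt w * csqrt z"
  have u2: "u\<^sup>2 = w * z" by (simp add: u_def power_mult_distrib)
  have Re_u: "Re u = Re (csqrt w) * Re (csqrt z) - Im (csqrt w) * Im (csqrt z)"
    and Im_u: "Im u = Re (csqrt w) * Im (csqrt z) + Im (csqrt w) * Re (csqrt z)"
    by (simp_all add: u_def)
  note cz = csqrt_upper[OF z]
  show ?thesis
  proof (cases "Im w > 0 \<or> Im w = 0 \<and> Re w < 0")
    case True
    have "Im u > 0"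
    proof (cases "Im w > 0")
      case True
      thus ?thesis using csqrt_upper[OF True] cz by (simp add: Im_u add_pos_pos)
    next
      case False
      hence "w = of_real (Re w)" "Re w < 0" using True by (auto simp: complex_eq_iff)
      hence "csqrt w = \<i> * of_real (sqrt (- Re w))"
        using csqrt_of_real_nonpos[of w] False True by auto
      thus ?thesis using cz \<open>Re w < 0\<close> by (simp add: Im_u)
    qed
    have im: "Im (w * z) = 2 * (Re u * Im u)"
      by (simp add: u2[symmetric] power2_eq_square)
    show ?thesis
    proof (cases "Im (w * z) < 0")
      case neg: True
      hence "Re u < 0" using \<open>Im u > 0\<close> im by (auto simp: mult_less_0_iff)
      hence "csqrt (w * z) = - u"
        using u2 by (intro csqrt_unique) auto
      thus ?thesis using True neg by (simp add: u_def)
    next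
      case nonneg: False
      hence "Re u \<ge> 0" using \<open>Im u > 0\<close> im by (auto simp: zero_le_mult_iff not_less)
      hence "csqrt (w * z) = u"
        using u2 \<open>Im u > 0\<close> by (intro csqrt_unique) auto
      thus ?thesis using nonneg by (simp add: u_def)
    qed
  next
    case False
    have "Re u > 0"
    proof (cases "Im w < 0")
      case True
      have "Re (csqrt w) * Re (csqrt z) > 0" "Im (csqrt w) * Im (csqrt z) < 0"
        using csqrt_lower[OF True] cz by (simp_all add: mult_neg_pos)
      thus ?thesis by (simp add: Re_u)
    next
      case not: False
      hence "w = of_real (Re w)" "Re w > 0" using False w by (auto simp: complex_eq_iff not_less)
      hence "csqrt w = of_real (sqrt (Re w))"
        using csqrt_of_real_nonneg[of w] not False by auto
      thus ?thesis using cz \<open>Re w > 0\<close> by (simp add: Re_u)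
    qed
    hence "csqrt (w * z) = u" using u2 by (intro csqrt_unique) auto
    thus ?thesis using False by (simp only: u_def if_False simp_thms) simp
  qed
qed

text \<open>
  With \<epsilon>_d = 1 or i according to d modulo 4, this is the inverse of \<epsilon>_d for
  odd d.
\<close>
definition theta_mult :: "int \<Rightarrow> complex" where
  "theta_mult d = xi8 d * chi8 d"

lemma theta_mult_eq:
  assumes "odd d"
  shows "theta_mult d = (if d mod 4 = 1 then 1 else - \<i>)"
proof -
  define r k where "r = d mod 8" and "k = d div 8"
  have d: "d = 8 * k + r" by (simp add: r_def k_def)
  have "2 * of_real pi * \<i> * of_int (d - 1) / 8 = 2 * of_real pi * \<i> * of_int (r - 1) / 8 + 2 * of_real pi * \<i> * of_int k"
    by (simp add: d field_simps)
  moreover have "exp (2 * of_real pi * \<i> * of_int k) = 1"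
    using ee_eq_1_iff[of "of_int k"] by simp
  ultimately have xi: "xi8 d = xi8 r" by (simp only: xi8_def exp_add) simp
  have e: "exp (pi * \<i> * (3 / 2)) = - \<i>"
  proof -
    have "pi * \<i> * (3 / 2) = pi * \<i> + pi * \<i> / 2" by simp
    thus ?thesis by (simp only: exp_add exp_half_pi_i) simp
  qed
  have "r = 1 \<or> r = 3 \<or> r = 5 \<or> r = 7" unfolding r_def using assms by presburger
  moreover have "d mod 4 = r mod 4" unfolding r_def by (simp add: mod_mod_cancel)
  ultimately show ?thesis
    unfolding theta_mult_def xi chi8_def r_def[symmetric]
    using e exp_half_pi_i by (elim disjE) (simp_all add: xi8_def mult_ac)
qed

lemma theta_mult_cong: "odd d \<Longrightarrow> 4 dvd c \<Longrightarrow> theta_mult (d + c) = theta_mult d"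
  by (subst (1 2) theta_mult_eq) auto

lemma Im_moebius_pos:
  fixes a b c d :: int
  assumes "Im \<tau> > 0" "a * d - b * c = 1"
  shows "Im ((of_int a * \<tau> + of_int b) / (of_int c * \<tau> + of_int d)) > 0"
    and "of_int c * \<tau> + of_int d \<noteq> 0"
    and "Im ((of_int a * \<tau> + of_int b) / (of_int c * \<tau> + of_int d)) =
         Im \<tau> / (norm (of_int c * \<tau> + of_int d))\<^sup>2"
proof -
  let ?w = "of_int c * \<tau> + of_int d"
  show nz: "?w \<noteq> 0"
  proof
    assume "?w = 0"
    hence "real_of_int c * Im \<tau> = 0" "of_int c * Re \<tau> + of_int d = 0" by (auto simp: complex_eq_iff)
    hence "c = 0" "d = 0" using assms(1) by auto
    thus False using assms(2) by simp
  qed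
  have det: "real_of_int a * of_int d - of_int b * of_int c = 1"
    using assms(2) by (metis of_int_1 of_int_diff of_int_mult)
  have "Im ((of_int a * \<tau> + of_int b) / ?w) =
     ((of_int a * of_int d - of_int b * of_int c) * Im \<tau>) / (norm ?w)\<^sup>2"
    by (simp add: Im_divide cmod_power2 algebra_simps)
  thus eq: "Im ((of_int a * \<tau> + of_int b) / ?w) = Im \<tau> / (norm ?w)\<^sup>2"
    using det by simp
  show "Im ((of_int a * \<tau> + of_int b) / ?w) > 0"
    unfolding eq using assms(1) nz by simp
qed

definition theta_factor :: "int \<Rightarrow> int \<Rightarrow> complex \<Rightarrow> complex" where
  "theta_factor c d \<tau> = theta_mult d * of_int (kronecker c d) * csqrt (of_int c * \<tau> + of_int d)"

lemma theta_factor_T: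
  assumes "4 dvd c" "odd d"
  shows "theta_factor c (d + c) \<tau> = theta_factor c d (\<tau> + 1)"
proof -
  have "of_int c * (\<tau> + 1) + of_int d = of_int c * \<tau> + of_int (d + c)" by (simp add: algebra_simps)
  thus ?thesis
    by (simp only: theta_factor_def kronecker_add_right[OF assms] theta_mult_cong[OF assms(2,1)])
qed

text \<open>
  The branch change of the square root and the sign change of the Kronecker symbol occur under
  the same condition on c and d.
\<close>
lemma theta_factor_U:
  assumes "4 dvd c" "odd d" "Im \<tau> > 0"
  shows "theta_factor (c + 4 * d) d \<tau> = theta_factor c d (\<tau> / (4 * \<tau> + 1)) * csqrt (4 * \<tau> + 1)"
proof -
  define z where "z = 4 * \<tau> + 1"
  define \<tau>' where "\<tau>' = \<tau> / (4 * \<tau> + 1)"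
  define w where "w = of_int c * \<tau>' + of_int d"
  have \<tau>': "Im \<tau>' > 0" unfolding \<tau>'_def by (rule Im_theta_U_pos[OF assms(3)])
  have z: "Im z > 0" using assms by (simp add: z_def)
  hence "z \<noteq> 0" by auto
  have d0: "d \<noteq> 0" using assms by auto
  have w0: "w \<noteq> 0"
  proof
    assume "w = 0"
    hence "real_of_int c * Im \<tau>' = 0" "of_int c * Re \<tau>' + of_int d = 0" by (auto simp: complex_eq_iff w_def)
    thus False using \<tau>' d0 by auto
  qed
  have wz: "w * z = of_int (c + 4 * d) * \<tau> + of_int d"
    using \<open>z \<noteq> 0\<close> unfolding w_def \<tau>'_def z_def by (simp add: field_simps)
  have Im_w: "Im w = of_int c * Im \<tau>'" by (simp add: w_def)
  have Im_wz: "Im (w * z) = of_int (c + 4 * d) * Im \<tau>"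
    unfolding wz by simp
  have Re_w: "Re w = of_int d" if "c = 0" using that by (simp add: w_def)
  have c1: "(Im w > 0 \<or> Im w = 0 \<and> Re w < 0) \<longleftrightarrow> c > 0 \<or> c = 0 \<and> d < 0"
    using \<tau>' Re_w by (auto simp: Im_w zero_less_mult_iff)
  have "Im (w * z) < 0 \<longleftrightarrow> of_int (c + 4 * d) < (0 :: real)"
    unfolding Im_wz using assms(3) by (auto simp: mult_less_0_iff)
  hence c2: "Im (w * z) < 0 \<longleftrightarrow> c + 4 * d < 0" by linarith
  have eq: "(c > 0 \<or> c = 0 \<and> d < 0) \<and> c + 4 * d < 0 \<longleftrightarrow> d < 0 \<and> (c < 0 \<longleftrightarrow> c + 4 * d \<ge> 0)"
    by auto
  have cs: "csqrt w * csqrt z =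
     (if d < 0 \<and> (c < 0 \<longleftrightarrow> c + 4 * d \<ge> 0) then -1 else 1) * csqrt (w * z)"
    using csqrt_mult_upper[OF z w0] unfolding c1 c2 eq .
  have "theta_factor c d \<tau>' * csqrt z = theta_mult d * of_int (kronecker c d) * (csqrt w * csqrt z)"
    by (simp add: theta_factor_def w_def)
  also have "\<dots> = theta_mult d * of_int (kronecker (c + 4 * d) d) * csqrt (w * z)"
    unfolding cs kronecker_add_left[OF assms(2)] by simp
  finally have "theta_factor c d \<tau>' * csqrt z = theta_factor (c + 4 * d) d \<tau>"
    unfolding wz by (simp only: theta_factor_def)
  thus ?thesis by (simp only: \<tau>'_def z_def)
qed

text \<open>
  Right multiplication by T or U, or an inverse, changes d by c or c by 4d. As |c| and 2|d| are
  never equal, one of these steps decreases |c| + |d| until c = 0, where only translations and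
  their negatives remain.
\<close>
theorem theta_transformation:
  assumes "a * d - b * c = 1" "4 dvd c" "Im \<tau> > 0"
  shows "theta ((of_int a * \<tau> + of_int b) / (of_int c * \<tau> + of_int d)) = theta_factor c d \<tau> * theta \<tau>"
  using assms
proof (induction "nat (\<bar>c\<bar> + \<bar>d\<bar>)" arbitrary: a b c d \<tau> rule: less_induct)
  case less
  note det = less.prems(1) and c4 = less.prems(2) and \<tau> = less.prems(3)
  have odd: "odd d"
  proof
    assume "even d"
    hence "even (a * d - b * c)" using c4 by auto
    thus False using det by simp
  qed
  consider "c = 0" | "c \<noteq> 0" "\<bar>c\<bar> < 2 * \<bar>d\<bar>" "c * d > 0" | "c \<noteq> 0" "\<bar>c\<bar> < 2 * \<bar>d\<bar>" "c * d < 0"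
    | "\<bar>c\<bar> > 2 * \<bar>d\<bar>" "c * d > 0" | "\<bar>c\<bar> > 2 * \<bar>d\<bar>" "c * d < 0"
  proof -
    have "\<bar>c\<bar> \<noteq> 2 * \<bar>d\<bar>" using odd c4 by presburger
    moreover have "d \<noteq> 0" using odd by auto
    ultimately show ?thesis using that by (metis linorder_less_linear mult_eq_0_iff)
  qed
  thus ?case
  proof cases
    case 1
    hence "a * d = 1" using det by simp
    hence ad: "a = 1 \<and> d = 1 \<or> a = -1 \<and> d = -1" by (metis mult.commute pos_zmult_eq_1_iff_lemma zmult_eq_1_iff)
    have k: "kronecker 0 1 = 1" "kronecker 0 (-1) = 1" by (simp_all add: kronecker_odd)
    have tm: "theta_mult 1 = 1" "theta_mult (-1) = - \<i>" by (simp_all add: theta_mult_eq)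
    from ad show ?thesis
    proof
      assume "a = 1 \<and> d = 1"
      thus ?thesis using 1 theta_add_int[OF \<tau>, of b] by (simp add: theta_factor_def k tm)
    next
      assume ad: "a = -1 \<and> d = -1"
      have "(of_int a * \<tau> + of_int b) / (of_int c * \<tau> + of_int d) = \<tau> + of_int (- b)"
        using ad 1 by (simp add: field_simps)
      thus ?thesis using ad 1 theta_add_int[OF \<tau>, of "-b"] by (simp add: theta_factor_def k tm)
    qed
  next
    case 2
    (* the matrix times the inverse of T, evaluated at tau + 1 *)
    have "nat (\<bar>c\<bar> + \<bar>d - c\<bar>) < nat (\<bar>c\<bar> + \<bar>d\<bar>)"
      using 2 by (auto simp: zero_less_mult_iff abs_if split: if_splits)
    moreover have "a * (d - c) - (b - a) * c = 1" using det by (simp add: algebra_simps)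
    ultimately have "theta ((of_int a * (\<tau> + 1) + of_int (b - a)) / (of_int c * (\<tau> + 1) + of_int (d - c))) =
        theta_factor c (d - c) (\<tau> + 1) * theta (\<tau> + 1)"
      using \<tau> c4 by (intro less.hyps) auto
    moreover have "theta_factor c (d - c) (\<tau> + 1) = theta_factor c d \<tau>"
      using theta_factor_T[OF c4, of "d - c" \<tau>] odd c4 by auto
    ultimately show ?thesis using theta_add_1[OF \<tau>] by (simp add: algebra_simps)
  next
    case 3
    (* the matrix times T, evaluated at tau - 1 *)
    have "nat (\<bar>c\<bar> + \<bar>d + c\<bar>) < nat (\<bar>c\<bar> + \<bar>d\<bar>)"
      using 3 by (auto simp: mult_less_0_iff abs_if split: if_splits)
    moreover have "a * (d + c) - (b + a) * c = 1" using det by (simp add: algebra_simps)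
    ultimately have "theta ((of_int a * (\<tau> - 1) + of_int (b + a)) / (of_int c * (\<tau> - 1) + of_int (d + c))) =
        theta_factor c (d + c) (\<tau> - 1) * theta (\<tau> - 1)"
      using \<tau> c4 by (intro less.hyps) auto
    moreover have "theta_factor c (d + c) (\<tau> - 1) = theta_factor c d \<tau>"
      using theta_factor_T[OF c4, of d "\<tau> - 1"] odd by auto
    moreover have "theta (\<tau> - 1) = theta \<tau>" using theta_add_1[of "\<tau> - 1"] \<tau> by simp
    ultimately show ?thesis by (simp add: algebra_simps)
  next
    case 4
    (* the matrix times the inverse of U, evaluated at U(tau) *)
    define \<sigma> where "\<sigma> = \<tau> / (4 * \<tau> + 1)"
    have nz: "4 * \<tau> + 1 \<noteq> 0" using \<tau> by (auto simp: complex_eq_iff)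
    have \<sigma>: "Im \<sigma> > 0" unfolding \<sigma>_def by (rule Im_theta_U_pos[OF \<tau>])
    have "nat (\<bar>c - 4 * d\<bar> + \<bar>d\<bar>) < nat (\<bar>c\<bar> + \<bar>d\<bar>)"
      using 4 by (auto simp: zero_less_mult_iff abs_if split: if_splits)
    moreover have "(a - 4 * b) * d - b * (c - 4 * d) = 1" using det by (simp add: algebra_simps)
    ultimately have "theta ((of_int (a - 4 * b) * \<sigma> + of_int b) / (of_int (c - 4 * d) * \<sigma> + of_int d)) =
        theta_factor (c - 4 * d) d \<sigma> * theta \<sigma>"
      using \<sigma> c4 by (intro less.hyps) auto
    also have "theta \<sigma> = csqrt (4 * \<tau> + 1) * theta \<tau>" unfolding \<sigma>_def by (rule theta_U[OF \<tau>])
    also have "theta_factor (c - 4 * d) d \<sigma> * (csqrt (4 * \<tau> + 1) * theta \<tau>) = theta_factor c d \<tau> * theta \<tau>"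
      using theta_factor_U[of "c - 4 * d" d \<tau>] c4 odd \<tau> by (simp add: \<sigma>_def)
    also have "(of_int (a - 4 * b) * \<sigma> + of_int b) / (of_int (c - 4 * d) * \<sigma> + of_int d) =
        ((of_int (a - 4 * b) * \<sigma> + of_int b) * (4 * \<tau> + 1)) / ((of_int (c - 4 * d) * \<sigma> + of_int d) * (4 * \<tau> + 1))"
      using nz by simp
    also have "(of_int (a - 4 * b) * \<sigma> + of_int b) * (4 * \<tau> + 1) = of_int a * \<tau> + of_int b"
      using nz by (simp add: \<sigma>_def field_simps)
    also have "(of_int (c - 4 * d) * \<sigma> + of_int d) * (4 * \<tau> + 1) = of_int c * \<tau> + of_int d"
      using nz by (simp add: \<sigma>_def field_simps)
    finally show ?thesis .
  next
    case 5
    (* the matrix times U, evaluated at the preimage of tau under U *)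
    define \<sigma> where "\<sigma> = \<tau> / (- 4 * \<tau> + 1)"
    have nz: "- 4 * \<tau> + 1 \<noteq> 0" using \<tau> by (auto simp: complex_eq_iff)
    have \<sigma>: "Im \<sigma> > 0"
      using Im_moebius_pos(1)[OF \<tau>, of 1 1 0 "-4"] by (simp add: \<sigma>_def)
    have nz': "4 * \<sigma> + 1 \<noteq> 0" using \<sigma> by (auto simp: complex_eq_iff)
    have \<tau>_eq: "\<tau> = \<sigma> / (4 * \<sigma> + 1)"
    proof -
      have "4 * \<sigma> + 1 = 1 / (- 4 * \<tau> + 1)" using nz by (simp add: \<sigma>_def field_simps)
      thus ?thesis using nz by (simp add: \<sigma>_def)
    qed
    have "nat (\<bar>c + 4 * d\<bar> + \<bar>d\<bar>) < nat (\<bar>c\<bar> + \<bar>d\<bar>)"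
      using 5 by (auto simp: mult_less_0_iff abs_if split: if_splits)
    moreover have "(a + 4 * b) * d - b * (c + 4 * d) = 1" using det by (simp add: algebra_simps)
    ultimately have "theta ((of_int (a + 4 * b) * \<sigma> + of_int b) / (of_int (c + 4 * d) * \<sigma> + of_int d)) =
        theta_factor (c + 4 * d) d \<sigma> * theta \<sigma>"
      using \<sigma> c4 by (intro less.hyps) auto
    also have "\<dots> = theta_factor c d \<tau> * (csqrt (4 * \<sigma> + 1) * theta \<sigma>)"
      using theta_factor_U[OF c4 odd \<sigma>] by (simp add: \<tau>_eq[symmetric])
    also have "csqrt (4 * \<sigma> + 1) * theta \<sigma> = theta \<tau>"
      using theta_U[OF \<sigma>] by (simp add: \<tau>_eq[symmetric])
    also have "(of_int (a + 4 * b) * \<sigma> + of_int b) / (of_int (c + 4 * d) * \<sigma> + of_int d) =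
        ((of_int a * \<tau> + of_int b) * (4 * \<sigma> + 1)) / ((of_int c * \<tau> + of_int d) * (4 * \<sigma> + 1))"
    proof -
      have ts: "\<tau> * (4 * \<sigma> + 1) = \<sigma>" using nz' by (subst \<tau>_eq) simp
      have "(of_int x * \<tau> + of_int y) * (4 * \<sigma> + 1) = of_int (x + 4 * y) * \<sigma> + of_int y" for x y :: int
      proof -
        have "(of_int x * \<tau> + of_int y) * (4 * \<sigma> + 1) = of_int x * (\<tau> * (4 * \<sigma> + 1)) + of_int y * (4 * \<sigma> + 1)"
          by (simp add: algebra_simps)
        also have "\<dots> = of_int (x + 4 * y) * \<sigma> + of_int y" unfolding ts by (simp add: algebra_simps)
        finally show ?thesis .
      qed
      thus ?thesis by (simp only:)
    qed
    also have "\<dots> = (of_int a * \<tau> + of_int b) / (of_int c * \<tau> + of_int d)"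
      using nz' by simp
    finally show ?thesis .
  qed
qed

section \<open>Sign characters of the eta quotients\<close>

text \<open>
  Indexing the three eta quotients lets statements about them be proved and applied uniformly;
  their behaviour differs only through the sign characters and through the permutation of the
  three by the modular group.
\<close>
datatype eta_kind = Natural | Flat | Sharp

fun eta_fn :: "eta_kind \<Rightarrow> complex \<Rightarrow> complex" where
  "eta_fn Natural = eta_natural"
| "eta_fn Flat = eta_flat"
| "eta_fn Sharp = eta_sharp"

lemma eta_kind_UNIV: "UNIV = {Natural, Flat, Sharp}"
  using eta_kind.exhaust by auto

lemma eta_fn_nonzero: "Im \<tau> > 0 \<Longrightarrow> eta_fn x \<tau> \<noteq> 0"
  by (cases x) (auto simp: eta_nonzeros)

lemma eta_fn_holomorphic: "eta_fn x holomorphic_on upper_half_plane"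
  by (cases x) (auto simp: eta_natural_holomorphic eta_flat_holomorphic eta_sharp_holomorphic)

lemma odd_diagonal:
  fixes a b c d :: int
  assumes "a * d - b * c = 1" "4 dvd c"
  shows "odd a" "odd d"
proof -
  have "even c" using assms(2) by auto
  hence "even (b * c)" by simp
  moreover have "a * d = b * c + 1" using assms(1) by simp
  ultimately have "odd (a * d)" by simp
  thus "odd a" "odd d" by simp_all
qed

text \<open>
  Since eta_natural(\<tau>) = theta(\<tau>/2), this is the law of theta for the matrix with
  entries a, b/2, 2c, d.
\<close>
lemma natural_transformation:
  fixes a b c d :: int
  assumes det: "a * d - b * c = 1" and bc: "4 dvd b" "4 dvd c" and \<tau>: "Im \<tau> > 0"
  shows "eta_natural ((of_int a * \<tau> + of_int b) / (of_int c * \<tau> + of_int d)) =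
         of_int (sgn8 d) * theta_factor c d \<tau> * eta_natural \<tau>"
proof -
  have "even b" using bc(1) by auto
  then obtain b' where b': "b = 2 * b'" by (elim evenE)
  have odd: "odd d" using odd_diagonal[OF det bc(2)] by simp
  have "theta ((of_int a * (\<tau> / 2) + of_int b') / (of_int (2 * c) * (\<tau> / 2) + of_int d)) =
     theta_factor (2 * c) d (\<tau> / 2) * theta (\<tau> / 2)"
    using \<tau> bc det by (intro theta_transformation) (auto simp: b')
  also have "theta_factor (2 * c) d (\<tau> / 2) = of_int (sgn8 d) * theta_factor c d \<tau>"
    using kronecker_two_mult[OF odd, of c] by (simp add: theta_factor_def)
  also have "of_int (2 * c) * (\<tau> / 2) + of_int d = of_int c * \<tau> + of_int d"
    by simp
  also have "of_int a * (\<tau> / 2) + of_int b' = (of_int a * \<tau> + of_int b) / 2"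
    by (simp add: b' add_divide_distrib)
  finally have "theta ((of_int a * \<tau> + of_int b) / 2 / (of_int c * \<tau> + of_int d)) =
     of_int (sgn8 d) * theta_factor c d \<tau> * theta (\<tau> / 2)" .
  moreover have "2 * (x / 2 / y) = x / y" "2 * (x / 2) = x" for x y :: complex by simp_all
  ultimately show ?thesis by (simp only: theta_def)
qed

text \<open>
  Since eta_flat(\<tau>) = theta((\<tau>+1)/2), this is the law of theta for a conjugate by a
  translation.
\<close>
lemma flat_transformation:
  fixes a b c d :: int
  assumes det: "a * d - b * c = 1" and bc: "4 dvd b" "4 dvd c" and \<tau>: "Im \<tau> > 0"
  shows "eta_flat ((of_int a * \<tau> + of_int b) / (of_int c * \<tau> + of_int d)) =
         of_int (sgn8 (d - c)) * theta_factor c d \<tau> * eta_flat \<tau>"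
proof -
  note odd = odd_diagonal[OF det bc(2)]
  have dbl: "2 * (x / 2) = x" for x :: complex by simp
  have odd': "odd (d - c)" using odd bc by auto
  have "even (b + d - a - c)" using odd bc by auto
  then obtain e where e: "b + d - a - c = 2 * e" by (elim evenE)
  note pos = Im_moebius_pos[OF \<tau> det]
  have "(a + c) * (d - c) - e * (2 * c) = (a + c) * (d - c) - (b + d - a - c) * c" unfolding e by simp
  also have "\<dots> = 1" using det by (simp add: algebra_simps)
  finally have det': "(a + c) * (d - c) - e * (2 * c) = 1" .
  have "theta ((of_int (a + c) * ((\<tau> + 1) / 2) + of_int e) / (of_int (2 * c) * ((\<tau> + 1) / 2) + of_int (d - c))) =
     theta_factor (2 * c) (d - c) ((\<tau> + 1) / 2) * theta ((\<tau> + 1) / 2)"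
    using \<tau> bc det' by (intro theta_transformation) auto
  also have "theta_factor (2 * c) (d - c) ((\<tau> + 1) / 2) = of_int (sgn8 (d - c)) * theta_factor c (d - c) (\<tau> + 1)"
    using kronecker_two_mult[OF odd', of c] by (simp add: theta_factor_def)
  also have "theta_factor c (d - c) (\<tau> + 1) = theta_factor c d \<tau>"
    using theta_factor_T[OF bc(2) odd', of \<tau>] by simp
  also have "theta ((\<tau> + 1) / 2) = eta_flat \<tau>"
    by (simp only: theta_def dbl eta_T(1)[OF \<tau>])
  also have "of_int (2 * c) * ((\<tau> + 1) / 2) + of_int (d - c) = of_int c * \<tau> + of_int d"
    by (simp add: field_simps)
  also have "(of_int (a + c) * ((\<tau> + 1) / 2) + of_int e) / (of_int c * \<tau> + of_int d) =
        ((of_int a * \<tau> + of_int b) / (of_int c * \<tau> + of_int d) + 1) / 2"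
  proof -
    have e2: "2 * of_int e = (of_int (b + d - a - c) :: complex)" unfolding e by simp
    have "2 * (of_int (a + c) * ((\<tau> + 1) / 2) + of_int e) =
        of_int (a + c) * (2 * ((\<tau> + 1) / 2)) + 2 * of_int e"
      by (simp only: distrib_left mult.left_commute)
    also have "\<dots> = (of_int a * \<tau> + of_int b) + (of_int c * \<tau> + of_int d)"
      unfolding dbl e2 by (simp add: algebra_simps)
    finally have "2 * (of_int (a + c) * ((\<tau> + 1) / 2) + of_int e) = (of_int a * \<tau> + of_int b) + (of_int c * \<tau> + of_int d)" .
    hence "of_int (a + c) * ((\<tau> + 1) / 2) + of_int e = ((of_int a * \<tau> + of_int b) + (of_int c * \<tau> + of_int d)) / 2"
      by (metis nonzero_mult_div_cancel_left zero_neq_numeral)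
    moreover have "(N + D) / 2 / D = (N / D + 1) / 2" if "D \<noteq> 0" for N D :: complex
      using that by (simp add: field_simps)
    from this[OF pos(2)] have "((of_int a * \<tau> + of_int b) + (of_int c * \<tau> + of_int d)) / 2 / (of_int c * \<tau> + of_int d) =
        ((of_int a * \<tau> + of_int b) / (of_int c * \<tau> + of_int d) + 1) / 2" .
    ultimately show ?thesis by (simp only:)
  qed
  finally have "theta (((of_int a * \<tau> + of_int b) / (of_int c * \<tau> + of_int d) + 1) / 2) =
     of_int (sgn8 (d - c)) * theta_factor c d \<tau> * eta_flat \<tau>" .
  thus ?thesis by (simp only: theta_def dbl eta_T(1)[OF pos(1)])
qed

text \<open>
  Dividing by theta removes the square root from the inversion formula.
\<close>
lemma sharp_div_theta_S:
  assumes "Im \<sigma> > 0"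
  shows "eta_sharp (- 1 / \<sigma>) / theta (- 1 / \<sigma>) = csqrt 2 / 2 * (eta_flat \<sigma> / theta (\<sigma> / 4))"
proof -
  have "2 * (- 1 / \<sigma>) = - 1 / (\<sigma> / 2)" by simp
  hence "theta (- 1 / \<sigma>) = csqrt (- \<i> * \<sigma>) / csqrt 2 * theta (\<sigma> / 4)"
    using eta_S(1)[of "\<sigma> / 2"] assms unfolding csqrt_scale(2)[OF assms] by (simp add: theta_def)
  moreover have "csqrt (- \<i> * \<sigma>) \<noteq> 0" using assms by auto
  hence "(csqrt (- \<i> * \<sigma>) / 2 * f) / (csqrt (- \<i> * \<sigma>) / r * t) = r / 2 * (f / t)" for f r t
    by simp
  ultimately show ?thesis by (simp only: eta_S(3)[OF assms])
qed

text \<open>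
  Conjugation by S turns eta_sharp / theta into the quotient of eta_flat(\<sigma>) and
  theta(\<sigma>/4). As theta(\<sigma>/4) has the same multiplier as theta for matrices with
  upper right entry divisible by 4, the sign is that of eta_flat for the conjugate matrix.
\<close>
lemma sharp_transformation:
  fixes a b c d :: int
  assumes det: "a * d - b * c = 1" and bc: "4 dvd b" "4 dvd c" and \<tau>: "Im \<tau> > 0"
  shows "eta_sharp ((of_int a * \<tau> + of_int b) / (of_int c * \<tau> + of_int d)) =
         of_int (sgn8 (a + b)) * theta_factor c d \<tau> * eta_sharp \<tau>"
proof -
  define \<sigma> where "\<sigma> = - 1 / \<tau>"
  have \<tau>0: "\<tau> \<noteq> 0" using \<tau> by auto
  have \<sigma>: "Im \<sigma> > 0" unfolding \<sigma>_def by (rule Im_neg_inverse_pos[OF \<tau>])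
  have \<tau>\<sigma>: "\<tau> = - 1 / \<sigma>" by (simp add: \<sigma>_def)
  define g where "g = (of_int a * \<tau> + of_int b) / (of_int c * \<tau> + of_int d)"
  define g' where "g' = (of_int d * \<sigma> + of_int (-c)) / (of_int (-b) * \<sigma> + of_int a)"
  have det': "d * a - (-c) * (-b) = 1" using det by (simp add: algebra_simps)
  note pos = Im_moebius_pos[OF \<tau> det, folded g_def]
  note pos' = Im_moebius_pos[OF \<sigma> det', folded g'_def]
  have gg': "g = - 1 / g'"
  proof -
    have 1: "of_int d * \<sigma> + of_int (-c) = - (of_int c * \<tau> + of_int d) / \<tau>"
      using \<tau>0 by (simp add: \<sigma>_def field_simps)
    have 2: "of_int (-b) * \<sigma> + of_int a = (of_int a * \<tau> + of_int b) / \<tau>"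
      using \<tau>0 by (simp add: \<sigma>_def field_simps)
    have "N / D = - 1 / ((- D / \<tau>) / (N / \<tau>))" for N D using \<tau>0 by simp
    thus ?thesis unfolding g_def g'_def 1 2 .
  qed
  have flat: "eta_flat g' = of_int (sgn8 (a + b)) * theta_factor (-b) a \<sigma> * eta_flat \<sigma>"
    unfolding g'_def using flat_transformation[OF det' _ _ \<sigma>] bc by simp
  have odd: "odd a" using odd_diagonal[OF det bc(2)] by simp
  obtain c' where c': "c = 4 * c'" using bc(2) by (auto elim: dvdE)
  have "theta ((of_int d * (\<sigma> / 4) + of_int (-c')) / (of_int (4 * -b) * (\<sigma> / 4) + of_int a)) =
      theta_factor (4 * -b) a (\<sigma> / 4) * theta (\<sigma> / 4)"
    using det' \<sigma> bc by (intro theta_transformation) (auto simp: c')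
  moreover have "(of_int d * (\<sigma> / 4) + of_int (-c')) / (of_int (4 * -b) * (\<sigma> / 4) + of_int a) = g' / 4"
    unfolding g'_def c' by (simp add: field_simps)
  moreover have "theta_factor (4 * -b) a (\<sigma> / 4) = theta_factor (-b) a \<sigma>"
    unfolding theta_factor_def kronecker_four_mult[OF odd] by simp
  ultimately have th: "theta (g' / 4) = theta_factor (-b) a \<sigma> * theta (\<sigma> / 4)"
    by (simp only:)
  have nz: "theta_factor (-b) a \<sigma> \<noteq> 0"
    using th theta_nonzero[of "g' / 4"] pos'(1) by auto
  have "eta_sharp g / theta g = csqrt 2 / 2 * (eta_flat g' / theta (g' / 4))"
    unfolding gg' by (rule sharp_div_theta_S[OF pos'(1)])
  also have "\<dots> = of_int (sgn8 (a + b)) * (csqrt 2 / 2 * (eta_flat \<sigma> / theta (\<sigma> / 4)))"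
    unfolding flat th using nz by simp
  also have "csqrt 2 / 2 * (eta_flat \<sigma> / theta (\<sigma> / 4)) = eta_sharp \<tau> / theta \<tau>"
    unfolding \<tau>\<sigma> by (rule sharp_div_theta_S[OF \<sigma>, symmetric])
  finally have "eta_sharp g = of_int (sgn8 (a + b)) * (theta g / theta \<tau>) * eta_sharp \<tau>"
    using theta_nonzero[OF pos(1)] by (simp add: field_simps)
  also have "theta g / theta \<tau> = theta_factor c d \<tau>"
    using theta_transformation[OF det bc(2) \<tau>] theta_nonzero[OF \<tau>] by (simp add: g_def)
  finally show ?thesis by (simp add: g_def)
qed

section \<open>Growth at infinity\<close>

lemma eventually_at_i_infinity: "eventually P at_i_infinity \<longleftrightarrow> (\<exists>B. \<forall>\<tau>. Im \<tau> > B \<longrightarrow> P \<tau>)"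
  unfolding at_i_infinity_def by (simp add: eventually_filtercomap_at_top_dense)

lemma at_i_infinity_upper: "eventually (\<lambda>\<tau>. Im \<tau> > B) at_i_infinity"
  unfolding eventually_at_i_infinity by blast

lemma tendsto_ee_scaled:
  assumes "c > 0"
  shows "((\<lambda>\<tau>. ee (of_real c * \<tau>)) \<longlongrightarrow> 0) at_i_infinity"
proof (rule tendsto_norm_zero_cancel)
  have "((\<lambda>y. exp (- (2 * pi * c) * y)) \<longlongrightarrow> 0) at_top"
    using assms by real_asymp
  hence "filterlim (\<lambda>\<tau>. exp (- (2 * pi * c) * Im \<tau>)) (nhds 0) at_i_infinity"
    unfolding at_i_infinity_def by (rule filterlim_compose[OF _ filterlim_filtercomap])
  moreover have "norm (ee (of_real c * \<tau>)) = exp (- (2 * pi * c) * Im \<tau>)" for \<tau>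
    by (simp add: norm_exp_eq_Re mult.assoc)
  ultimately show "((\<lambda>\<tau>. norm (ee (of_real c * \<tau>))) \<longlongrightarrow> 0) at_i_infinity"
    by (simp only:)
qed

lemma euler_phi_tendsto_1:
  assumes "c > 0"
  shows "((\<lambda>\<tau>. euler_phi (ee (of_real c * \<tau>))) \<longlongrightarrow> 1) at_i_infinity"
proof -
  have "isCont euler_phi 0"
    using holomorphic_on_imp_continuous_on[OF euler_phi_holomorphic]
    by (simp add: continuous_on_eq_continuous_at)
  from isCont_tendsto_compose[OF this tendsto_ee_scaled[OF assms]] show ?thesis by simp
qed

lemma eta_tendsto:
  shows "(eta_natural \<longlongrightarrow> 1) at_i_infinity" "(eta_flat \<longlongrightarrow> 1) at_i_infinity"
    "((\<lambda>\<tau>. eta_sharp \<tau> / exp (pi * \<i> * \<tau> / 4)) \<longlongrightarrow> 1) at_i_infinity"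
proof -
  define A B C where "A = (\<lambda>\<tau>. euler_phi (ee \<tau>))" and "B = (\<lambda>\<tau>. euler_phi (ee (\<tau> / 2)))"
    and "C = (\<lambda>\<tau>. euler_phi (ee (2 * \<tau>)))"
  have lim: "(A \<longlongrightarrow> 1) at_i_infinity" "(B \<longlongrightarrow> 1) at_i_infinity" "(C \<longlongrightarrow> 1) at_i_infinity"
    unfolding A_def B_def C_def
    using euler_phi_tendsto_1[of 1] euler_phi_tendsto_1[of "1/2"] euler_phi_tendsto_1[of 2] by simp_all
  define z where "z = (\<lambda>\<tau>::complex. exp (pi * \<i> * \<tau> / 24))"
  have z: "z \<tau> \<noteq> 0" "exp (pi * \<i> * \<tau> / 12) = z \<tau> ^ 2" "exp (pi * \<i> * (\<tau> / 2) / 12) = z \<tau>"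
    "exp (pi * \<i> * (2 * \<tau>) / 12) = z \<tau> ^ 4" "exp (pi * \<i> * \<tau> / 4) = z \<tau> ^ 6" for \<tau>
    unfolding z_def exp_of_nat_mult[symmetric]
    by (auto intro!: arg_cong[of _ _ exp] simp flip: exp_of_nat_mult)
  have e: "dedekind_eta \<tau> = z \<tau> ^ 2 * A \<tau>" "dedekind_eta (\<tau> / 2) = z \<tau> * B \<tau>"
    "dedekind_eta (2 * \<tau>) = z \<tau> ^ 4 * C \<tau>" for \<tau>
    unfolding A_def B_def C_def
    by (simp only: dedekind_eta_eq z(2), simp only: dedekind_eta_eq z(3), simp only: dedekind_eta_eq z(4))
  have "eta_natural = (\<lambda>\<tau>. A \<tau> ^ 5 / (B \<tau> ^ 2 * C \<tau> ^ 2))"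
  proof
    fix \<tau>
    have "z \<tau> ^ 10 \<noteq> 0" using z by simp
    have "eta_natural \<tau> = (z \<tau> ^ 10 * A \<tau> ^ 5) / (z \<tau> ^ 10 * (B \<tau> ^ 2 * C \<tau> ^ 2))"
      unfolding eta_natural_def e(1)[of \<tau>] e(2)[of \<tau>] e(3)[of \<tau>] by (simp add: power_mult_distrib mult_ac flip: power_mult power_add)
    thus "eta_natural \<tau> = A \<tau> ^ 5 / (B \<tau> ^ 2 * C \<tau> ^ 2)" using z(1) by simp
  qed
  moreover have "((\<lambda>\<tau>. A \<tau> ^ 5 / (B \<tau> ^ 2 * C \<tau> ^ 2)) \<longlongrightarrow> 1 ^ 5 / (1 ^ 2 * 1 ^ 2)) at_i_infinity"
    by (intro tendsto_intros lim) auto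
  ultimately show "(eta_natural \<longlongrightarrow> 1) at_i_infinity" by simp
  have "eta_flat = (\<lambda>\<tau>. B \<tau> ^ 2 / A \<tau>)"
    by (rule ext, simp only: eta_flat_def e(2), subst e(1)) (use z(1) in \<open>simp add: power_mult_distrib\<close>)
  moreover have "((\<lambda>\<tau>. B \<tau> ^ 2 / A \<tau>) \<longlongrightarrow> 1 ^ 2 / 1) at_i_infinity"
    by (intro tendsto_intros lim) auto
  ultimately show "(eta_flat \<longlongrightarrow> 1) at_i_infinity" by simp
  have "eta_sharp \<tau> / exp (pi * \<i> * \<tau> / 4) = C \<tau> ^ 2 / A \<tau>" for \<tau>
  proof -
    have "eta_sharp \<tau> / exp (pi * \<i> * \<tau> / 4) = (z \<tau> ^ 8 * C \<tau> ^ 2) / (z \<tau> ^ 8 * A \<tau>)"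
      unfolding eta_sharp_def e(1)[of \<tau>] e(3)[of \<tau>] z(5) by (simp add: power_mult_distrib mult_ac flip: power_mult power_add)
    thus ?thesis using z(1) by simp
  qed
  moreover have "((\<lambda>\<tau>. C \<tau> ^ 2 / A \<tau>) \<longlongrightarrow> 1 ^ 2 / 1) at_i_infinity"
    by (intro tendsto_intros lim) auto
  ultimately show "((\<lambda>\<tau>. eta_sharp \<tau> / exp (pi * \<i> * \<tau> / 4)) \<longlongrightarrow> 1) at_i_infinity" by simp
qed

lemma eta_sharp_tendsto_0: "(eta_sharp \<longlongrightarrow> 0) at_i_infinity"
proof -
  have "((\<lambda>\<tau>. exp (pi * \<i> * \<tau> / 4)) \<longlongrightarrow> 0) at_i_infinity"
    using tendsto_ee_scaled[of "1/8"] by (simp add: mult_ac)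
  from tendsto_mult[OF this eta_tendsto(3)] show ?thesis by simp
qed

text \<open>
  The bounds match the leading terms 1, 1 and exp(\<pi>i\<tau>/4) of the three eta quotients.
  Only eta_sharp vanishes at infinity.
\<close>
lemma eta_lower_bounds:
  shows "x \<noteq> Sharp \<Longrightarrow> \<exists>B. \<forall>\<tau>. Im \<tau> > B \<longrightarrow> norm (eta_fn x \<tau>) \<ge> 1 / 2"
    "\<exists>B. \<forall>\<tau>. Im \<tau> > B \<longrightarrow> norm (eta_sharp \<tau>) \<ge> exp (- (pi / 4) * Im \<tau>) / 2"
proof -
  have *: "\<exists>B. \<forall>\<tau>. Im \<tau> > B \<longrightarrow> norm (f \<tau>) \<ge> 1 / 2" if "(f \<longlongrightarrow> 1) at_i_infinity" for f :: "complex \<Rightarrow> complex"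
  proof -
    have "((\<lambda>\<tau>. norm (f \<tau>)) \<longlongrightarrow> norm (1::complex)) at_i_infinity" by (rule tendsto_norm[OF that])
    hence "eventually (\<lambda>\<tau>. norm (f \<tau>) > 1 / 2) at_i_infinity"
      by (rule order_tendstoD) simp
    thus ?thesis unfolding eventually_at_i_infinity by (meson less_imp_le)
  qed
  show "\<exists>B. \<forall>\<tau>. Im \<tau> > B \<longrightarrow> norm (eta_fn x \<tau>) \<ge> 1 / 2" if "x \<noteq> Sharp"
    using that *[OF eta_tendsto(1)] *[OF eta_tendsto(2)] by (cases x) auto
  from *[OF eta_tendsto(3)] show "\<exists>B. \<forall>\<tau>. Im \<tau> > B \<longrightarrow> norm (eta_sharp \<tau>) \<ge> exp (- (pi / 4) * Im \<tau>) / 2"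
    by (simp add: norm_divide norm_exp_eq_Re field_simps)
qed

lemma eta_upper_bound: "\<exists>B C. \<forall>\<tau>. Im \<tau> > B \<longrightarrow> norm (eta_fn x \<tau>) \<le> C"
proof -
  have *: "\<exists>B C. \<forall>\<tau>. Im \<tau> > B \<longrightarrow> norm (f \<tau>) \<le> C" if "(f \<longlongrightarrow> l) at_i_infinity" for f :: "complex \<Rightarrow> complex" and l
  proof -
    have "((\<lambda>\<tau>. norm (f \<tau>)) \<longlongrightarrow> norm l) at_i_infinity" by (rule tendsto_norm[OF that])
    hence "eventually (\<lambda>\<tau>. norm (f \<tau>) < norm l + 1) at_i_infinity"
      by (rule order_tendstoD) simp
    thus ?thesis unfolding eventually_at_i_infinity by (meson less_imp_le)
  qed
  show ?thesis
    using *[OF eta_tendsto(1)] *[OF eta_tendsto(2)] *[OF eta_sharp_tendsto_0] by (cases x) auto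
qed

section \<open>Permutation of the eta quotients\<close>

text \<open>
  The cusp a/c determines which eta quotient vanishes there; it is a function of the parities of
  a and c.
\<close>
definition kind_of :: "int \<Rightarrow> int \<Rightarrow> eta_kind" where
  "kind_of a c = (if odd a \<and> odd c then Natural else if odd c then Flat else Sharp)"

text \<open>
  The eta quotients correspond to the nonzero vectors modulo 2: eta_sharp to (1,0), eta_flat to
  (0,1) and eta_natural to (1,1). A matrix acts on them by permuting these vectors.
\<close>
fun kind_image :: "int \<Rightarrow> int \<Rightarrow> int \<Rightarrow> int \<Rightarrow> eta_kind \<Rightarrow> eta_kind" where
  "kind_image a b c d Sharp = kind_of a c"
| "kind_image a b c d Flat = kind_of b d"
| "kind_image a b c d Natural = kind_of (a + b) (c + d)"

text \<open>
  In the laws under S and T the roots of unity disappear in the modulus, while powers of 2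
  remain; hence the constant.
\<close>
definition eta_permuted :: "int \<Rightarrow> int \<Rightarrow> int \<Rightarrow> int \<Rightarrow> bool" where
  "eta_permuted a b c d \<longleftrightarrow> (\<forall>y. \<exists>C>0. \<forall>\<tau>. Im \<tau> > 0 \<longrightarrow>
     norm (eta_fn (kind_image a b c d y) ((of_int a * \<tau> + of_int b) / (of_int c * \<tau> + of_int d))) =
     C * sqrt (norm (of_int c * \<tau> + of_int d)) * norm (eta_fn y \<tau>))"

fun T_kind :: "eta_kind \<Rightarrow> eta_kind" where
  "T_kind Natural = Flat" | "T_kind Flat = Natural" | "T_kind Sharp = Sharp"

fun S_kind :: "eta_kind \<Rightarrow> eta_kind" where
  "S_kind Natural = Natural" | "S_kind Flat = Sharp" | "S_kind Sharp = Flat"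

lemma norm_eta_T: "Im \<tau> > 0 \<Longrightarrow> norm (eta_fn (T_kind y) (\<tau> + 1)) = norm (eta_fn y \<tau>)"
  by (cases y) (simp_all add: eta_T norm_mult norm_exp_eq_Re)

lemma norm_eta_S: "\<exists>C>0. \<forall>\<tau>. Im \<tau> > 0 \<longrightarrow>
    norm (eta_fn (S_kind y) (- 1 / \<tau>)) = C * sqrt (norm \<tau>) * norm (eta_fn y \<tau>)"
proof -
  define C :: real where "C = (case y of Natural \<Rightarrow> 1 | Flat \<Rightarrow> 1 / 2 | Sharp \<Rightarrow> 2)"
  have "norm (eta_fn (S_kind y) (- 1 / \<tau>)) = C * sqrt (norm \<tau>) * norm (eta_fn y \<tau>)" if "Im \<tau> > 0" for \<tau>
    by (cases y; simp only: C_def eta_fn.simps S_kind.simps eta_S[OF that] norm_mult norm_csqrt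
          norm_divide eta_kind.case; simp)
  moreover have "C > 0" by (cases y) (simp_all add: C_def)
  ultimately show ?thesis by blast
qed

lemma eta_permuted_T:
  assumes "eta_permuted a b c d"
  shows "eta_permuted a (b + a) c (d + c)"
  unfolding eta_permuted_def
proof
  fix y
  obtain C where C: "C > 0" "\<And>\<tau>. Im \<tau> > 0 \<Longrightarrow>
     norm (eta_fn (kind_image a b c d (T_kind y)) ((of_int a * \<tau> + of_int b) / (of_int c * \<tau> + of_int d))) =
     C * sqrt (norm (of_int c * \<tau> + of_int d)) * norm (eta_fn (T_kind y) \<tau>)"
    using assms unfolding eta_permuted_def by blast
  have k: "kind_image a (b + a) c (d + c) y = kind_image a b c d (T_kind y)"
    by (cases y) (auto simp: kind_of_def)
  show "\<exists>C>0. \<forall>\<tau>. Im \<tau> > 0 \<longrightarrow>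
     norm (eta_fn (kind_image a (b + a) c (d + c) y) ((of_int a * \<tau> + of_int (b + a)) / (of_int c * \<tau> + of_int (d + c)))) =
     C * sqrt (norm (of_int c * \<tau> + of_int (d + c))) * norm (eta_fn y \<tau>)"
  proof (intro exI[of _ C] conjI allI impI C(1))
    fix \<tau> assume \<tau>: "Im \<tau> > 0"
    have eqs: "of_int a * \<tau> + of_int (b + a) = of_int a * (\<tau> + 1) + of_int b"
       "of_int c * \<tau> + of_int (d + c) = of_int c * (\<tau> + 1) + of_int d" by (simp_all add: algebra_simps)
    show "norm (eta_fn (kind_image a (b + a) c (d + c) y) ((of_int a * \<tau> + of_int (b + a)) / (of_int c * \<tau> + of_int (d + c)))) =
     C * sqrt (norm (of_int c * \<tau> + of_int (d + c))) * norm (eta_fn y \<tau>)"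
      using C(2)[of "\<tau> + 1"] \<tau> unfolding k eqs by (simp add: norm_eta_T)
  qed
qed

lemma eta_permuted_S:
  assumes "eta_permuted a b c d"
  shows "eta_permuted (-b) a (-d) c"
  unfolding eta_permuted_def
proof
  fix y
  obtain C where C: "C > 0" "\<And>\<tau>. Im \<tau> > 0 \<Longrightarrow>
     norm (eta_fn (kind_image a b c d (S_kind y)) ((of_int a * \<tau> + of_int b) / (of_int c * \<tau> + of_int d))) =
     C * sqrt (norm (of_int c * \<tau> + of_int d)) * norm (eta_fn (S_kind y) \<tau>)"
    using assms unfolding eta_permuted_def by blast
  obtain D where D: "D > 0" "\<And>\<tau>. Im \<tau> > 0 \<Longrightarrow>
    norm (eta_fn (S_kind y) (- 1 / \<tau>)) = D * sqrt (norm \<tau>) * norm (eta_fn y \<tau>)"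
    using norm_eta_S by blast
  have k: "kind_image (-b) a (-d) c y = kind_image a b c d (S_kind y)"
    by (cases y) (auto simp: kind_of_def)
  show "\<exists>C>0. \<forall>\<tau>. Im \<tau> > 0 \<longrightarrow>
     norm (eta_fn (kind_image (-b) a (-d) c y) ((of_int (-b) * \<tau> + of_int a) / (of_int (-d) * \<tau> + of_int c))) =
     C * sqrt (norm (of_int (-d) * \<tau> + of_int c)) * norm (eta_fn y \<tau>)"
  proof (intro exI[of _ "C * D"] conjI allI impI)
    show "C * D > 0" using C D by simp
    fix \<tau> assume \<tau>: "Im \<tau> > 0"
    hence \<tau>0: "\<tau> \<noteq> 0" by auto
    have eqs: "of_int (-b) * \<tau> + of_int a = - \<tau> * (of_int a * (- 1 / \<tau>) + of_int b)"
       "of_int (-d) * \<tau> + of_int c = - \<tau> * (of_int c * (- 1 / \<tau>) + of_int d)"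
      using \<tau>0 by (simp_all add: algebra_simps)
    have "(of_int (-b) * \<tau> + of_int a) / (of_int (-d) * \<tau> + of_int c) =
          (of_int a * (- 1 / \<tau>) + of_int b) / (of_int c * (- 1 / \<tau>) + of_int d)"
      unfolding eqs using \<tau>0 by simp
    moreover have "sqrt (norm (of_int (-d) * \<tau> + of_int c)) = sqrt (norm (of_int c * (- 1 / \<tau>) + of_int d)) * sqrt (norm \<tau>)"
      unfolding eqs(2) by (simp add: norm_mult real_sqrt_mult)
    ultimately show "norm (eta_fn (kind_image (-b) a (-d) c y) ((of_int (-b) * \<tau> + of_int a) / (of_int (-d) * \<tau> + of_int c))) =
     C * D * sqrt (norm (of_int (-d) * \<tau> + of_int c)) * norm (eta_fn y \<tau>)"
      using C(2)[OF Im_neg_inverse_pos[OF \<tau>]] D(2)[OF \<tau>] unfolding k by simp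
  qed
qed

text \<open>
  The inverse of T is a word in S and T, by the relation between S and ST.
\<close>
lemma eta_permuted_T_inv:
  assumes "eta_permuted a b c d"
  shows "eta_permuted a (b - a) c (d - c)"
  using eta_permuted_S[OF eta_permuted_T[OF eta_permuted_S[OF eta_permuted_T[OF eta_permuted_S[OF assms]]]]]
  by simp

lemma eta_permuted_uminus: "eta_permuted a b c d \<Longrightarrow> eta_permuted (-a) (-b) (-c) (-d)"
  using eta_permuted_S[OF eta_permuted_S] by simp

lemma eta_permuted_1: "eta_permuted 1 b 0 1"
proof (induction b rule: int_induct[where k = 0])
  case base
  have "kind_image 1 0 0 1 y = y" for y by (cases y) (auto simp: kind_of_def)
  thus ?case unfolding eta_permuted_def by (auto intro!: exI[of _ 1])
next
  case (step1 i)
  from eta_permuted_T[OF step1(2)] show ?case by simp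
next
  case (step2 i)
  from eta_permuted_T_inv[OF step2(2)] show ?case by simp
qed

text \<open>
  The modular group is generated by S and T; right multiplication by them runs the Euclidean
  algorithm on the lower row.
\<close>
lemma eta_permuted_SL2Z:
  assumes "a * d - b * c = 1"
  shows "eta_permuted a b c d"
  using assms
  (* the last summand of the measure makes the exchange of c and d by S count as progress *)
proof (induction "nat (2 * (\<bar>c\<bar> + \<bar>d\<bar>) + (if \<bar>d\<bar> < \<bar>c\<bar> then 1 else 0))" arbitrary: a b c d rule: less_induct)
  case less
  note det = less.prems
  consider "c = 0" | "c \<noteq> 0" "\<bar>d\<bar> < \<bar>c\<bar>" | "c \<noteq> 0" "\<bar>c\<bar> \<le> \<bar>d\<bar>" "c * d > 0" | "c \<noteq> 0" "\<bar>c\<bar> \<le> \<bar>d\<bar>" "c * d < 0"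
  proof -
    have "d \<noteq> 0 \<Longrightarrow> c \<noteq> 0 \<Longrightarrow> c * d > 0 \<or> c * d < 0" by (metis linorder_less_linear mult_eq_0_iff)
    thus ?thesis using that by fastforce
  qed
  thus ?case
  proof cases
    case 1
    hence "a * d = 1" using det by simp
    hence ad: "a = 1 \<and> d = 1 \<or> a = -1 \<and> d = -1" by (metis mult.commute pos_zmult_eq_1_iff_lemma zmult_eq_1_iff)
    thus ?thesis using 1 eta_permuted_1[of b] eta_permuted_uminus[OF eta_permuted_1[of "-b"]] by auto
  next
    case 2
    have "eta_permuted b (-a) d (-c)"
      using 2 det by (intro less.hyps) (auto simp: algebra_simps)
    from eta_permuted_S[OF this] show ?thesis by simp
  next
    case 3
    have "eta_permuted a (b - a) c (d - c)"
      using 3 det by (intro less.hyps) (auto simp: algebra_simps zero_less_mult_iff abs_if split: if_splits)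
    from eta_permuted_T[OF this] show ?thesis by simp
  next
    case 4
    have "eta_permuted a (b + a) c (d + c)"
      using 4 det by (intro less.hyps) (auto simp: algebra_simps mult_less_0_iff abs_if split: if_splits)
    from eta_permuted_T_inv[OF this] show ?thesis by simp
  qed
qed

section \<open>Expansions at infinity\<close>

lemma at_i_infinity_neq_bot: "at_i_infinity \<noteq> bot"
proof
  assume "at_i_infinity = bot"
  hence "eventually (\<lambda>_. False) at_i_infinity" by simp
  then obtain B where "\<And>\<tau>. \<not> Im \<tau> > B" unfolding eventually_at_i_infinity by blast
  from this[of "Complex 0 (B + 1)"] show False by simp
qed

abbreviation q8 :: "complex \<Rightarrow> complex" where
  "q8 \<tau> \<equiv> exp (pi * \<i> * \<tau> / 4)"

lemma norm_q8: "norm (q8 \<tau>) = exp (- (pi / 4) * Im \<tau>)"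
  by (simp add: norm_exp_eq_Re)

text \<open>
  The function h is g composed with a logarithm. Periodicity makes it independent of the branch,
  hence holomorphic in the punctured disc, and boundedness removes the singularity at 0.
\<close>
lemma q_expansion:
  assumes hol: "g holomorphic_on upper_half_plane"
    and per: "\<And>\<tau>. Im \<tau> > 0 \<Longrightarrow> g (\<tau> + 8) = g \<tau>"
    and bound: "\<And>\<tau>. Im \<tau> > B \<Longrightarrow> norm (g \<tau>) \<le> C"
  obtains h where "h holomorphic_on ball 0 1" "\<And>\<tau>. Im \<tau> > 0 \<Longrightarrow> g \<tau> = h (q8 \<tau>)"
proof -
  define t where "t = (\<lambda>L::complex. 4 / (pi * \<i>) * L)"
  define h0 where "h0 = (\<lambda>w. g (t (Ln w)))"
  have Im_t: "Im (t L) = - (4 / pi) * Re L" for L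
    by (simp add: t_def Im_divide field_simps power2_eq_square)
  have t_hol: "(\<lambda>w. t (k w)) holomorphic_on A" if "k holomorphic_on A" for k A
    unfolding t_def by (intro holomorphic_intros that)
  define g' where "g' = (\<lambda>\<tau>. if Im \<tau> > 0 then g \<tau> else 0)"
  have g'per: "g' (z + of_int n * 8) = g' z" for z n
    by (rule periodic_int_shift) (use per in \<open>auto simp: g'_def\<close>)
  have branch: "g (t L) = h0 w" if "exp L = w" "norm w < 1" for L w
  proof -
    have w: "w \<noteq> 0" using that by auto
    have "exp L = exp (Ln w)" using that w by simp
    then obtain n :: int where L: "L = Ln w + (of_int (2 * n) * pi) * \<i>" by (auto simp: exp_eq)
    have "t L = t (Ln w) + of_int n * 8" unfolding L t_def by (simp add: field_simps)
    hence "g' (t L) = g' (t (Ln w))" using g'per by simp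
    moreover have "norm w = exp (Re L)" using that by (simp add: norm_exp_eq_Re flip: that(1))
    hence "Re L < 0" using that(2) by simp
    hence "Im (t L) > 0" by (simp add: Im_t divide_neg_pos)
    moreover have "Re (Ln w) < 0" using w that(2) by (simp add: Re_Ln)
    hence "Im (t (Ln w)) > 0" by (simp add: Im_t divide_neg_pos)
    ultimately show ?thesis by (simp add: g'_def h0_def)
  qed
  have hol1: "h0 holomorphic_on (ball 0 1 - \<real>\<^sub>\<le>\<^sub>0)"
  proof -
    have "(g \<circ> (\<lambda>w. t (Ln w))) holomorphic_on (ball 0 1 - \<real>\<^sub>\<le>\<^sub>0)"
    proof (rule holomorphic_on_compose_gen[OF _ hol])
      show "(\<lambda>w. t (Ln w)) holomorphic_on (ball 0 1 - \<real>\<^sub>\<le>\<^sub>0)"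
        by (intro t_hol holomorphic_intros) auto
      show "(\<lambda>w. t (Ln w)) ` (ball 0 1 - \<real>\<^sub>\<le>\<^sub>0) \<subseteq> upper_half_plane"
      proof safe
        fix w :: complex assume w: "w \<in> ball 0 1" "w \<notin> \<real>\<^sub>\<le>\<^sub>0"
        hence "w \<noteq> 0" by auto
        hence "Re (Ln w) < 0" using w by (simp add: Re_Ln)
        thus "t (Ln w) \<in> upper_half_plane" by (simp add: upper_half_plane_def Im_t divide_neg_pos)
      qed
    qed
    thus ?thesis by (simp add: o_def h0_def)
  qed
  have hol2: "h0 holomorphic_on {w \<in> ball 0 1. - w \<notin> \<real>\<^sub>\<le>\<^sub>0}" (is "_ holomorphic_on ?A")
  proof -
    have "(g \<circ> (\<lambda>w. t (Ln (- w) + pi * \<i>))) holomorphic_on ?A"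
    proof (rule holomorphic_on_compose_gen[OF _ hol])
      show "(\<lambda>w. t (Ln (- w) + pi * \<i>)) holomorphic_on ?A"
        by (intro t_hol holomorphic_intros) auto
      show "(\<lambda>w. t (Ln (- w) + pi * \<i>)) ` ?A \<subseteq> upper_half_plane"
      proof safe
        fix w :: complex assume w: "w \<in> ball 0 1" "- w \<notin> \<real>\<^sub>\<le>\<^sub>0"
        hence "- w \<noteq> 0" by auto
        hence "Re (Ln (-w)) < 0" using w by (simp add: Re_Ln)
        thus "t (Ln (-w) + pi * \<i>) \<in> upper_half_plane" by (simp add: upper_half_plane_def Im_t divide_neg_pos)
      qed
    qed
    moreover have "(g \<circ> (\<lambda>w. t (Ln (- w) + pi * \<i>))) w = h0 w" if "w \<in> ?A" for w
    proof -
      have "- w \<noteq> 0" using that by auto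
      hence "exp (Ln (- w) + pi * \<i>) = w" by (simp add: exp_add)
      from branch[OF this] that show ?thesis by simp
    qed
    ultimately show ?thesis by (rule holomorphic_transform)
  qed
  have "h0 field_differentiable at w" if w: "w \<in> ball 0 1 - {0}" for w
  proof (cases "w \<in> \<real>\<^sub>\<le>\<^sub>0")
    case False
    have "open (ball (0::complex) 1 - \<real>\<^sub>\<le>\<^sub>0)" by (intro open_Diff) auto
    thus ?thesis using hol1 False w by (intro holomorphic_on_imp_differentiable_at[of h0 "ball 0 1 - \<real>\<^sub>\<le>\<^sub>0"]) auto
  next
    case True
    have "{w \<in> ball 0 1. - w \<notin> \<real>\<^sub>\<le>\<^sub>0} = ball 0 1 \<inter> uminus -` (- \<real>\<^sub>\<le>\<^sub>0 :: complex set)" by auto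
    moreover have "open (ball 0 1 \<inter> uminus -` (- \<real>\<^sub>\<le>\<^sub>0 :: complex set))"
      by (intro open_Int open_vimage open_Compl) (auto intro!: continuous_intros)
    ultimately have op: "open {w \<in> ball 0 1. - w \<notin> (\<real>\<^sub>\<le>\<^sub>0 :: complex set)}" by simp
    have "- w \<notin> \<real>\<^sub>\<le>\<^sub>0" using True w by (auto simp: complex_nonpos_Reals_iff complex_eq_iff)
    thus ?thesis using hol2 op w by (intro holomorphic_on_imp_differentiable_at[OF hol2 op]) auto
  qed
  hence hol0: "h0 holomorphic_on ball 0 1 - {0}"
    by (simp add: holomorphic_on_def field_differentiable_at_within)
  have "eventually (\<lambda>w. norm (h0 w) \<le> C) (at 0)"
  proof -
    have "norm (h0 w) \<le> C" if w: "w \<noteq> 0" "norm w < exp (- (pi / 4) * B)" for w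
    proof -
      have "ln (norm w) < ln (exp (- (pi / 4) * B))" using w by (subst ln_less_cancel_iff) auto
      hence "Im (t (Ln w)) > B" using w by (simp add: Im_t Re_Ln field_simps)
      thus ?thesis using bound by (simp add: h0_def)
    qed
    thus ?thesis unfolding eventually_at by (intro exI[of _ "exp (- (pi / 4) * B)"]) auto
  qed
  hence "\<exists>h. h holomorphic_on ball 0 1 \<and> (\<forall>z\<in>ball 0 1 - {0}. h z = h0 z)"
    using holomorphic_on_extend_bounded[OF hol0] by auto
  then obtain h where h: "h holomorphic_on ball 0 1" "\<And>z. z \<in> ball 0 1 - {0} \<Longrightarrow> h z = h0 z" by blast
  show ?thesis
  proof (rule that[OF h(1)])
    fix \<tau> assume \<tau>: "Im \<tau> > 0"
    have "norm (q8 \<tau>) < 1" using \<tau> by (simp add: norm_q8)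
    moreover have "t (pi * \<i> * \<tau> / 4) = \<tau>" by (simp add: t_def)
    ultimately show "g \<tau> = h (q8 \<tau>)" using branch[of "pi * \<i> * \<tau> / 4" "q8 \<tau>"] h(2)[of "q8 \<tau>"] by simp
  qed
qed

lemma q8_tendsto_0: "(q8 \<longlongrightarrow> 0) at_i_infinity"
  using tendsto_ee_scaled[of "1/8"] by (simp add: mult_ac)

text \<open>
  In both cases the constant term vanishes: an antiperiodic function corresponds to an odd
  function of exp(\<pi>i\<tau>/4).
\<close>
lemma q_expansion_decay:
  assumes hol: "g holomorphic_on upper_half_plane"
    and per: "\<And>\<tau>. Im \<tau> > 0 \<Longrightarrow> g (\<tau> + 8) = g \<tau>"
    and bound: "\<And>\<tau>. Im \<tau> > B \<Longrightarrow> norm (g \<tau>) \<le> C"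
    and van: "(g \<longlongrightarrow> 0) at_i_infinity \<or> (\<forall>\<tau>. Im \<tau> > 0 \<longrightarrow> g (\<tau> + 4) = - g \<tau>)"
  shows "\<exists>B C. \<forall>\<tau>. Im \<tau> > B \<longrightarrow> norm (g \<tau>) \<le> C * exp (- (pi / 4) * Im \<tau>)"
proof -
  obtain h where h: "h holomorphic_on ball 0 1" "\<And>\<tau>. Im \<tau> > 0 \<Longrightarrow> g \<tau> = h (q8 \<tau>)"
    using q_expansion[OF hol per bound] by blast
  have "h field_differentiable at 0"
    using h(1) by (rule holomorphic_on_imp_differentiable_at) auto
  then obtain D where D: "(h has_field_derivative D) (at 0)" by (auto simp: field_differentiable_def)
  have "isCont h 0" using D by (rule DERIV_isCont)
  from isCont_tendsto_compose[OF this q8_tendsto_0]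
  have "((\<lambda>\<tau>. h (q8 \<tau>)) \<longlongrightarrow> h 0) at_i_infinity" .
  hence lim: "(g \<longlongrightarrow> h 0) at_i_infinity"
    by (rule Lim_transform_eventually) (use h(2) in \<open>auto simp: eventually_at_i_infinity intro!: exI[of _ 0]\<close>)
  have "h 0 = 0" using van
  proof
    assume "(g \<longlongrightarrow> 0) at_i_infinity"
    with lim show ?thesis using at_i_infinity_neq_bot tendsto_unique by blast
  next
    assume *: "\<forall>\<tau>. Im \<tau> > 0 \<longrightarrow> g (\<tau> + 4) = - g \<tau>"
    have "filterlim (\<lambda>\<tau>::complex. \<tau> + 4) at_i_infinity at_i_infinity"
    proof -
      have "\<exists>B. \<forall>\<tau>. Im \<tau> > B \<longrightarrow> P (\<tau> + 4)" if "\<forall>\<tau>. Im \<tau> > B \<longrightarrow> P \<tau>" for P :: "complex \<Rightarrow> bool" and B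
        using that by (intro exI[of _ B]) auto
      thus ?thesis unfolding filterlim_iff eventually_at_i_infinity by blast
    qed
    from filterlim_compose[OF lim this] have "((\<lambda>\<tau>. g (\<tau> + 4)) \<longlongrightarrow> h 0) at_i_infinity" .
    hence "((\<lambda>\<tau>. - g \<tau>) \<longlongrightarrow> h 0) at_i_infinity"
      by (rule Lim_transform_eventually) (use * in \<open>auto simp: eventually_at_i_infinity intro!: exI[of _ 0]\<close>)
    moreover have "((\<lambda>\<tau>. - g \<tau>) \<longlongrightarrow> - h 0) at_i_infinity" by (rule tendsto_minus[OF lim])
    ultimately have "h 0 = - h 0" using at_i_infinity_neq_bot tendsto_unique by blast
    thus ?thesis by simp
  qed
  hence "((\<lambda>w. h w / w) \<longlongrightarrow> D) (at 0)" using D by (simp add: has_field_derivative_iff)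
  hence "((\<lambda>w. norm (h w / w)) \<longlongrightarrow> norm D) (at 0)" by (rule tendsto_norm)
  hence "eventually (\<lambda>w. norm (h w / w) < norm D + 1) (at 0)"
    by (rule order_tendstoD) simp
  then obtain r where r: "r > 0" "\<And>w. w \<noteq> 0 \<Longrightarrow> norm w < r \<Longrightarrow> norm (h w / w) < norm D + 1"
    unfolding eventually_at by auto
  have "eventually (\<lambda>\<tau>. norm (q8 \<tau>) < r) at_i_infinity"
    using tendsto_norm[OF q8_tendsto_0] r(1) by (intro order_tendstoD) auto
  then obtain B' where B': "\<And>\<tau>. Im \<tau> > B' \<Longrightarrow> norm (q8 \<tau>) < r"
    unfolding eventually_at_i_infinity by blast
  have "norm (g \<tau>) \<le> (norm D + 1) * exp (- (pi / 4) * Im \<tau>)" if "Im \<tau> > max B' 0" for \<tau>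
  proof -
    have "norm (h (q8 \<tau>) / q8 \<tau>) < norm D + 1" using that B' by (intro r(2)) auto
    hence "norm (h (q8 \<tau>)) \<le> (norm D + 1) * norm (q8 \<tau>)"
      by (simp add: norm_divide divide_less_eq)
    thus ?thesis using that h(2)[of \<tau>] unfolding norm_q8 by simp
  qed
  thus ?thesis by blast
qed

section \<open>Matrices acting on the upper half plane\<close>

definition mat2 :: "int \<Rightarrow> int \<Rightarrow> int \<Rightarrow> int \<Rightarrow> int^2^2" where
  "mat2 a b c d = vector [vector [a, b], vector [c, d]]"

lemma mat2_sel [simp]:
  "mat2 a b c d $ 1 $ 1 = a" "mat2 a b c d $ 1 $ 2 = b"
  "mat2 a b c d $ 2 $ 1 = c" "mat2 a b c d $ 2 $ 2 = d"
  by (simp_all add: mat2_def)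

lemma mat2_eqI:
  fixes A B :: "int^2^2"
  assumes "A $ 1 $ 1 = B $ 1 $ 1" "A $ 1 $ 2 = B $ 1 $ 2" "A $ 2 $ 1 = B $ 2 $ 1" "A $ 2 $ 2 = B $ 2 $ 2"
  shows "A = B"
  using assms by (simp add: vec_eq_iff forall_2)

lemma mat2_mult_sel:
  fixes A B :: "int^2^2"
  shows "(A ** B) $ 1 $ 1 = A $ 1 $ 1 * B $ 1 $ 1 + A $ 1 $ 2 * B $ 2 $ 1"
    "(A ** B) $ 1 $ 2 = A $ 1 $ 1 * B $ 1 $ 2 + A $ 1 $ 2 * B $ 2 $ 2"
    "(A ** B) $ 2 $ 1 = A $ 2 $ 1 * B $ 1 $ 1 + A $ 2 $ 2 * B $ 2 $ 1"
    "(A ** B) $ 2 $ 2 = A $ 2 $ 1 * B $ 1 $ 2 + A $ 2 $ 2 * B $ 2 $ 2"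
  by (simp_all add: matrix_matrix_mult_def sum_2)

lemma SL2Z_iff: "A \<in> SL2Z \<longleftrightarrow> A $ 1 $ 1 * A $ 2 $ 2 - A $ 1 $ 2 * A $ 2 $ 1 = 1"
  by (simp add: SL2Z_def det_2)

lemma SL2Z_mult: "A \<in> SL2Z \<Longrightarrow> B \<in> SL2Z \<Longrightarrow> A ** B \<in> SL2Z"
  by (simp add: SL2Z_def det_mul)

definition SL2Z_inv :: "int^2^2 \<Rightarrow> int^2^2" where
  "SL2Z_inv A = mat2 (A $ 2 $ 2) (- A $ 1 $ 2) (- A $ 2 $ 1) (A $ 1 $ 1)"

lemma SL2Z_inv_sel [simp]:
  "SL2Z_inv A $ 1 $ 1 = A $ 2 $ 2" "SL2Z_inv A $ 1 $ 2 = - A $ 1 $ 2"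
  "SL2Z_inv A $ 2 $ 1 = - A $ 2 $ 1" "SL2Z_inv A $ 2 $ 2 = A $ 1 $ 1"
  by (simp_all add: SL2Z_inv_def)

lemma SL2Z_inv_SL2Z: "A \<in> SL2Z \<Longrightarrow> SL2Z_inv A \<in> SL2Z"
  by (simp add: SL2Z_iff algebra_simps)

lemma SL2Z_inv_mult:
  assumes "A \<in> SL2Z"
  shows "A ** (SL2Z_inv A ** B) = B" "SL2Z_inv A ** (A ** B) = B" "B ** SL2Z_inv A ** A = B" "B ** A ** SL2Z_inv A = B"
proof -
  have 1: "A ** SL2Z_inv A = mat 1" "SL2Z_inv A ** A = mat 1"
    using assms by (auto intro!: mat2_eqI simp: mat2_mult_sel SL2Z_iff mat_def algebra_simps)
  show "A ** (SL2Z_inv A ** B) = B" "SL2Z_inv A ** (A ** B) = B" "B ** SL2Z_inv A ** A = B" "B ** A ** SL2Z_inv A = B"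
    by (simp_all only: matrix_mul_assoc 1 matrix_mul_lid) (simp_all only: 1 matrix_mul_rid flip: matrix_mul_assoc)
qed

text \<open>
  The modulus of the automorphy factor of weight k/2 is the k-th power of the square root of the
  modulus of this denominator.
\<close>
definition den :: "int^2^2 \<Rightarrow> complex \<Rightarrow> complex" where
  "den A \<tau> = of_int (A $ 2 $ 1) * \<tau> + of_int (A $ 2 $ 2)"

lemma SL2Z_moebius:
  assumes "A \<in> SL2Z" "Im \<tau> > 0"
  shows "Im (moebius A \<tau>) > 0" "den A \<tau> \<noteq> 0" "Im (moebius A \<tau>) = Im \<tau> / (norm (den A \<tau>))\<^sup>2"
  using Im_moebius_pos[OF assms(2), of "A $ 1 $ 1" "A $ 2 $ 2" "A $ 1 $ 2" "A $ 2 $ 1"] assms(1)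
  by (simp_all add: moebius_def den_def SL2Z_iff)

lemma moebius_mult:
  assumes "B \<in> SL2Z" "Im \<tau> > 0"
  shows "moebius (A ** B) \<tau> = moebius A (moebius B \<tau>)"
    "den (A ** B) \<tau> = den A (moebius B \<tau>) * den B \<tau>"
proof -
  define N where "N = of_int (B $ 1 $ 1) * \<tau> + of_int (B $ 1 $ 2)"
  define D where "D = den B \<tau>"
  have D: "D \<noteq> 0" using SL2Z_moebius[OF assms] by (simp add: D_def)
  have M: "moebius B \<tau> = N / D" by (simp add: moebius_def N_def D_def den_def)
  have 1: "of_int ((A ** B) $ 2 $ 1) * \<tau> + of_int ((A ** B) $ 2 $ 2) = of_int (A $ 2 $ 1) * N + of_int (A $ 2 $ 2) * D"
    "of_int ((A ** B) $ 1 $ 1) * \<tau> + of_int ((A ** B) $ 1 $ 2) = of_int (A $ 1 $ 1) * N + of_int (A $ 1 $ 2) * D"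
    by (simp_all add: mat2_mult_sel N_def D_def den_def algebra_simps)
  have 2: "of_int (A $ 2 $ 1) * (N / D) + of_int (A $ 2 $ 2) = (of_int (A $ 2 $ 1) * N + of_int (A $ 2 $ 2) * D) / D"
    "of_int (A $ 1 $ 1) * (N / D) + of_int (A $ 1 $ 2) = (of_int (A $ 1 $ 1) * N + of_int (A $ 1 $ 2) * D) / D"
    using D by (simp_all add: field_simps)
  show "moebius (A ** B) \<tau> = moebius A (moebius B \<tau>)"
    unfolding moebius_def[of A] moebius_def[of "A ** B"] M 1 2 using D by simp
  show "den (A ** B) \<tau> = den A (moebius B \<tau>) * den B \<tau>"
    unfolding den_def[of A] den_def[of "A ** B"] M 1 2 D_def[symmetric] using D by simp
qed

lemma moebius_mat2: "moebius (mat2 a b c d) \<tau> = (of_int a * \<tau> + of_int b) / (of_int c * \<tau> + of_int d)"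
  by (simp add: moebius_def)

lemma moebius_holomorphic:
  assumes "A \<in> SL2Z"
  shows "moebius A holomorphic_on upper_half_plane"
  unfolding moebius_def[abs_def]
  using SL2Z_moebius(2)[OF assms] by (intro holomorphic_intros) (auto simp: upper_half_plane_def den_def)

lemma compose_moebius_holomorphic:
  assumes "A \<in> SL2Z" "f holomorphic_on upper_half_plane"
  shows "(\<lambda>\<tau>. f (moebius A \<tau>)) holomorphic_on upper_half_plane"
proof -
  have "(f \<circ> moebius A) holomorphic_on upper_half_plane"
    by (rule holomorphic_on_compose_gen[OF moebius_holomorphic[OF assms(1)] assms(2)])
       (use SL2Z_moebius(1)[OF assms(1)] in \<open>auto simp: upper_half_plane_def\<close>)
  thus ?thesis by (simp only: o_def)
qed

text \<open>
  The conjugate A T^n A^(-1), which generates stabilisers of the cusp a/c = A(i\<infinity>).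
\<close>
definition T_conj :: "int \<Rightarrow> int^2^2 \<Rightarrow> int^2^2" where
  "T_conj n A = (let a = A $ 1 $ 1; c = A $ 2 $ 1 in
     mat2 (1 - n * a * c) (n * a * a) (- (n * c * c)) (1 + n * a * c))"

lemma T_conj_sel:
  "T_conj n A $ 1 $ 1 = 1 - n * (A $ 1 $ 1) * (A $ 2 $ 1)"
  "T_conj n A $ 1 $ 2 = n * (A $ 1 $ 1) * (A $ 1 $ 1)"
  "T_conj n A $ 2 $ 1 = - (n * (A $ 2 $ 1) * (A $ 2 $ 1))"
  "T_conj n A $ 2 $ 2 = 1 + n * (A $ 1 $ 1) * (A $ 2 $ 1)"
  by (simp_all add: T_conj_def Let_def)

lemma T_conj_SL2Z: "T_conj n A \<in> SL2Z"
  unfolding SL2Z_iff T_conj_sel by (simp add: algebra_simps)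

lemma moebius_T_conj:
  assumes "A \<in> SL2Z" "Im \<tau> > 0"
  shows "moebius A (\<tau> + of_int n) = moebius (T_conj n A) (moebius A \<tau>)"
    "den (T_conj n A) (moebius A \<tau>) = den A (\<tau> + of_int n) / den A \<tau>"
proof -
  define T where "T = mat2 1 n 0 1"
  have T: "T \<in> SL2Z" by (simp add: T_def SL2Z_iff)
  have det: "A $ 1 $ 1 * A $ 2 $ 2 - A $ 1 $ 2 * A $ 2 $ 1 = 1" using assms(1) by (simp add: SL2Z_iff)
  have eq: "A ** T = T_conj n A ** A"
  proof (rule mat2_eqI)
    show "(A ** T) $ 1 $ 2 = (T_conj n A ** A) $ 1 $ 2"
    proof -
      have "n * A $ 1 $ 1 * (A $ 1 $ 1 * A $ 2 $ 2 - A $ 1 $ 2 * A $ 2 $ 1) = n * A $ 1 $ 1" by (simp add: det)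
      thus ?thesis by (simp add: mat2_mult_sel T_conj_sel T_def algebra_simps)
    qed
    show "(A ** T) $ 2 $ 2 = (T_conj n A ** A) $ 2 $ 2"
    proof -
      have "n * A $ 2 $ 1 * (A $ 1 $ 1 * A $ 2 $ 2 - A $ 1 $ 2 * A $ 2 $ 1) = n * A $ 2 $ 1" by (simp add: det)
      thus ?thesis by (simp add: mat2_mult_sel T_conj_sel T_def algebra_simps)
    qed
  qed (simp_all add: mat2_mult_sel T_conj_sel T_def algebra_simps)
  have mT: "moebius T \<tau> = \<tau> + of_int n" "den T \<tau> = 1" by (simp_all add: moebius_def T_def den_def)
  show "moebius A (\<tau> + of_int n) = moebius (T_conj n A) (moebius A \<tau>)"
    using moebius_mult(1)[OF T assms(2), of A] moebius_mult(1)[OF assms, of "T_conj n A"] by (simp add: mT eq)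
  show "den (T_conj n A) (moebius A \<tau>) = den A (\<tau> + of_int n) / den A \<tau>"
    using moebius_mult(2)[OF T assms(2), of A] moebius_mult(2)[OF assms, of "T_conj n A"] SL2Z_moebius(2)[OF assms]
    by (simp add: mT eq eq_divide_eq)
qed

text \<open>
  The classical reduction: minimising |c\<tau> + d| over coprime pairs and then translating the
  real part into [-1/2, 1/2] leads to a point of modulus at least 1.
\<close>
lemma exists_moebius_Im_ge_half:
  assumes \<tau>: "Im \<tau> > 0"
  shows "\<exists>A\<in>SL2Z. Im (moebius A \<tau>) \<ge> 1 / 2"
proof -
  define P where "P = {(c, d). coprime c d \<and> norm (of_int c * \<tau> + of_int d) \<le> 1}"
  define N where "N = \<lceil>1 / Im \<tau>\<rceil>"
  define M where "M = \<lceil>1 + of_int N * norm \<tau>\<rceil>"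
  have "P \<subseteq> {-N..N} \<times> {-M..M}"
  proof safe
    fix c d assume "(c, d) \<in> P"
    hence n: "norm (of_int c * \<tau> + of_int d) \<le> 1" by (simp add: P_def)
    have "\<bar>of_int c * Im \<tau>\<bar> \<le> 1"
      using abs_Im_le_cmod[of "of_int c * \<tau> + of_int d"] n by simp
    hence "\<bar>of_int c\<bar> \<le> 1 / Im \<tau>" using \<tau> by (simp add: abs_mult field_simps)
    hence c: "\<bar>of_int c\<bar> \<le> (of_int N :: real)" unfolding N_def by linarith
    have "norm (of_int d :: complex) \<le> norm (of_int c * \<tau> + of_int d) + norm (of_int c * \<tau>)"
      by (metis add_diff_cancel_left' norm_triangle_ineq4)
    also have "\<dots> \<le> 1 + of_int N * norm \<tau>"
      using n c by (auto simp: norm_mult intro!: add_mono mult_right_mono)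
    finally have d: "\<bar>of_int d\<bar> \<le> (of_int M :: real)" unfolding M_def by simp linarith
    show "c \<in> {-N..N}" "d \<in> {-M..M}" using c d by auto
  qed
  hence fin: "finite P" by (rule finite_subset) auto
  have "(0, 1) \<in> P" by (simp add: P_def)
  hence "P \<noteq> {}" by auto
  define m where "m = Min ((\<lambda>(c, d). norm (of_int c * \<tau> + of_int d)) ` P)"
  have "m \<in> (\<lambda>(c, d). norm (of_int c * \<tau> + of_int d)) ` P"
    unfolding m_def using fin \<open>P \<noteq> {}\<close> by (intro Min_in) auto
  then obtain c d where cd: "(c, d) \<in> P" "m = norm (of_int c * \<tau> + of_int d)" by auto
  have min: "norm (of_int c * \<tau> + of_int d) \<le> norm (of_int c' * \<tau> + of_int d')" if "coprime c' d'" for c' d'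
  proof (cases "norm (of_int c' * \<tau> + of_int d') \<le> 1")
    case True
    hence "(c', d') \<in> P" using that by (simp add: P_def)
    hence "m \<le> norm (of_int c' * \<tau> + of_int d')"
      unfolding m_def using fin by (intro Min_le) force+
    thus ?thesis using cd by simp
  next
    case False
    thus ?thesis using cd by (auto simp: P_def)
  qed
  have "coprime c d" using cd by (simp add: P_def)
  then obtain b0 a where "b0 * c + a * d = 1" using bezout_int[of c d] by (metis coprime_iff_gcd_eq_1)
  hence det: "a * d - (- b0) * c = 1" by (simp add: algebra_simps)
  define A where "A = mat2 a (- b0) c d"
  have A: "A \<in> SL2Z" using det by (simp add: A_def SL2Z_iff)
  define n where "n = - round (Re (moebius A \<tau>))"
  define A' where "A' = mat2 (a + n * c) (- b0 + n * d) c d"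
  have A': "A' \<in> SL2Z" using det by (simp add: A'_def SL2Z_iff algebra_simps)
  have dn: "of_int c * \<tau> + of_int d \<noteq> 0" using SL2Z_moebius(2)[OF A \<tau>] by (simp add: den_def A_def)
  define \<sigma> where "\<sigma> = moebius A' \<tau>"
  have \<sigma>: "\<sigma> = moebius A \<tau> + of_int n"
    using dn unfolding \<sigma>_def A_def A'_def moebius_mat2 by (simp add: field_simps)
  have "\<bar>Re \<sigma>\<bar> \<le> 1 / 2"
    using of_int_round_abs_le[of "Re (moebius A \<tau>)"] by (simp add: \<sigma> n_def abs_minus_commute)
  hence "(Re \<sigma>)\<^sup>2 \<le> (1 / 2)\<^sup>2" using power2_le_iff_abs_le[of "1/2" "Re \<sigma>"] by simp
  have "coprime (a + n * c) (- b0 + n * d)"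
  proof (rule coprimeI)
    fix k assume "k dvd a + n * c" "k dvd - b0 + n * d"
    hence "k dvd (a + n * c) * d - (- b0 + n * d) * c" by (intro dvd_diff dvd_mult2)
    thus "is_unit k" using det by (simp add: algebra_simps)
  qed
  from min[OF this] have "norm (of_int c * \<tau> + of_int d) \<le> norm \<sigma> * norm (of_int c * \<tau> + of_int d)"
    using dn by (simp add: \<sigma>_def A'_def moebius_mat2 norm_divide)
  hence "norm \<sigma> \<ge> 1" using dn by simp
  hence "(norm \<sigma>)\<^sup>2 \<ge> 1" by simp
  moreover have "(norm \<sigma>)\<^sup>2 = (Re \<sigma>)\<^sup>2 + (Im \<sigma>)\<^sup>2" by (rule cmod_power2)
  moreover have "(1 / 2)\<^sup>2 = (1 / 4 :: real)" by (simp add: power2_eq_square)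
  ultimately have "(Im \<sigma>)\<^sup>2 \<ge> (1 / 2)\<^sup>2" using \<open>(Re \<sigma>)\<^sup>2 \<le> (1 / 2)\<^sup>2\<close> by linarith
  hence "Im \<sigma> \<ge> 1 / 2"
    using SL2Z_moebius(1)[OF A' \<tau>] by (intro power2_le_imp_le[of "1/2"]) (auto simp: \<sigma>_def)
  thus ?thesis using A' by (auto simp: \<sigma>_def)
qed

section \<open>Invariant functions of weight zero\<close>

lemma Gamma_principal_T_conj: "T_conj N A \<in> Gamma_principal N"
  by (auto simp: Gamma_principal_def T_conj_SL2Z T_conj_sel cong_iff_dvd_diff)

lemma Gamma_principal_quotient:
  assumes "A \<in> SL2Z" "B \<in> SL2Z"
    "[A $ 1 $ 1 = B $ 1 $ 1] (mod N)" "[A $ 1 $ 2 = B $ 1 $ 2] (mod N)"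
    "[A $ 2 $ 1 = B $ 2 $ 1] (mod N)" "[A $ 2 $ 2 = B $ 2 $ 2] (mod N)"
  shows "B ** SL2Z_inv A \<in> Gamma_principal N"
proof -
  have det: "A $ 1 $ 1 * A $ 2 $ 2 - A $ 1 $ 2 * A $ 2 $ 1 = 1" using assms(1) by (simp add: SL2Z_iff)
  have *: "[x' * y - z' * w = x * y - z * w] (mod N)" if "[x = x'] (mod N)" "[z = z'] (mod N)" for x x' z z' y w :: int
    using that by (intro cong_diff cong_mult) (auto intro: cong_sym)
  have "[B $ 1 $ 1 * A $ 2 $ 2 - B $ 1 $ 2 * A $ 2 $ 1 = 1] (mod N)"
    using *[OF assms(3,4), of "A $ 2 $ 2" "A $ 2 $ 1"] det by simp
  moreover have "[B $ 2 $ 2 * A $ 1 $ 1 - B $ 2 $ 1 * A $ 1 $ 2 = 1] (mod N)"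
    using *[OF assms(6,5), of "A $ 1 $ 1" "A $ 1 $ 2"] det by (simp add: algebra_simps)
  moreover have "[B $ 1 $ 2 * A $ 1 $ 1 - B $ 1 $ 1 * A $ 1 $ 2 = 0] (mod N)"
    using *[OF assms(4,3), of "A $ 1 $ 1" "A $ 1 $ 2"] by (simp add: algebra_simps)
  moreover have "[B $ 2 $ 1 * A $ 2 $ 2 - B $ 2 $ 2 * A $ 2 $ 1 = 0] (mod N)"
    using *[OF assms(5,6), of "A $ 2 $ 2" "A $ 2 $ 1"] by (simp add: algebra_simps)
  ultimately show ?thesis
    using SL2Z_mult[OF assms(2) SL2Z_inv_SL2Z[OF assms(1)]]
    by (simp add: Gamma_principal_def mat2_mult_sel)
qed

text \<open>
  Composition with the modular group yields only finitely many functions, one for each residue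
  class of matrices modulo 8, and each extends to the disc in the variable exp(\<pi>i\<tau>/4).
  By reduction theory all values occur for Im \<tau> \<ge> 1/2, that is, on a compact subdisc of
  one of these discs. So the maximal modulus is attained at an interior point.
\<close>
theorem Gamma8_invariant_bounded_constant:
  assumes hol: "f holomorphic_on upper_half_plane"
    and inv: "\<And>A \<tau>. A \<in> Gamma_principal 8 \<Longrightarrow> Im \<tau> > 0 \<Longrightarrow> f (moebius A \<tau>) = f \<tau>"
    and bound: "\<And>A. A \<in> SL2Z \<Longrightarrow> \<exists>B C. \<forall>\<tau>. Im \<tau> > B \<longrightarrow> norm (f (moebius A \<tau>)) \<le> C"
  shows "\<exists>c. \<forall>\<tau>. Im \<tau> > 0 \<longrightarrow> f \<tau> = c"
proof -
  have "\<exists>h. h holomorphic_on ball 0 1 \<and> (\<forall>\<tau>. Im \<tau> > 0 \<longrightarrow> f (moebius A \<tau>) = h (q8 \<tau>))"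
    if A: "A \<in> SL2Z" for A
  proof -
    obtain B C where BC: "\<And>\<tau>. Im \<tau> > B \<Longrightarrow> norm (f (moebius A \<tau>)) \<le> C" using bound[OF A] by blast
    have per: "f (moebius A (\<tau> + 8)) = f (moebius A \<tau>)" if \<tau>: "Im \<tau> > 0" for \<tau>
      using moebius_T_conj(1)[OF A \<tau>, of 8] inv[OF Gamma_principal_T_conj[of 8 A] SL2Z_moebius(1)[OF A \<tau>]] by simp
    show ?thesis
      by (rule q_expansion[OF compose_moebius_holomorphic[OF A hol] per BC]) auto
  qed
  then obtain h where h: "\<And>A. A \<in> SL2Z \<Longrightarrow> h A holomorphic_on ball 0 1"
     "\<And>A \<tau>. A \<in> SL2Z \<Longrightarrow> Im \<tau> > 0 \<Longrightarrow> f (moebius A \<tau>) = h A (q8 \<tau>)" by metis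
  define res where "res = (\<lambda>A::int^2^2. (A $ 1 $ 1 mod 8, A $ 1 $ 2 mod 8, A $ 2 $ 1 mod 8, A $ 2 $ 2 mod 8))"
  define R where "R = inv_into SL2Z res ` (res ` SL2Z)"
  have "res ` SL2Z \<subseteq> {0..<8} \<times> {0..<8} \<times> {0..<8} \<times> {0..<8}" by (auto simp: res_def)
  hence "finite (res ` SL2Z)" by (rule finite_subset) auto
  hence finR: "finite R" by (simp add: R_def)
  have RS: "R \<subseteq> SL2Z" unfolding R_def by (auto intro!: inv_into_into)
  have "mat2 1 0 0 1 \<in> SL2Z" by (simp add: SL2Z_iff)
  hence "R \<noteq> {}" by (auto simp: R_def)
  have rep: "\<exists>A\<in>R. \<forall>\<tau>. Im \<tau> > 0 \<longrightarrow> f (moebius B \<tau>) = f (moebius A \<tau>)" if B: "B \<in> SL2Z" for B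
  proof -
    define A where "A = inv_into SL2Z res (res B)"
    have A: "A \<in> SL2Z" "res A = res B" unfolding A_def using B by (auto intro!: inv_into_into f_inv_into_f)
    have "B ** SL2Z_inv A \<in> Gamma_principal 8"
      using A B by (intro Gamma_principal_quotient) (auto simp: res_def cong_def)
    hence "f (moebius (B ** SL2Z_inv A) (moebius A \<tau>)) = f (moebius A \<tau>)" if "Im \<tau> > 0" for \<tau>
      using inv SL2Z_moebius(1)[OF A(1) that] by blast
    moreover have "moebius (B ** SL2Z_inv A) (moebius A \<tau>) = moebius B \<tau>" if "Im \<tau> > 0" for \<tau>
      using moebius_mult(1)[OF A(1) that, of "B ** SL2Z_inv A"] by (simp add: SL2Z_inv_mult A(1))
    moreover have "A \<in> R" unfolding A_def R_def using B by blast
    ultimately show ?thesis by (intro bexI[of _ A]) auto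
  qed
  define r where "r = exp (- (pi / 8))"
  have r: "r < 1" "r > 0" by (simp_all add: r_def)
  have "\<exists>w\<in>cball 0 r. \<forall>v\<in>cball 0 r. norm (h A v) \<le> norm (h A w)" if "A \<in> R" for A
  proof (rule continuous_attains_sup)
    have "cball (0::complex) r \<subseteq> ball 0 1" using r by auto
    moreover have "A \<in> SL2Z" using that RS by blast
    ultimately show "continuous_on (cball 0 r) (\<lambda>v. norm (h A v))"
      by (intro continuous_on_norm holomorphic_on_imp_continuous_on holomorphic_on_subset[OF h(1)])
  qed (use r in auto)
  then obtain w where w: "\<And>A. A \<in> R \<Longrightarrow> w A \<in> cball 0 r"
     "\<And>A v. A \<in> R \<Longrightarrow> v \<in> cball 0 r \<Longrightarrow> norm (h A v) \<le> norm (h A (w A))" by metis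
  define m where "m = Max ((\<lambda>A. norm (h A (w A))) ` R)"
  have "m \<in> (\<lambda>A. norm (h A (w A))) ` R" unfolding m_def using finR \<open>R \<noteq> {}\<close> by (intro Max_in) auto
  then obtain A0 where A0: "A0 \<in> R" "m = norm (h A0 (w A0))" by auto
  have mle: "norm (h A v) \<le> m" if "A \<in> R" "v \<in> cball 0 r" for A v
  proof -
    have "norm (h A (w A)) \<le> m" unfolding m_def using finR that by (intro Max_ge) auto
    thus ?thesis using w(2)[OF that] by linarith
  qed
  have SA0: "A0 \<in> SL2Z" using A0 RS by auto
  have max: "norm (h A0 v) \<le> norm (h A0 (w A0))" if v: "v \<in> ball 0 1" for v
  proof (cases "v = 0")
    case True
    thus ?thesis using w(2)[OF A0(1), of 0] r by simp
  next
    case False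
    define \<tau> where "\<tau> = 4 / (pi * \<i>) * Ln v"
    have q: "q8 \<tau> = v" using False by (simp add: \<tau>_def)
    hence "exp (- (pi / 4) * Im \<tau>) < 1" using v norm_q8[of \<tau>] by simp
    hence \<tau>: "Im \<tau> > 0" by (simp add: zero_less_mult_iff)
    obtain B where B: "B \<in> SL2Z" "Im (moebius B \<tau>) \<ge> 1 / 2" using exists_moebius_Im_ge_half[OF \<tau>] by blast
    note pos = SL2Z_moebius(1)[OF B(1) \<tau>]
    have "h A0 v = f (moebius A0 \<tau>)" using h(2)[OF SA0 \<tau>] q by simp
    also have "moebius A0 \<tau> = moebius (A0 ** SL2Z_inv B) (moebius B \<tau>)"
      using moebius_mult(1)[OF B(1) \<tau>, of "A0 ** SL2Z_inv B"] by (simp add: SL2Z_inv_mult B(1))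
    also obtain A1 where A1: "A1 \<in> R" "f (moebius (A0 ** SL2Z_inv B) (moebius B \<tau>)) = f (moebius A1 (moebius B \<tau>))"
      using rep[OF SL2Z_mult[OF SA0 SL2Z_inv_SL2Z[OF B(1)]]] pos by blast
    note A1(2)
    also have "f (moebius A1 (moebius B \<tau>)) = h A1 (q8 (moebius B \<tau>))"
      using h(2) pos A1 RS by blast
    also have "norm \<dots> \<le> m"
    proof (rule mle[OF A1(1)])
      have "exp (- (pi / 4) * Im (moebius B \<tau>)) \<le> r"
        unfolding r_def using B(2) by (simp add: field_simps)
      thus "q8 (moebius B \<tau>) \<in> cball 0 r" using norm_q8[of "moebius B \<tau>"] by simp
    qed
    finally show ?thesis using A0 by simp
  qed
  have "w A0 \<in> ball 0 1" using w(1)[OF A0(1)] r by auto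
  hence "h A0 constant_on ball 0 1"
    using max by (intro maximum_modulus_principle[OF h(1)[OF SA0], where U = "ball 0 1" and \<xi> = "w A0"]) auto
  then obtain c where c: "\<And>v. v \<in> ball 0 1 \<Longrightarrow> h A0 v = c" by (auto simp: constant_on_def)
  have "f \<tau> = c" if \<tau>: "Im \<tau> > 0" for \<tau>
  proof -
    define \<sigma> where "\<sigma> = moebius (SL2Z_inv A0) \<tau>"
    have \<sigma>: "Im \<sigma> > 0" unfolding \<sigma>_def by (rule SL2Z_moebius(1)[OF SL2Z_inv_SL2Z[OF SA0] \<tau>])
    have "moebius A0 \<sigma> = moebius (A0 ** SL2Z_inv A0) \<tau>"
      unfolding \<sigma>_def by (rule moebius_mult(1)[OF SL2Z_inv_SL2Z[OF SA0] \<tau>, symmetric])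
    also have "A0 ** SL2Z_inv A0 = mat 1"
      using SL2Z_inv_mult(4)[OF SA0, of "mat 1"] by simp
    also have "moebius (mat 1) \<tau> = \<tau>" by (simp add: moebius_def mat_def)
    finally have "f \<tau> = h A0 (q8 \<sigma>)" using h(2)[OF SA0 \<sigma>] by simp
    thus ?thesis using c[of "q8 \<sigma>"] \<sigma> norm_q8[of \<sigma>] by simp
  qed
  thus ?thesis by blast
qed

section \<open>Modular forms divided by powers of theta\<close>

text \<open>
  Boundedness and vanishing at the cusps depend only on the modulus of the slashed function, and
  in the modulus the Kronecker symbol and the branch of the root disappear. This makes it
  multiplicative in the matrix, which the slash operator itself is not.
\<close>
definition slash_abs :: "nat \<Rightarrow> (complex \<Rightarrow> complex) \<Rightarrow> int^2^2 \<Rightarrow> complex \<Rightarrow> real" where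
  "slash_abs k f A \<tau> = norm (f (moebius A \<tau>)) / sqrt (norm (den A \<tau>)) ^ k"

lemma SL2Z_coprime_row:
  assumes "A \<in> SL2Z" shows "coprime (A $ 2 $ 1) (A $ 2 $ 2)"
proof (rule coprimeI)
  fix c assume "c dvd A $ 2 $ 1" "c dvd A $ 2 $ 2"
  hence "c dvd A $ 1 $ 1 * A $ 2 $ 2 - A $ 1 $ 2 * A $ 2 $ 1" by (intro dvd_diff dvd_mult)
  thus "is_unit c" using assms by (simp add: SL2Z_iff)
qed

lemma SL2Z_coprime_col:
  assumes "A \<in> SL2Z" shows "coprime (A $ 1 $ 1) (A $ 2 $ 1)"
proof (rule coprimeI)
  fix c assume "c dvd A $ 1 $ 1" "c dvd A $ 2 $ 1"
  hence "c dvd A $ 1 $ 1 * A $ 2 $ 2 - A $ 1 $ 2 * A $ 2 $ 1" by (intro dvd_diff dvd_mult2 dvd_mult)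
  thus "is_unit c" using assms by (simp add: SL2Z_iff)
qed

lemma weight_factor_eq: "weight_factor k A \<tau> = weight_factor 1 A \<tau> ^ k"
  by (simp add: weight_factor_def power_mult_distrib)

lemma norm_weight_factor:
  assumes "A \<in> SL2Z"
  shows "norm (weight_factor k A \<tau>) = sqrt (norm (den A \<tau>)) ^ k"
proof -
  have "\<bar>kronecker (A $ 2 $ 1) (A $ 2 $ 2)\<bar> = 1"
    by (rule kronecker_abs[OF SL2Z_coprime_row[OF assms]])
  hence "norm (of_int (kronecker (A $ 2 $ 1) (A $ 2 $ 2)) :: complex) = 1"
    by (simp flip: of_int_abs)
  thus ?thesis by (simp add: weight_factor_def den_def norm_mult norm_power)
qed

lemma weight_factor_nonzero: "A \<in> SL2Z \<Longrightarrow> Im \<tau> > 0 \<Longrightarrow> weight_factor k A \<tau> \<noteq> 0"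
  using norm_weight_factor[of A k \<tau>] SL2Z_moebius(2)[of A \<tau>] by auto

lemma norm_slash: "A \<in> SL2Z \<Longrightarrow> norm (slash k f A \<tau>) = slash_abs k f A \<tau>"
  by (simp add: slash_def slash_abs_def norm_divide norm_weight_factor)

lemma Bfun_slash_iff:
  assumes "A \<in> SL2Z"
  shows "Bfun (slash k f A) at_i_infinity \<longleftrightarrow> (\<exists>B C. \<forall>\<tau>. Im \<tau> > B \<longrightarrow> slash_abs k f A \<tau> \<le> C)"
proof
  assume "Bfun (slash k f A) at_i_infinity"
  thus "\<exists>B C. \<forall>\<tau>. Im \<tau> > B \<longrightarrow> slash_abs k f A \<tau> \<le> C"
    unfolding Bfun_def eventually_at_i_infinity norm_slash[OF assms] by blast
next
  assume "\<exists>B C. \<forall>\<tau>. Im \<tau> > B \<longrightarrow> slash_abs k f A \<tau> \<le> C"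
  then obtain B C where "\<forall>\<tau>. Im \<tau> > B \<longrightarrow> slash_abs k f A \<tau> \<le> C" by blast
  thus "Bfun (slash k f A) at_i_infinity"
    unfolding Bfun_def eventually_at_i_infinity norm_slash[OF assms]
    by (intro exI[of _ "max C 1"] conjI exI[of _ B]) (auto simp: le_max_iff_disj)
qed

definition bounded_at_cusps :: "nat \<Rightarrow> (complex \<Rightarrow> complex) \<Rightarrow> bool" where
  "bounded_at_cusps k f \<longleftrightarrow> (\<forall>A\<in>SL2Z. \<exists>B C. \<forall>\<tau>. Im \<tau> > B \<longrightarrow> slash_abs k f A \<tau> \<le> C)"

text \<open>
  All requirements on a modular form except its transformation law.
\<close>
definition admissible :: "nat \<Rightarrow> (complex \<Rightarrow> complex) \<Rightarrow> bool" where
  "admissible k f \<longleftrightarrow> f holomorphic_on upper_half_plane \<and> (\<forall>\<tau>. \<not> Im \<tau> > 0 \<longrightarrow> f \<tau> = 0) \<and> bounded_at_cusps k f"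

lemma modular_forms_iff:
  "f \<in> modular_forms G k \<psi> \<longleftrightarrow> admissible k f \<and>
     (\<forall>A\<in>G. \<forall>\<tau>. Im \<tau> > 0 \<longrightarrow> slash k f A \<tau> = \<psi> A * f \<tau>)"
  by (auto simp: modular_forms_def admissible_def bounded_at_cusps_def Bfun_slash_iff upper_half_plane_def)

lemma slash_abs_add:
  "slash_abs k (f + g) A \<tau> \<le> slash_abs k f A \<tau> + slash_abs k g A \<tau>"
proof -
  have "norm (f (moebius A \<tau>) + g (moebius A \<tau>)) \<le> norm (f (moebius A \<tau>)) + norm (g (moebius A \<tau>))"
    by (rule norm_triangle_ineq)
  hence "norm (f (moebius A \<tau>) + g (moebius A \<tau>)) / sqrt (norm (den A \<tau>)) ^ k \<le>
      (norm (f (moebius A \<tau>)) + norm (g (moebius A \<tau>))) / sqrt (norm (den A \<tau>)) ^ k"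
    by (rule divide_right_mono) simp
  thus ?thesis by (simp add: slash_abs_def add_divide_distrib)
qed

lemma slash_abs_scale: "slash_abs k (fun_scale c f) A \<tau> = norm c * slash_abs k f A \<tau>"
  by (simp add: slash_abs_def fun_scale_def norm_mult)

lemma slash_abs_nonneg: "slash_abs k f A \<tau> \<ge> 0"
  by (simp add: slash_abs_def)

lemma admissible_0: "admissible k 0"
  by (auto simp: admissible_def bounded_at_cusps_def slash_abs_def zero_fun_def)

lemma admissible_add:
  assumes "admissible k f" "admissible k g"
  shows "admissible k (f + g)"
  unfolding admissible_def bounded_at_cusps_def
proof (intro conjI ballI)
  show "f + g holomorphic_on upper_half_plane"
    using assms by (auto simp: admissible_def plus_fun_def intro!: holomorphic_intros)
  fix A :: "int^2^2" assume A: "A \<in> SL2Z"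
  obtain B C where 1: "\<And>\<tau>. Im \<tau> > B \<Longrightarrow> slash_abs k f A \<tau> \<le> C"
    using assms(1) A unfolding admissible_def bounded_at_cusps_def by blast
  obtain B' C' where 2: "\<And>\<tau>. Im \<tau> > B' \<Longrightarrow> slash_abs k g A \<tau> \<le> C'"
    using assms(2) A unfolding admissible_def bounded_at_cusps_def by blast
  have "slash_abs k (f + g) A \<tau> \<le> C + C'" if "Im \<tau> > max B B'" for \<tau>
    using slash_abs_add[of k f g A \<tau>] 1[of \<tau>] 2[of \<tau>] that by auto
  thus "\<exists>B C. \<forall>\<tau>. Im \<tau> > B \<longrightarrow> slash_abs k (f + g) A \<tau> \<le> C" by blast
qed (use assms in \<open>auto simp: admissible_def\<close>)

lemma admissible_scale:
  assumes "admissible k f"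
  shows "admissible k (fun_scale c f)"
  unfolding admissible_def bounded_at_cusps_def
proof (intro conjI ballI)
  show "fun_scale c f holomorphic_on upper_half_plane"
    using assms by (auto simp: admissible_def fun_scale_def intro!: holomorphic_intros)
  fix A :: "int^2^2" assume A: "A \<in> SL2Z"
  obtain B C where 1: "\<And>\<tau>. Im \<tau> > B \<Longrightarrow> slash_abs k f A \<tau> \<le> C"
    using assms(1) A unfolding admissible_def bounded_at_cusps_def by blast
  have "slash_abs k (fun_scale c f) A \<tau> \<le> norm c * C" if "Im \<tau> > B" for \<tau>
    using 1[OF that] by (simp add: slash_abs_scale mult_left_mono)
  thus "\<exists>B C. \<forall>\<tau>. Im \<tau> > B \<longrightarrow> slash_abs k (fun_scale c f) A \<tau> \<le> C" by blast
qed (use assms in \<open>auto simp: admissible_def fun_scale_def\<close>)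

lemma slash_0: "slash k 0 A \<tau> = 0"
  by (simp add: slash_def)

lemma slash_add: "slash k (f + g) A \<tau> = slash k f A \<tau> + slash k g A \<tau>"
  by (simp add: slash_def add_divide_distrib)

lemma slash_scale: "slash k (fun_scale c f) A \<tau> = c * slash k f A \<tau>"
  by (simp add: slash_def fun_scale_def)

lemma fun_scale_apply: "fun_scale c f \<tau> = c * f \<tau>"
  by (simp add: fun_scale_def)

lemma subspace_modular_forms: "cfun.subspace (modular_forms G k \<psi>)"
  by (rule cfun.subspaceI)
     (auto simp: modular_forms_iff admissible_0 admissible_add admissible_scale slash_add slash_scale
        slash_0 fun_scale_apply distrib_left)

lemma subspace_cusp_forms: "cfun.subspace (cusp_forms G k \<psi>)"
proof -
  note sub = subspace_modular_forms[of G k \<psi>]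
  have 1: "(slash k (f + g) A \<longlongrightarrow> 0) at_i_infinity"
    if "(slash k f A \<longlongrightarrow> 0) at_i_infinity" "(slash k g A \<longlongrightarrow> 0) at_i_infinity" for f g A
  proof -
    have "slash k (f + g) A = (\<lambda>\<tau>. slash k f A \<tau> + slash k g A \<tau>)"
      by (rule ext) (rule slash_add)
    thus ?thesis using tendsto_add[OF that] by simp
  qed
  have 2: "(slash k (fun_scale c f) A \<longlongrightarrow> 0) at_i_infinity"
    if "(slash k f A \<longlongrightarrow> 0) at_i_infinity" for c f A
  proof -
    have "slash k (fun_scale c f) A = (\<lambda>\<tau>. c * slash k f A \<tau>)"
      by (simp add: slash_def fun_eq_iff fun_scale_def)
    thus ?thesis using tendsto_mult_left[OF that, of c] by simp
  qed
  have 3: "slash k 0 A = (\<lambda>_. 0)" for A by (simp add: slash_def fun_eq_iff)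
  show ?thesis
    unfolding cfun.subspace_def cusp_forms_def
    using cfun.subspace_0[OF sub] cfun.subspace_add[OF sub] cfun.subspace_scale[OF sub] 1 2 3 by auto
qed

definition Gamma4 :: "(int^2^2) set" where
  "Gamma4 = Gamma\<^sub>0 4 \<inter> Gamma\<^sup>0 4"

lemma Gamma4_iff: "A \<in> Gamma4 \<longleftrightarrow> A \<in> SL2Z \<and> 4 dvd A $ 2 $ 1 \<and> 4 dvd A $ 1 $ 2"
  by (auto simp: Gamma4_def Gamma_lower_def Gamma_upper_def)

lemma Gamma4_SL2Z: "A \<in> Gamma4 \<Longrightarrow> A \<in> SL2Z" by (simp add: Gamma4_iff)

lemma Gamma4_mult: "A \<in> Gamma4 \<Longrightarrow> B \<in> Gamma4 \<Longrightarrow> A ** B \<in> Gamma4"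
  by (simp add: Gamma4_iff SL2Z_mult mat2_mult_sel)

lemma Gamma4_sinv: "A \<in> Gamma4 \<Longrightarrow> SL2Z_inv A \<in> Gamma4"
  by (simp add: Gamma4_iff SL2Z_inv_SL2Z)

lemma Gamma4_odd:
  assumes "A \<in> Gamma4" shows "odd (A $ 1 $ 1)" "odd (A $ 2 $ 2)"
  using odd_diagonal[of "A $ 1 $ 1" "A $ 2 $ 2" "A $ 1 $ 2" "A $ 2 $ 1"] assms
  by (simp_all add: Gamma4_iff SL2Z_iff)

lemma theta_mult_nonzero: "odd d \<Longrightarrow> theta_mult d \<noteq> 0"
  by (simp add: theta_mult_eq)

lemma theta_moebius:
  assumes "A \<in> Gamma4" "Im \<tau> > 0"
  shows "theta (moebius A \<tau>) = theta_mult (A $ 2 $ 2) * weight_factor 1 A \<tau> * theta \<tau>"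
  using theta_transformation[of "A $ 1 $ 1" "A $ 2 $ 2" "A $ 1 $ 2" "A $ 2 $ 1" \<tau>] assms
  by (simp add: Gamma4_iff SL2Z_iff moebius_def theta_factor_def weight_factor_def)

lemma norm_theta_moebius:
  assumes "A \<in> Gamma4" "Im \<tau> > 0"
  shows "norm (theta (moebius A \<tau>)) = sqrt (norm (den A \<tau>)) * norm (theta \<tau>)"
proof -
  have "norm (theta_mult (A $ 2 $ 2)) = 1" using theta_mult_eq[OF Gamma4_odd(2)[OF assms(1)]] by simp
  thus ?thesis
    using theta_moebius[OF assms] norm_weight_factor[OF Gamma4_SL2Z[OF assms(1)], of 1 \<tau>] by (simp add: norm_mult)
qed

text \<open>
  Division by the power of theta trades the half-integral weight for weight 0.
\<close>
definition normalized :: "nat \<Rightarrow> (complex \<Rightarrow> complex) \<Rightarrow> complex \<Rightarrow> complex" where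
  "normalized k f \<tau> = f \<tau> / theta \<tau> ^ k"

lemma slash_eq_iff_normalized:
  assumes "A \<in> Gamma4" "Im \<tau> > 0"
  shows "slash k f A \<tau> = theta_mult (A $ 2 $ 2) ^ k * \<psi> * f \<tau> \<longleftrightarrow>
         normalized k f (moebius A \<tau>) = \<psi> * normalized k f \<tau>"
proof -
  define m w where "m = theta_mult (A $ 2 $ 2)" and "w = weight_factor 1 A \<tau>"
  have nz: "m \<noteq> 0" "w \<noteq> 0" "theta \<tau> \<noteq> 0"
    using theta_mult_nonzero[OF Gamma4_odd(2)[OF assms(1)]] theta_nonzero[OF assms(2)]
      weight_factor_nonzero[OF Gamma4_SL2Z[OF assms(1)] assms(2)] by (simp_all add: m_def w_def)
  have th: "theta (moebius A \<tau>) = m * w * theta \<tau>" using theta_moebius[OF assms] by (simp add: m_def w_def)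
  have "slash k f A \<tau> = m ^ k * \<psi> * f \<tau> \<longleftrightarrow> f (moebius A \<tau>) = m ^ k * \<psi> * f \<tau> * w ^ k"
    unfolding slash_def weight_factor_eq[of k] w_def[symmetric] using nz by (simp add: divide_eq_eq)
  also have "\<dots> \<longleftrightarrow> normalized k f (moebius A \<tau>) = \<psi> * normalized k f \<tau>"
    using nz by (simp add: normalized_def th power_mult_distrib field_simps)
  finally show ?thesis by (simp add: m_def)
qed

text \<open>
  The signs by which the eta quotients, divided by theta, are multiplied.
\<close>
fun eta_char :: "eta_kind \<Rightarrow> int^2^2 \<Rightarrow> int" where
  "eta_char Natural A = sgn8 (A $ 2 $ 2)"
| "eta_char Flat A = sgn8 (A $ 2 $ 2 - A $ 2 $ 1)"
| "eta_char Sharp A = sgn8 (A $ 1 $ 1 + A $ 1 $ 2)"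

lemma eta_fn_moebius:
  assumes "A \<in> Gamma4" "Im \<tau> > 0"
  shows "eta_fn x (moebius A \<tau>) = of_int (eta_char x A) * (theta (moebius A \<tau>) / theta \<tau>) * eta_fn x \<tau>"
proof -
  have det: "A $ 1 $ 1 * A $ 2 $ 2 - A $ 1 $ 2 * A $ 2 $ 1 = 1" "4 dvd A $ 1 $ 2" "4 dvd A $ 2 $ 1"
    using assms by (simp_all add: Gamma4_iff SL2Z_iff)
  have "theta (moebius A \<tau>) / theta \<tau> = theta_factor (A $ 2 $ 1) (A $ 2 $ 2) \<tau>"
    using theta_transformation[OF det(1,3) assms(2)] theta_nonzero[OF assms(2)] by (simp add: moebius_def)
  thus ?thesis
    using natural_transformation[OF det assms(2)] flat_transformation[OF det assms(2)]
      sharp_transformation[OF det assms(2)] by (cases x) (simp_all add: moebius_def)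
qed

lemma eta_char_square: "A \<in> Gamma4 \<Longrightarrow> eta_char x A * eta_char x A = 1"
proof -
  assume A: "A \<in> Gamma4"
  have "even (A $ 2 $ 1)" "even (A $ 1 $ 2)"
    using A by (auto simp: Gamma4_iff)
  thus ?thesis using Gamma4_odd[OF A] by (cases x) (simp_all add: sgn8_odd_sq)
qed

lemma eta_char_cases:
  assumes "A \<in> Gamma4" shows "eta_char x A = 1 \<or> eta_char x A = -1"
  using eta_char_square[OF assms, of x] by (simp add: zmult_eq_1_iff)

text \<open>
  This is inherited from the composition of the transformations of a nonvanishing function.
\<close>
lemma eta_char_mult:
  assumes "A \<in> Gamma4" "B \<in> Gamma4"
  shows "eta_char x (A ** B) = eta_char x A * eta_char x B"
proof -
  define \<sigma> where "\<sigma> = moebius B \<i>"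
  have i: "Im \<i> > 0" by simp
  have \<sigma>: "Im \<sigma> > 0" unfolding \<sigma>_def by (rule SL2Z_moebius(1)[OF Gamma4_SL2Z[OF assms(2)] i])
  have AB: "moebius (A ** B) \<i> = moebius A \<sigma>" "Im (moebius A \<sigma>) > 0"
    unfolding \<sigma>_def by (rule moebius_mult(1)[OF Gamma4_SL2Z[OF assms(2)] i])
      (rule SL2Z_moebius(1)[OF Gamma4_SL2Z[OF assms(1)] \<sigma>[unfolded \<sigma>_def]])
  define u where "u = theta (moebius A \<sigma>) / theta \<i> * eta_fn x \<i>"
  have u: "u \<noteq> 0" using theta_nonzero[OF AB(2)] theta_nonzero[OF i] eta_fn_nonzero[OF i] by (simp add: u_def)
  have "eta_fn x (moebius A \<sigma>) = of_int (eta_char x (A ** B)) * u"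
    using eta_fn_moebius[OF Gamma4_mult[OF assms] i, of x] by (simp add: AB u_def)
  moreover have "eta_fn x (moebius A \<sigma>) = of_int (eta_char x A * eta_char x B) * u"
    using eta_fn_moebius[OF assms(1) \<sigma>, of x] eta_fn_moebius[OF assms(2) i, of x] theta_nonzero[OF \<sigma>]
    by (simp add: \<sigma>_def[symmetric] u_def)
  ultimately have "(of_int (eta_char x (A ** B)) :: complex) = of_int (eta_char x A * eta_char x B)"
    using u by simp
  thus ?thesis by (simp only: of_int_eq_iff)
qed

lemma eta_char_sinv:
  assumes "A \<in> Gamma4"
  shows "eta_char x (SL2Z_inv A) = eta_char x A"
proof -
  have "eta_char x A = eta_char x (A ** SL2Z_inv A ** A)"
    using SL2Z_inv_mult(3)[OF Gamma4_SL2Z[OF assms], of A] SL2Z_inv_mult(1)[OF Gamma4_SL2Z[OF assms], of A]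
    by (simp add: matrix_mul_assoc)
  also have "\<dots> = eta_char x (SL2Z_inv A)"
    using eta_char_square[OF assms, of x] eta_char_mult[OF Gamma4_mult[OF assms Gamma4_sinv[OF assms]] assms, of x]
      eta_char_mult[OF assms Gamma4_sinv[OF assms], of x] by (simp add: mult_ac)
  finally show ?thesis ..
qed

text \<open>
  Conjugates of T^4 and of its inverse that fix the cusps 1, 0 and \<infinity>, where the
  respective eta quotients vanish. They represent the basis dual to the three sign characters.
\<close>
fun eta_gen :: "eta_kind \<Rightarrow> int^2^2" where
  "eta_gen Natural = mat2 5 (-4) 4 (-3)"
| "eta_gen Flat = mat2 1 0 4 1"
| "eta_gen Sharp = mat2 1 4 0 1"

lemma eta_gen_Gamma4: "eta_gen x \<in> Gamma4"
  by (cases x) (simp_all add: Gamma4_iff SL2Z_iff)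

lemma eta_char_gen: "eta_char y (eta_gen x) = (if y = x then -1 else 1)"
  by (cases x; cases y) (simp_all add: sgn8_def)

lemma T_conj_4_Gamma4: "T_conj 4 A \<in> Gamma4"
  unfolding Gamma4_iff T_conj_sel by (simp add: T_conj_SL2Z)

lemma sgn8_1_plus_4: "sgn8 (1 + 4 * m) = (if even m then 1 else -1)"
proof -
  have "even m \<Longrightarrow> (1 + 4 * m) mod 8 = 1" "odd m \<Longrightarrow> (1 + 4 * m) mod 8 = 5" by presburger+
  thus ?thesis by (auto simp: sgn8_def)
qed

text \<open>
  The stabiliser of a cusp is detected by exactly one of the three characters, that of the eta
  quotient vanishing at this cusp.
\<close>
lemma eta_char_T_conj:
  assumes "A \<in> SL2Z"
  shows "eta_char x (T_conj 4 A) = (if x = kind_of (A $ 1 $ 1) (A $ 2 $ 1) then -1 else 1)"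
proof -
  define a c where "a = A $ 1 $ 1" and "c = A $ 2 $ 1"
  have ac: "odd a \<or> odd c"
    using SL2Z_coprime_col[OF assms] by (auto simp: a_def c_def)
  have eqs: "1 + 4 * a * c = 1 + 4 * (a * c)" "1 + 4 * a * c - - (4 * c * c) = 1 + 4 * (a * c + c * c)"
    "1 - 4 * a * c + 4 * a * a = 1 + 4 * (a * a - a * c)" by (simp_all add: algebra_simps)
  have "eta_char Natural (T_conj 4 A) = sgn8 (1 + 4 * (a * c))"
    "eta_char Flat (T_conj 4 A) = sgn8 (1 + 4 * (a * c + c * c))"
    "eta_char Sharp (T_conj 4 A) = sgn8 (1 + 4 * (a * a - a * c))"
    by (simp_all only: eta_char.simps T_conj_sel a_def[symmetric] c_def[symmetric] eqs(2,3))
       (simp add: mult.assoc)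
  thus ?thesis using ac unfolding sgn8_1_plus_4
    by (cases x) (auto simp: kind_of_def a_def c_def)
qed

text \<open>
  These groups interpolate between \<plusminus>Gamma(4), for the empty set, and
  \<plusminus>Gamma(8), for the full set.
\<close>
definition char_group :: "eta_kind set \<Rightarrow> (int^2^2) set" where
  "char_group S = {A \<in> Gamma4. \<forall>x\<in>S. eta_char x A = 1}"

text \<open>
  These spaces interpolate between the forms of weight multiple of w_2, for the empty set, and
  the forms on Gamma(8), for the full set. Enlarging the set by x amounts to admitting multiples
  of the eta quotient x.
\<close>
definition theta_forms :: "eta_kind set \<Rightarrow> nat \<Rightarrow> (complex \<Rightarrow> complex) set" where
  "theta_forms S k = {f. admissible k f \<and>
     (\<forall>A\<in>char_group S. \<forall>\<tau>. Im \<tau> > 0 \<longrightarrow> normalized k f (moebius A \<tau>) = normalized k f \<tau>)}"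

lemma theta_forms_eq: "theta_forms S k = modular_forms (char_group S) k (\<lambda>A. theta_mult (A $ 2 $ 2) ^ k)"
proof -
  have "(slash k f A \<tau> = theta_mult (A $ 2 $ 2) ^ k * f \<tau>) \<longleftrightarrow> (normalized k f (moebius A \<tau>) = normalized k f \<tau>)"
    if "A \<in> char_group S" "Im \<tau> > 0" for f A \<tau>
    using slash_eq_iff_normalized[of A \<tau> k f 1] that by (simp add: char_group_def)
  thus ?thesis by (auto simp: theta_forms_def modular_forms_iff)
qed

lemma subspace_theta_forms: "cfun.subspace (theta_forms S k)"
  unfolding theta_forms_eq by (rule subspace_modular_forms)

lemma forms4_w2_eq: "forms4_w2 k = theta_forms {} k"
proof -
  have "char_group {} = Gamma\<^sub>0 4 \<inter> Gamma\<^sup>0 4" by (auto simp: char_group_def Gamma4_def)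
  thus ?thesis by (simp only: forms4_w2_def theta_forms_eq theta_mult_def)
qed

lemma theta_forms_antimono: "S \<subseteq> S' \<Longrightarrow> theta_forms S k \<subseteq> theta_forms S' k"
  by (auto simp: theta_forms_def char_group_def)

lemma Gamma8_subset:
  assumes "A \<in> Gamma_principal 8" shows "A \<in> char_group S" "theta_mult (A $ 2 $ 2) = 1"
proof -
  have m: "A $ 1 $ 1 mod 8 = 1" "A $ 1 $ 2 mod 8 = 0" "A $ 2 $ 1 mod 8 = 0" "A $ 2 $ 2 mod 8 = 1"
    using assms by (auto simp: Gamma_principal_def cong_def)
  have "sgn8 (A $ 2 $ 2) = 1" "sgn8 (A $ 2 $ 2 - A $ 2 $ 1) = 1" "sgn8 (A $ 1 $ 1 + A $ 1 $ 2) = 1"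
    using m mod_diff_eq[of "A $ 2 $ 2" 8 "A $ 2 $ 1", symmetric] mod_add_eq[of "A $ 1 $ 1" 8 "A $ 1 $ 2", symmetric]
    by (simp_all only: sgn8_def) simp_all
  hence "eta_char x A = 1" for x by (cases x) simp_all
  moreover have "4 dvd A $ 2 $ 1" "4 dvd A $ 1 $ 2" using m by presburger+
  ultimately show "A \<in> char_group S"
    using assms by (simp add: char_group_def Gamma4_iff Gamma_principal_def)
  have "odd (A $ 2 $ 2)" "A $ 2 $ 2 mod 4 = 1" using m by presburger+
  thus "theta_mult (A $ 2 $ 2) = 1" by (simp add: theta_mult_eq)
qed

lemma sgn8_eq_1: "sgn8 d = 1 \<Longrightarrow> d mod 8 = 1 \<or> d mod 8 = 7"
  by (auto simp: sgn8_def split: if_splits)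

text \<open>
  The three characters determine d up to sign, and then c and b, modulo 8; the determinant gives
  a modulo 8.
\<close>
lemma char_group_UNIV_cases:
  assumes "A \<in> char_group UNIV"
  shows "A \<in> Gamma_principal 8 \<or> - A \<in> Gamma_principal 8"
proof -
  have G: "A \<in> SL2Z" "4 dvd A $ 2 $ 1" "4 dvd A $ 1 $ 2" using assms by (auto simp: char_group_def Gamma4_iff)
  have ch: "eta_char x A = 1" for x using assms by (auto simp: char_group_def)
  define a b c d where "a = A $ 1 $ 1" and "b = A $ 1 $ 2" and "c = A $ 2 $ 1" and "d = A $ 2 $ 2"
  have d: "d mod 8 = 1 \<or> d mod 8 = 7" using sgn8_eq_1[of d] ch[of Natural] by (simp add: d_def)
  have dc: "(d - c) mod 8 = 1 \<or> (d - c) mod 8 = 7" using sgn8_eq_1[of "d - c"] ch[of Flat] by (simp add: d_def c_def)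
  have ab: "(a + b) mod 8 = 1 \<or> (a + b) mod 8 = 7" using sgn8_eq_1[of "a + b"] ch[of Sharp] by (simp add: a_def b_def)
  have c4: "4 dvd c" "4 dvd b" using G by (simp_all add: b_def c_def)
  have c8: "c mod 8 = 0" using d dc c4 by presburger
  obtain b' c' where bc: "b = 4 * b'" "c = 8 * c'" using c4 c8 by (auto elim!: dvdE simp: mod_0_imp_dvd)
  have "a * d - b * c = 1" using G by (simp add: SL2Z_iff a_def b_def c_def d_def)
  hence "a * d = 1 + 8 * (4 * b' * c')" by (simp add: bc algebra_simps)
  hence "(a * d) mod 8 = 1" by (simp only: mod_mult_self2) simp
  hence prod: "((a mod 8) * (d mod 8)) mod 8 = 1" by (simp add: mod_mult_eq)
  have a: "a mod 8 = d mod 8"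
  proof -
    have "a mod 8 \<in> {0,1,2,3,4,5,6,7}" by auto
    thus ?thesis using prod d by auto
  qed
  have b8: "b mod 8 = 0" using a ab d c4 by presburger
  show ?thesis
  proof (cases "d mod 8 = 1")
    case True
    hence "A \<in> Gamma_principal 8" using a b8 c8 G
      by (simp add: Gamma_principal_def cong_def a_def b_def c_def d_def)
    thus ?thesis ..
  next
    case False
    hence "d mod 8 = 7" using d by simp
    hence "(- d) mod 8 = 1" "(- a) mod 8 = 1" "(- b) mod 8 = 0" "(- c) mod 8 = 0"
      using a b8 c8 by presburger+
    hence "- A \<in> Gamma_principal 8" using G
      by (simp add: Gamma_principal_def cong_def a_def b_def c_def d_def SL2Z_iff)
    thus ?thesis ..
  qed
qed

lemma moebius_uminus: "moebius (- A) \<tau> = moebius A \<tau>"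
proof -
  have "(- x) / (- y) = x / y" for x y :: complex by simp
  from this[of "of_int (A $ 1 $ 1) * \<tau> + of_int (A $ 1 $ 2)" "of_int (A $ 2 $ 1) * \<tau> + of_int (A $ 2 $ 2)"]
  show ?thesis by (simp add: moebius_def)
qed

text \<open>
  On Gamma(8) the theta multiplier is 1, and -A acts on functions of weight 0 like A.
\<close>
lemma forms_Gamma8_eq: "forms_Gamma8 k = theta_forms UNIV k"
proof -
  have *: "(slash k f A \<tau> = f \<tau>) \<longleftrightarrow> (normalized k f (moebius A \<tau>) = normalized k f \<tau>)"
    if "A \<in> Gamma_principal 8" "Im \<tau> > 0" for f A \<tau>
    using slash_eq_iff_normalized[of A \<tau> k f 1] Gamma8_subset[OF that(1)] that by (simp add: char_group_def)
  have "(\<forall>A\<in>Gamma_principal 8. \<forall>\<tau>. Im \<tau> > 0 \<longrightarrow> normalized k f (moebius A \<tau>) = normalized k f \<tau>) \<longleftrightarrow>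
        (\<forall>A\<in>char_group UNIV. \<forall>\<tau>. Im \<tau> > 0 \<longrightarrow> normalized k f (moebius A \<tau>) = normalized k f \<tau>)" for f
    using Gamma8_subset(1) char_group_UNIV_cases moebius_uminus by metis
  thus ?thesis using * by (auto simp: forms_Gamma8_def theta_forms_def modular_forms_iff)
qed

lemma char_group_SL2Z: "A \<in> char_group S \<Longrightarrow> A \<in> SL2Z"
  by (simp add: char_group_def Gamma4_iff)

section \<open>Splitting off an eta quotient\<close>

text \<open>
  For arguments on the same side of the real axis the two roots lie in a common quadrant, so
  their quotient has positive real part.
\<close>
lemma csqrt_divide_same_side:
  assumes "Im z * Im w > 0 \<or> z = w \<and> w \<noteq> 0"
  shows "csqrt (z / w) = csqrt z / csqrt w"
  using assms
proof
  assume "z = w \<and> w \<noteq> 0"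
  thus ?thesis by simp
next
  assume s: "Im z * Im w > 0"
  hence w: "w \<noteq> 0" by auto
  define u v where "u = csqrt z" and "v = csqrt w"
  have v: "v \<noteq> 0" using w by (simp add: v_def)
  have "Re u * Re v > 0 \<and> Im u * Im v > 0"
  proof (cases "Im z > 0")
    case True
    hence "Im w > 0" using s by (simp add: zero_less_mult_iff)
    thus ?thesis using csqrt_upper[OF True] csqrt_upper[of w] unfolding u_def v_def by (simp add: mult_pos_pos del: csqrt.simps)
  next
    case False
    hence "Im z < 0" "Im w < 0" using s by (auto simp: zero_less_mult_iff)
    thus ?thesis using csqrt_lower[of z] csqrt_lower[of w] unfolding u_def v_def by (simp add: mult_pos_pos mult_neg_neg del: csqrt.simps)
  qed
  hence "Re u * Re v + Im u * Im v > 0" by simp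
  moreover have "Re (u / v) = (Re u * Re v + Im u * Im v) / ((Re v)\<^sup>2 + (Im v)\<^sup>2)"
    by (rule Re_divide)
  moreover have "(Re v)\<^sup>2 + (Im v)\<^sup>2 > 0" using v by (simp add: sum_power2_gt_zero_iff complex_eq_iff)
  ultimately have "Re (u / v) > 0" by simp
  moreover have "(u / v)\<^sup>2 = z / w" unfolding power_divide u_def v_def power2_csqrt ..
  ultimately show ?thesis using csqrt_unique[of "u / v" "z / w"] by (simp only: u_def v_def simp_thms)
qed

lemma csqrt_den_holomorphic:
  assumes "A \<in> SL2Z"
  shows "(\<lambda>\<tau>. csqrt (den A \<tau>)) holomorphic_on upper_half_plane"
proof (cases "A $ 2 $ 1 = 0")
  case True
  thus ?thesis by (simp add: den_def)
next
  case False
  have "den A \<tau> \<notin> \<real>\<^sub>\<le>\<^sub>0" if "\<tau> \<in> upper_half_plane" for \<tau>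
    using that False by (auto simp: complex_nonpos_Reals_iff den_def upper_half_plane_def)
  thus ?thesis unfolding den_def[abs_def]
    by (intro holomorphic_on_csqrt' holomorphic_intros) (auto simp: den_def)
qed

text \<open>
  The conjugate of T^4 has multiplier 1 and Kronecker symbol 1, so its automorphy factor is the
  root of the quotient of the two denominators.
\<close>
lemma theta_periodic_at_cusp:
  assumes "A \<in> SL2Z" "Im \<tau> > 0"
  shows "theta (moebius A (\<tau> + 4)) / csqrt (den A (\<tau> + 4)) = theta (moebius A \<tau>) / csqrt (den A \<tau>)"
proof -
  define a c where "a = A $ 1 $ 1" and "c = A $ 2 $ 1"
  define \<sigma> where "\<sigma> = moebius A \<tau>"
  have \<tau>4: "Im (\<tau> + 4) > 0" using assms by simp
  have d: "den A (\<tau> + 4) \<noteq> 0" "den A \<tau> \<noteq> 0"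
    using SL2Z_moebius(2)[OF assms(1) \<tau>4] SL2Z_moebius(2)[OF assms] .
  have \<sigma>: "Im \<sigma> > 0" unfolding \<sigma>_def by (rule SL2Z_moebius(1)[OF assms])
  have m: "moebius A (\<tau> + 4) = moebius (T_conj 4 A) \<sigma>" and dd: "den (T_conj 4 A) \<sigma> = den A (\<tau> + 4) / den A \<tau>"
    using moebius_T_conj[OF assms, of 4] by (simp_all add: \<sigma>_def)
  have "coprime a c" using SL2Z_coprime_col[OF assms(1)] by (simp add: a_def c_def)
  have m4: "(1 + 4 * a * c) mod 4 = 1"
    using mod_mult_self2[of 1 4 "a * c"] by (simp add: mult.assoc)
  have "coprime c (1 + 4 * a * c)"
  proof (rule coprimeI)
    fix k assume k: "k dvd c" "k dvd 1 + 4 * a * c"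
    hence "k dvd (1 + 4 * a * c) - 4 * a * c" by (intro dvd_diff dvd_mult)
    thus "is_unit k" by simp
  qed
  from kronecker_neg_square[OF m4 this] have kr: "kronecker (- (4 * c * c)) (1 + 4 * a * c) = 1"
    by (simp add: power2_eq_square mult.assoc)
  have tm: "theta_mult (1 + 4 * a * c) = 1"
    using m4 by (subst theta_mult_eq) auto
  have "theta (moebius (T_conj 4 A) \<sigma>) = csqrt (den (T_conj 4 A) \<sigma>) * theta \<sigma>"
    using theta_moebius[OF T_conj_4_Gamma4 \<sigma>, of A] kr tm
    by (simp add: weight_factor_def den_def T_conj_sel a_def c_def)
  also have "csqrt (den (T_conj 4 A) \<sigma>) = csqrt (den A (\<tau> + 4)) / csqrt (den A \<tau>)"
    unfolding dd
  proof (rule csqrt_divide_same_side)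
    show "Im (den A (\<tau> + 4)) * Im (den A \<tau>) > 0 \<or> den A (\<tau> + 4) = den A \<tau> \<and> den A \<tau> \<noteq> 0"
    proof (cases "c = 0")
      case True
      thus ?thesis using d by (simp add: den_def c_def)
    next
      case False
      have "Im (den A (\<tau> + 4)) = Im (den A \<tau>)" by (simp add: den_def)
      moreover have "Im (den A \<tau>) \<noteq> 0" using False assms by (simp add: den_def c_def)
      ultimately show ?thesis by (auto simp: zero_less_mult_iff)
    qed
  qed
  finally show ?thesis using d unfolding m by (simp add: \<sigma>_def[symmetric])
qed

text \<open>
  After division by the k-th power of the root of the denominator, f at the cusp is the product
  of the normalized function, which has period 8 or antiperiod 4, and of a power of a function
  with period 4. Hence it has an expansion in exp(\<pi>i\<tau>/4) without constant term.
\<close>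
lemma cusp_decay:
  assumes adm: "admissible k f" and A: "A \<in> SL2Z"
    and inv: "\<And>B \<tau>. B \<in> Gamma_principal 8 \<Longrightarrow> Im \<tau> > 0 \<Longrightarrow> normalized k f (moebius B \<tau>) = normalized k f \<tau>"
    and van: "(slash_abs k f A \<longlongrightarrow> 0) at_i_infinity \<or>
       (\<forall>\<tau>. Im \<tau> > 0 \<longrightarrow> normalized k f (moebius (T_conj 4 A) \<tau>) = - normalized k f \<tau>)"
  shows "\<exists>B C. \<forall>\<tau>. Im \<tau> > B \<longrightarrow> slash_abs k f A \<tau> \<le> C * exp (- (pi / 4) * Im \<tau>)"
proof -
  define g where "g = (\<lambda>\<tau>. f (moebius A \<tau>) / csqrt (den A \<tau>) ^ k)"
  define th where "th = (\<lambda>\<tau>. theta (moebius A \<tau>) / csqrt (den A \<tau>))"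
  have norm_g: "norm (g \<tau>) = slash_abs k f A \<tau>" for \<tau>
    by (simp add: g_def slash_abs_def norm_divide norm_power)
  have g_eq: "g \<tau> = normalized k f (moebius A \<tau>) * th \<tau> ^ k" if "Im \<tau> > 0" for \<tau>
    using theta_nonzero[OF SL2Z_moebius(1)[OF A that]] by (simp add: g_def normalized_def th_def power_divide)
  have th4: "th (\<tau> + 4) = th \<tau>" if "Im \<tau> > 0" for \<tau>
    unfolding th_def by (rule theta_periodic_at_cusp[OF A that])
  have th8: "th (\<tau> + 8) = th \<tau>" if "Im \<tau> > 0" for \<tau>
    using th4[OF that] th4[of "\<tau> + 4"] that by (simp add: add.assoc)
  have hol: "g holomorphic_on upper_half_plane"
  proof -
    have "csqrt (den A \<tau>) ^ k \<noteq> 0" if "\<tau> \<in> upper_half_plane" for \<tau>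
      using SL2Z_moebius(2)[OF A] that by (simp add: upper_half_plane_def)
    moreover have "f holomorphic_on upper_half_plane" using adm by (simp add: admissible_def)
    ultimately show ?thesis unfolding g_def
      by (intro holomorphic_on_divide holomorphic_on_power compose_moebius_holomorphic csqrt_den_holomorphic A) auto
  qed
  have per: "g (\<tau> + 8) = g \<tau>" if \<tau>: "Im \<tau> > 0" for \<tau>
  proof -
    have "normalized k f (moebius A (\<tau> + 8)) = normalized k f (moebius A \<tau>)"
      using moebius_T_conj(1)[OF A \<tau>, of 8] inv[OF Gamma_principal_T_conj SL2Z_moebius(1)[OF A \<tau>]] by simp
    thus ?thesis using g_eq[OF \<tau>] g_eq[of "\<tau> + 8"] th8[OF \<tau>] \<tau> by simp
  qed
  obtain B C where bound: "\<And>\<tau>. Im \<tau> > B \<Longrightarrow> slash_abs k f A \<tau> \<le> C"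
    using adm A unfolding admissible_def bounded_at_cusps_def by blast
  have "(g \<longlongrightarrow> 0) at_i_infinity \<or> (\<forall>\<tau>. Im \<tau> > 0 \<longrightarrow> g (\<tau> + 4) = - g \<tau>)"
    using van
  proof
    assume "(slash_abs k f A \<longlongrightarrow> 0) at_i_infinity"
    hence "((\<lambda>\<tau>. norm (g \<tau>)) \<longlongrightarrow> 0) at_i_infinity" by (simp only: norm_g)
    thus ?thesis using tendsto_norm_zero_cancel by blast
  next
    assume *: "\<forall>\<tau>. Im \<tau> > 0 \<longrightarrow> normalized k f (moebius (T_conj 4 A) \<tau>) = - normalized k f \<tau>"
    have "g (\<tau> + 4) = - g \<tau>" if \<tau>: "Im \<tau> > 0" for \<tau>
    proof -
      have "normalized k f (moebius A (\<tau> + 4)) = - normalized k f (moebius A \<tau>)"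
        using moebius_T_conj(1)[OF A \<tau>, of 4] *[rule_format, OF SL2Z_moebius(1)[OF A \<tau>]] by simp
      thus ?thesis using g_eq[OF \<tau>] g_eq[of "\<tau> + 4"] th4[OF \<tau>] \<tau> by simp
    qed
    thus ?thesis by blast
  qed
  from q_expansion_decay[OF hol per bound[folded norm_g] this] show ?thesis
    unfolding norm_g by blast
qed

text \<open>
  The action of an element of Gamma_0(4) \<inter> Gamma^0(4), corrected by its theta multiplier,
  only permutes the cusps at which boundedness is tested.
\<close>
lemma admissible_twist:
  assumes adm: "admissible k f" and G: "G \<in> Gamma4"
  shows "admissible k (\<lambda>\<tau>. if Im \<tau> > 0 then theta \<tau> ^ k * normalized k f (moebius G \<tau>) else 0)" (is "admissible k ?g")
proof -
  note GS = Gamma4_SL2Z[OF G]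
  have f: "f holomorphic_on upper_half_plane" using adm by (simp add: admissible_def)
  have "(\<lambda>\<tau>. theta \<tau> ^ k * (f (moebius G \<tau>) / theta (moebius G \<tau>) ^ k)) holomorphic_on upper_half_plane"
    using theta_nonzero SL2Z_moebius(1)[OF GS]
    by (intro holomorphic_intros theta_holomorphic compose_moebius_holomorphic GS f)
       (auto simp: upper_half_plane_def)
  hence hol: "?g holomorphic_on upper_half_plane"
    by (rule holomorphic_transform) (simp add: upper_half_plane_def normalized_def)
  have ns: "slash_abs k ?g A \<tau> = slash_abs k f (G ** A) \<tau>" if A: "A \<in> SL2Z" and \<tau>: "Im \<tau> > 0" for A \<tau>
  proof -
    define \<sigma> where "\<sigma> = moebius A \<tau>"
    have \<sigma>: "Im \<sigma> > 0" unfolding \<sigma>_def by (rule SL2Z_moebius(1)[OF A \<tau>])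
    have "norm (theta \<sigma>) \<noteq> 0" using theta_nonzero[OF \<sigma>] by simp
    moreover have "slash_abs k ?g A \<tau> = norm (theta \<sigma>) ^ k * (norm (f (moebius G \<sigma>)) / (sqrt (norm (den G \<sigma>)) * norm (theta \<sigma>)) ^ k) / sqrt (norm (den A \<tau>)) ^ k"
      using \<sigma> by (simp add: slash_abs_def \<sigma>_def[symmetric] normalized_def norm_mult norm_divide norm_power norm_theta_moebius[OF G \<sigma>])
    ultimately show ?thesis
      by (simp add: slash_abs_def moebius_mult[OF A \<tau>] \<sigma>_def[symmetric] norm_mult real_sqrt_mult power_mult_distrib)
  qed
  have "bounded_at_cusps k ?g"
    unfolding bounded_at_cusps_def
  proof
    fix A :: "int^2^2" assume A: "A \<in> SL2Z"
    obtain B C where 1: "\<And>\<tau>. Im \<tau> > B \<Longrightarrow> slash_abs k f (G ** A) \<tau> \<le> C"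
      using adm SL2Z_mult[OF GS A] unfolding admissible_def bounded_at_cusps_def by blast
    have "slash_abs k ?g A \<tau> \<le> C" if "Im \<tau> > max B 0" for \<tau>
      using 1[of \<tau>] ns[OF A, of \<tau>] that by simp
    thus "\<exists>B C. \<forall>\<tau>. Im \<tau> > B \<longrightarrow> slash_abs k ?g A \<tau> \<le> C" by blast
  qed
  thus ?thesis using hol by (simp add: admissible_def)
qed

text \<open>
  The even and the odd part of f under the corrected action of G. The hypotheses say that modulo
  the invariance group of f each element of L acts like 1 or like G, and that G acts as an
  involution.
\<close>
lemma eigen_split:
  fixes ch :: "int^2^2 \<Rightarrow> int"
  assumes adm: "admissible k f" and G: "G \<in> Gamma4"
    and ch: "\<And>D. D \<in> L \<Longrightarrow> ch D = 1 \<or> ch D = -1" and L: "L \<subseteq> SL2Z"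
    and 1: "\<And>D \<tau>. D \<in> L \<Longrightarrow> Im \<tau> > 0 \<Longrightarrow> normalized k f (moebius D \<tau>) =
              (if ch D = 1 then normalized k f \<tau> else normalized k f (moebius G \<tau>))"
    and 2: "\<And>D \<tau>. D \<in> L \<Longrightarrow> Im \<tau> > 0 \<Longrightarrow> normalized k f (moebius G (moebius D \<tau>)) =
              (if ch D = 1 then normalized k f (moebius G \<tau>) else normalized k f \<tau>)"
  obtains g m where "f = g + m" "admissible k g" "admissible k m"
    "\<And>D \<tau>. D \<in> L \<Longrightarrow> Im \<tau> > 0 \<Longrightarrow> normalized k g (moebius D \<tau>) = normalized k g \<tau>"
    "\<And>D \<tau>. D \<in> L \<Longrightarrow> Im \<tau> > 0 \<Longrightarrow> normalized k m (moebius D \<tau>) = of_int (ch D) * normalized k m \<tau>"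
proof -
  define f' where "f' = (\<lambda>\<tau>. if Im \<tau> > 0 then theta \<tau> ^ k * normalized k f (moebius G \<tau>) else 0)"
  have f': "admissible k f'" unfolding f'_def by (rule admissible_twist[OF adm G])
  have nf': "normalized k f' \<tau> = normalized k f (moebius G \<tau>)" if "Im \<tau> > 0" for \<tau>
    unfolding normalized_def[of k f'] using theta_nonzero[OF that] that by (simp add: f'_def)
  define g where "g = fun_scale (1 / 2) (f + f')"
  define m where "m = fun_scale (1 / 2) (f + fun_scale (-1) f')"
  have ng: "normalized k g \<tau> = (normalized k f \<tau> + normalized k f (moebius G \<tau>)) / 2" if "Im \<tau> > 0" for \<tau>
    unfolding nf'[OF that, symmetric] using theta_nonzero[OF that] by (simp add: normalized_def g_def fun_scale_apply field_simps)
  have nm: "normalized k m \<tau> = (normalized k f \<tau> - normalized k f (moebius G \<tau>)) / 2" if "Im \<tau> > 0" for \<tau>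
    unfolding nf'[OF that, symmetric] using theta_nonzero[OF that] by (simp add: normalized_def m_def fun_scale_apply field_simps)
  show ?thesis
  proof (rule that[of g m])
    show "f = g + m" by (simp add: g_def m_def fun_eq_iff fun_scale_apply field_simps)
    show "admissible k g" "admissible k m"
      unfolding g_def m_def by (intro admissible_add admissible_scale adm f')+
    fix D \<tau> assume D: "D \<in> L" and \<tau>: "Im \<tau> > 0"
    have D\<tau>: "Im (moebius D \<tau>) > 0" using SL2Z_moebius(1) D L \<tau> by blast
    show "normalized k g (moebius D \<tau>) = normalized k g \<tau>"
      "normalized k m (moebius D \<tau>) = of_int (ch D) * normalized k m \<tau>"
      using ch[OF D] by (auto simp: ng[OF \<tau>] ng[OF D\<tau>] nm[OF \<tau>] nm[OF D\<tau>] 1[OF D \<tau>] 2[OF D \<tau>] field_simps)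
  qed
qed

lemma kind_image_surj:
  assumes "a * d - b * c = 1"
  shows "\<exists>y. kind_image a b c d y = x"
proof -
  have par: "odd (a * d) \<noteq> odd (b * c)"
  proof -
    have "a * d = b * c + 1" using assms by simp
    thus ?thesis by simp
  qed
  have "x = kind_image a b c d Natural \<or> x = kind_image a b c d Flat \<or> x = kind_image a b c d Sharp"
    using par by (cases x) (auto simp: kind_of_def)
  thus ?thesis by blast
qed

text \<open>
  Read at the cusp A(i\<infinity>), the eta quotient x looks like some eta quotient y at
  infinity; it vanishes only if y is eta_sharp.
\<close>
lemma eta_fn_at_cusp:
  assumes A: "A \<in> SL2Z"
  obtains y C where "C > 0" "y = Sharp \<Longrightarrow> x = kind_of (A $ 1 $ 1) (A $ 2 $ 1)"
    "\<And>\<tau>. Im \<tau> > 0 \<Longrightarrow> norm (eta_fn x (moebius A \<tau>)) = C * sqrt (norm (den A \<tau>)) * norm (eta_fn y \<tau>)"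
proof -
  have det: "A $ 1 $ 1 * A $ 2 $ 2 - A $ 1 $ 2 * A $ 2 $ 1 = 1" using A by (simp add: SL2Z_iff)
  obtain y where y: "kind_image (A $ 1 $ 1) (A $ 1 $ 2) (A $ 2 $ 1) (A $ 2 $ 2) y = x"
    using kind_image_surj[OF det] by blast
  obtain C where "C > 0" "\<And>\<tau>. Im \<tau> > 0 \<Longrightarrow> norm (eta_fn x (moebius A \<tau>)) = C * sqrt (norm (den A \<tau>)) * norm (eta_fn y \<tau>)"
    using eta_permuted_SL2Z[OF det] unfolding eta_permuted_def moebius_def den_def y[symmetric] by blast
  thus ?thesis using that[of C y] y by auto
qed

lemma eta_over_theta_char:
  assumes "D \<in> Gamma4" "Im \<tau> > 0"
  shows "eta_fn x (moebius D \<tau>) / theta (moebius D \<tau>) = of_int (eta_char x D) * (eta_fn x \<tau> / theta \<tau>)"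
  using eta_fn_moebius[OF assms, of x] theta_nonzero[OF SL2Z_moebius(1)[OF Gamma4_SL2Z[OF assms(1)] assms(2)]]
  by simp

lemma theta_forms_mult_eta:
  assumes f: "f \<in> theta_forms S k"
  shows "f * eta_fn x \<in> theta_forms (insert x S) (Suc k)"
  unfolding theta_forms_def
proof (intro CollectI conjI ballI allI impI)
  have adm: "admissible k f" using f by (simp add: theta_forms_def)
  have hol: "f * eta_fn x holomorphic_on upper_half_plane"
    using adm eta_fn_holomorphic[of x] by (auto simp: admissible_def times_fun_def intro!: holomorphic_intros)
  have "bounded_at_cusps (Suc k) (f * eta_fn x)"
    unfolding bounded_at_cusps_def
  proof
    fix A :: "int^2^2" assume A: "A \<in> SL2Z"
    obtain B C where 1: "\<And>\<tau>. Im \<tau> > B \<Longrightarrow> slash_abs k f A \<tau> \<le> C"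
      using adm A unfolding admissible_def bounded_at_cusps_def by blast
    obtain y C' where y: "C' > 0" "\<And>\<tau>. Im \<tau> > 0 \<Longrightarrow> norm (eta_fn x (moebius A \<tau>)) = C' * sqrt (norm (den A \<tau>)) * norm (eta_fn y \<tau>)"
      using eta_fn_at_cusp[OF A] by metis
    obtain B'' C'' where 2: "\<And>\<tau>. Im \<tau> > B'' \<Longrightarrow> norm (eta_fn y \<tau>) \<le> C''" using eta_upper_bound[of y] by blast
    have "slash_abs (Suc k) (f * eta_fn x) A \<tau> \<le> C * (C' * C'')" if "Im \<tau> > max (max B B'') 0" for \<tau>
    proof -
      have \<tau>: "Im \<tau> > 0" "Im \<tau> > B" "Im \<tau> > B''" using that by auto
      have "sqrt (norm (den A \<tau>)) \<noteq> 0" using SL2Z_moebius(2)[OF A \<tau>(1)] by simp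
      hence "slash_abs (Suc k) (f * eta_fn x) A \<tau> = slash_abs k f A \<tau> * (C' * norm (eta_fn y \<tau>))"
        using y(2)[OF \<tau>(1)] by (simp add: slash_abs_def norm_mult)
      also have "\<dots> \<le> C * (C' * C'')"
        using 1[OF \<tau>(2)] 2[OF \<tau>(3)] y(1) slash_abs_nonneg[of k f A \<tau>]
        by (intro mult_mono mult_left_mono) (auto intro: order_trans)
      finally show ?thesis .
    qed
    thus "\<exists>B C. \<forall>\<tau>. Im \<tau> > B \<longrightarrow> slash_abs (Suc k) (f * eta_fn x) A \<tau> \<le> C" by blast
  qed
  thus "admissible (Suc k) (f * eta_fn x)" using hol adm by (simp add: admissible_def)
  fix D \<tau> assume D: "D \<in> char_group (insert x S)" and \<tau>: "Im (\<tau>::complex) > 0"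
  have eq: "normalized (Suc k) (f * eta_fn x) \<tau> = normalized k f \<tau> * (eta_fn x \<tau> / theta \<tau>)" for \<tau>
    by (simp add: normalized_def)
  have DG: "D \<in> Gamma4" "eta_char x D = 1" "D \<in> char_group S" using D by (auto simp: char_group_def)
  have "normalized k f (moebius D \<tau>) = normalized k f \<tau>" using f DG(3) \<tau> by (simp add: theta_forms_def)
  thus "normalized (Suc k) (f * eta_fn x) (moebius D \<tau>) = normalized (Suc k) (f * eta_fn x) \<tau>"
    unfolding eq using eta_over_theta_char[OF DG(1) \<tau>, of x] DG(2) by simp
qed

lemma weight_zero_constant:
  assumes "f \<in> theta_forms S 0"
  shows "\<exists>c. \<forall>\<tau>. Im \<tau> > 0 \<longrightarrow> f \<tau> = c"
proof (rule Gamma8_invariant_bounded_constant)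
  have adm: "admissible 0 f" using assms by (simp add: theta_forms_def)
  show "f holomorphic_on upper_half_plane" using adm by (simp add: admissible_def)
  show "f (moebius A \<tau>) = f \<tau>" if "A \<in> Gamma_principal 8" "Im \<tau> > 0" for A \<tau>
    using assms Gamma8_subset(1)[OF that(1), of S] that(2) by (auto simp: theta_forms_def normalized_def)
  show "\<exists>B C. \<forall>\<tau>. Im \<tau> > B \<longrightarrow> norm (f (moebius A \<tau>)) \<le> C" if "A \<in> SL2Z" for A
    using adm that unfolding admissible_def bounded_at_cusps_def slash_abs_def by simp
qed

text \<open>
  The form h is the odd part of f divided by the eta quotient. Where the latter vanishes, the
  odd part is antiperiodic under the conjugate of T^4 and so decays at least as fast; elsewhere
  the eta quotient is bounded below. In weight 0 the odd part is a constant that changes sign,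
  hence zero.
\<close>
theorem theta_forms_split:
  assumes x: "x \<notin> S" and f: "f \<in> theta_forms (insert x S) k"
  shows "\<exists>g\<in>theta_forms S k. \<exists>h. (if k = 0 then h = 0 else h \<in> theta_forms S (k - 1)) \<and> f = g + h * eta_fn x"
proof -
  define G where "G = eta_gen x"
  have G: "G \<in> Gamma4" and GS: "G \<in> SL2Z" unfolding G_def using eta_gen_Gamma4 Gamma4_SL2Z by blast+
  have chG: "eta_char y G = (if y = x then -1 else 1)" for y by (simp add: G_def eta_char_gen)
  have adm: "admissible k f" using f by (simp add: theta_forms_def)
  have inv: "normalized k f (moebius D \<tau>) = normalized k f \<tau>" if "D \<in> char_group (insert x S)" "Im \<tau> > 0" for D \<tau>
    using f that by (simp add: theta_forms_def)
  have L: "char_group S \<subseteq> Gamma4" "char_group S \<subseteq> SL2Z" by (auto simp: char_group_def Gamma4_iff)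
  have chi: "eta_char x D = 1 \<or> eta_char x D = -1" if "D \<in> char_group S" for D
    using eta_char_cases L that by blast
  (* elements with the same characters for x and S act on the normalized form in the same way *)
  have act: "normalized k f (moebius E (moebius D \<tau>)) = normalized k f (moebius E' \<tau>)"
    if "E \<in> Gamma4" "D \<in> Gamma4" "E' \<in> Gamma4" "\<And>y. y \<in> insert x S \<Longrightarrow> eta_char y E * eta_char y D = eta_char y E'" "Im \<tau> > 0"
    for E D E' \<tau>
  proof -
    note SL = Gamma4_SL2Z[OF that(1)] Gamma4_SL2Z[OF that(2)] Gamma4_SL2Z[OF that(3)]
    define N where "N = E ** D ** SL2Z_inv E'"
    have "eta_char y N = 1" if y: "y \<in> insert x S" for y
    proof -
      have "eta_char y N = eta_char y E * eta_char y D * eta_char y E'"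
        unfolding N_def using that by (simp add: eta_char_mult Gamma4_mult Gamma4_sinv eta_char_sinv \<open>E \<in> Gamma4\<close> \<open>D \<in> Gamma4\<close> \<open>E' \<in> Gamma4\<close>)
      thus ?thesis using \<open>\<And>y. y \<in> insert x S \<Longrightarrow> eta_char y E * eta_char y D = eta_char y E'\<close>[OF y] eta_char_square[OF \<open>E' \<in> Gamma4\<close>, of y] by simp
    qed
    moreover have "N \<in> Gamma4" unfolding N_def by (intro Gamma4_mult Gamma4_sinv that(1,2,3))
    ultimately have N: "N \<in> char_group (insert x S)" by (simp add: char_group_def)
    have "moebius E (moebius D \<tau>) = moebius (E ** D) \<tau>" by (rule moebius_mult(1)[OF SL(2) that(5), symmetric])
    also have "E ** D = N ** E'" unfolding N_def by (simp add: SL2Z_inv_mult(3)[OF SL(3)])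
    also have "moebius (N ** E') \<tau> = moebius N (moebius E' \<tau>)" by (rule moebius_mult(1)[OF SL(3) that(5)])
    finally show ?thesis using inv[OF N SL2Z_moebius(1)[OF SL(3) that(5)]] by simp
  qed
  define I where "I = mat2 1 0 0 1"
  have I: "I \<in> Gamma4" "eta_char y I = 1" "moebius I \<tau> = \<tau>" for y \<tau>
    by (simp add: I_def Gamma4_iff SL2Z_iff, cases y, simp_all add: I_def sgn8_def moebius_def)
  have 1: "normalized k f (moebius D \<tau>) = (if eta_char x D = 1 then normalized k f \<tau> else normalized k f (moebius G \<tau>))"
    if D: "D \<in> char_group S" and \<tau>: "Im \<tau> > 0" for D \<tau>
  proof (cases "eta_char x D = 1")
    case True
    hence "D \<in> char_group (insert x S)" using D by (simp add: char_group_def)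
    thus ?thesis using inv[OF _ \<tau>] True by simp
  next
    case False
    hence m1: "eta_char x D = -1" using chi[OF D] by simp
    have "normalized k f (moebius D (moebius I \<tau>)) = normalized k f (moebius G \<tau>)"
      using D L m1 x by (intro act I G \<tau>) (auto simp: chG I char_group_def)
    thus ?thesis using False by (simp add: I)
  qed
  have 2: "normalized k f (moebius G (moebius D \<tau>)) = (if eta_char x D = 1 then normalized k f (moebius G \<tau>) else normalized k f \<tau>)"
    if D: "D \<in> char_group S" and \<tau>: "Im \<tau> > 0" for D \<tau>
  proof (cases "eta_char x D = 1")
    case True
    have "normalized k f (moebius G (moebius D \<tau>)) = normalized k f (moebius G \<tau>)"
      using D L True x by (intro act G \<tau>) (auto simp: chG char_group_def)
    thus ?thesis using True by simp
  next
    case False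
    hence m1: "eta_char x D = -1" using chi[OF D] by simp
    have "normalized k f (moebius G (moebius D \<tau>)) = normalized k f (moebius I \<tau>)"
      using D L m1 x by (intro act I G \<tau>) (auto simp: chG I char_group_def)
    thus ?thesis using False by (simp add: I)
  qed
  obtain g m where fgm: "f = g + m" and ag: "admissible k g" and am: "admissible k m"
    and ng: "\<And>D \<tau>. D \<in> char_group S \<Longrightarrow> Im \<tau> > 0 \<Longrightarrow> normalized k g (moebius D \<tau>) = normalized k g \<tau>"
    and nm: "\<And>D \<tau>. D \<in> char_group S \<Longrightarrow> Im \<tau> > 0 \<Longrightarrow> normalized k m (moebius D \<tau>) = of_int (eta_char x D) * normalized k m \<tau>"
    using eigen_split[OF adm G chi L(2) 1 2] by blast
  have g: "g \<in> theta_forms S k" using ag ng by (simp add: theta_forms_def)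
  have mins: "m \<in> theta_forms (insert x S) k"
    using am nm by (auto simp: theta_forms_def char_group_def)
  have m0: "m \<tau> = 0" if "\<not> Im \<tau> > 0" for \<tau> using am that by (simp add: admissible_def)
  show ?thesis
  proof (cases "k = 0")
    case True
    then obtain c where c: "\<And>\<tau>. Im \<tau> > 0 \<Longrightarrow> m \<tau> = c" using weight_zero_constant mins by metis
    have GL: "G \<in> char_group S" using G chG x by (auto simp: char_group_def)
    have i: "Im \<i> > 0" by simp
    have "m (moebius G \<i>) = - m \<i>" using nm[OF GL i] chG True by (simp add: normalized_def)
    hence "c = - c" using c[OF i] c[OF SL2Z_moebius(1)[OF GS i]] by simp
    hence "c = 0" by simp
    hence "m \<tau> = 0" for \<tau> using c m0 by (cases "Im \<tau> > 0") auto
    hence "m = 0" by (simp add: fun_eq_iff)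
    thus ?thesis using g True fgm by (intro bexI[of _ g] exI[of _ 0]) auto
  next
    case False
    then obtain j where k: "k = Suc j" by (cases k) auto
    define h where "h = (\<lambda>\<tau>. if Im \<tau> > 0 then m \<tau> / eta_fn x \<tau> else 0)"
    have mh: "m = h * eta_fn x"
      using eta_fn_nonzero m0 by (auto simp: fun_eq_iff h_def)
    have "(\<lambda>\<tau>. m \<tau> / eta_fn x \<tau>) holomorphic_on upper_half_plane"
      using am eta_fn_nonzero by (intro holomorphic_on_divide eta_fn_holomorphic) (auto simp: admissible_def upper_half_plane_def)
    hence hol: "h holomorphic_on upper_half_plane"
      by (rule holomorphic_transform) (simp add: h_def upper_half_plane_def)
    have "bounded_at_cusps j h"
      unfolding bounded_at_cusps_def
    proof
      fix A :: "int^2^2" assume A: "A \<in> SL2Z"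
      obtain y C where C: "C > 0" and yS: "y = Sharp \<Longrightarrow> x = kind_of (A $ 1 $ 1) (A $ 2 $ 1)"
        and ey: "\<And>\<tau>. Im \<tau> > 0 \<Longrightarrow> norm (eta_fn x (moebius A \<tau>)) = C * sqrt (norm (den A \<tau>)) * norm (eta_fn y \<tau>)"
        using eta_fn_at_cusp[OF A] by metis
      have ns: "slash_abs j h A \<tau> = slash_abs k m A \<tau> / (C * norm (eta_fn y \<tau>))" if \<tau>: "Im \<tau> > 0" for \<tau>
      proof -
        have "sqrt (norm (den A \<tau>)) \<noteq> 0" using SL2Z_moebius(2)[OF A \<tau>] by simp
        thus ?thesis using SL2Z_moebius(1)[OF A \<tau>] ey[OF \<tau>] C by (simp add: slash_abs_def h_def norm_divide k)
      qed
      show "\<exists>B C. \<forall>\<tau>. Im \<tau> > B \<longrightarrow> slash_abs j h A \<tau> \<le> C"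
      proof (cases "y = Sharp")
        case False
        obtain B where B: "\<And>\<tau>. Im \<tau> > B \<Longrightarrow> norm (eta_fn y \<tau>) \<ge> 1 / 2" using eta_lower_bounds(1)[OF False] by blast
        obtain B' K where K: "\<And>\<tau>. Im \<tau> > B' \<Longrightarrow> slash_abs k m A \<tau> \<le> K"
          using am A unfolding admissible_def bounded_at_cusps_def by blast
        have "slash_abs j h A \<tau> \<le> K / (C * (1 / 2))" if "Im \<tau> > max (max B B') 0" for \<tau>
        proof -
          have "Im \<tau> > 0" using that by simp
          from ns[OF this] show ?thesis
          using that B[of \<tau>] K[of \<tau>] C slash_abs_nonneg[of k m A \<tau>]
          by (simp only:) (intro frac_le mult_left_mono; (simp; fail | auto intro: order_trans))
        qed
        thus ?thesis by blast
      next
        case True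
        have T: "T_conj 4 A \<in> char_group S"
          using x by (auto simp: char_group_def T_conj_4_Gamma4 eta_char_T_conj[OF A] yS[OF True, symmetric])
        have "normalized k m (moebius (T_conj 4 A) \<tau>) = - normalized k m \<tau>" if "Im \<tau> > 0" for \<tau>
          using nm[OF T that] by (simp add: eta_char_T_conj[OF A] yS[OF True, symmetric])
        moreover have "normalized k m (moebius D \<tau>) = normalized k m \<tau>" if "D \<in> Gamma_principal 8" "Im \<tau> > 0" for D \<tau>
          using mins Gamma8_subset(1)[OF that(1)] that(2) by (auto simp: theta_forms_def)
        ultimately have "\<exists>B C. \<forall>\<tau>. Im \<tau> > B \<longrightarrow> slash_abs k m A \<tau> \<le> C * exp (- (pi / 4) * Im \<tau>)"
          by (intro cusp_decay[OF am A]) auto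
        then obtain B' K where K: "\<And>\<tau>. Im \<tau> > B' \<Longrightarrow> slash_abs k m A \<tau> \<le> K * exp (- (pi / 4) * Im \<tau>)" by blast
        obtain B where B: "\<And>\<tau>. Im \<tau> > B \<Longrightarrow> norm (eta_sharp \<tau>) \<ge> exp (- (pi / 4) * Im \<tau>) / 2"
          using eta_lower_bounds(2) by blast
        have "slash_abs j h A \<tau> \<le> 2 * K / C" if "Im \<tau> > max (max B B') 0" for \<tau>
        proof -
          define e where "e = exp (- (pi / 4) * Im \<tau>)"
          have e: "e > 0" by (simp add: e_def)
          have "Im \<tau> > 0" using that by simp
          have "slash_abs j h A \<tau> \<le> (K * e) / (C * (e / 2))"
            unfolding ns[OF \<open>Im \<tau> > 0\<close>] True eta_fn.simps
          proof (intro frac_le mult_left_mono)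
            show le: "slash_abs k m A \<tau> \<le> K * e" using K[of \<tau>] that by (simp add: e_def)
            show "0 \<le> K * e" using le slash_abs_nonneg[of k m A \<tau>] by linarith
            show "e / 2 \<le> norm (eta_sharp \<tau>)" using B[of \<tau>] that by (simp add: e_def)
          qed (use C e in auto)
          thus ?thesis using e by (simp add: mult_ac)
        qed
        thus ?thesis by blast
      qed
    qed
    hence ah: "admissible j h" using hol by (simp add: admissible_def h_def)
    have nh: "normalized j h \<tau> = normalized k m \<tau> / (eta_fn x \<tau> / theta \<tau>)" if "Im \<tau> > 0" for \<tau>
      using theta_nonzero[OF that] that by (simp add: normalized_def h_def k)
    have "normalized j h (moebius D \<tau>) = normalized j h \<tau>" if D: "D \<in> char_group S" and \<tau>: "Im \<tau> > 0" for D \<tau>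
    proof -
      have DG: "D \<in> Gamma4" using D by (simp add: char_group_def)
      have "of_int (eta_char x D) \<noteq> (0 :: complex)" using chi[OF D] by auto
      thus ?thesis
        using nh[OF \<tau>] nh[OF SL2Z_moebius(1)[OF Gamma4_SL2Z[OF DG] \<tau>]] nm[OF D \<tau>]
          eta_over_theta_char[OF DG \<tau>, of x] by simp
    qed
    hence "h \<in> theta_forms S (k - 1)" using ah by (simp add: theta_forms_def k)
    thus ?thesis using g fgm mh False by (intro bexI[of _ g] exI[of _ h]) auto
  qed
qed

section \<open>Cusp forms and the cube of eta\<close>

lemma eta_fn_prod:
  assumes "Im \<tau> > 0"
  shows "(\<Prod>x\<in>UNIV. norm (eta_fn x \<tau>)) = norm (dedekind_eta \<tau>) ^ 3"
  unfolding eta_kind_UNIV using arg_cong[OF eta_product[OF assms], of norm]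
  by (simp add: norm_mult norm_power mult_ac)

lemma finite_eta_kind: "finite (UNIV :: eta_kind set)"
  unfolding eta_kind_UNIV by simp

text \<open>
  The modular group permutes the three factors of the cube of eta.
\<close>
lemma eta_cubed_at_cusp:
  assumes A: "A \<in> SL2Z"
  obtains C where "C > 0"
    "\<And>\<tau>. Im \<tau> > 0 \<Longrightarrow> norm (dedekind_eta (moebius A \<tau>)) ^ 3 = C * sqrt (norm (den A \<tau>)) ^ 3 * norm (dedekind_eta \<tau>) ^ 3"
proof -
  define \<pi> where "\<pi> = kind_image (A $ 1 $ 1) (A $ 1 $ 2) (A $ 2 $ 1) (A $ 2 $ 2)"
  have det: "A $ 1 $ 1 * A $ 2 $ 2 - A $ 1 $ 2 * A $ 2 $ 1 = 1" using A by (simp add: SL2Z_iff)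
  have "surj \<pi>" unfolding \<pi>_def surj_def using kind_image_surj[OF det] by metis
  hence bij: "bij_betw \<pi> UNIV UNIV"
    using finite_eta_kind finite_UNIV_surj_inj by (auto simp: bij_betw_def)
  obtain C where C: "\<And>y. C y > 0"
    "\<And>y \<tau>. Im \<tau> > 0 \<Longrightarrow> norm (eta_fn (\<pi> y) (moebius A \<tau>)) = C y * sqrt (norm (den A \<tau>)) * norm (eta_fn y \<tau>)"
    using eta_permuted_SL2Z[OF det] unfolding eta_permuted_def moebius_def den_def \<pi>_def by metis
  show ?thesis
  proof (rule that[of "\<Prod>y\<in>UNIV. C y"])
    show "(\<Prod>y\<in>UNIV. C y) > 0" using C(1) by (intro prod_pos) auto
    fix \<tau> assume \<tau>: "Im (\<tau>::complex) > 0"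
    have "norm (dedekind_eta (moebius A \<tau>)) ^ 3 = (\<Prod>x\<in>UNIV. norm (eta_fn x (moebius A \<tau>)))"
      by (rule eta_fn_prod[OF SL2Z_moebius(1)[OF A \<tau>], symmetric])
    also have "\<dots> = (\<Prod>y\<in>UNIV. norm (eta_fn (\<pi> y) (moebius A \<tau>)))"
      by (rule prod.reindex_bij_betw[OF bij, symmetric])
    also have "\<dots> = (\<Prod>y\<in>UNIV. C y) * (\<Prod>y\<in>(UNIV::eta_kind set). sqrt (norm (den A \<tau>))) * (\<Prod>y\<in>UNIV. norm (eta_fn y \<tau>))"
      by (simp add: C(2)[OF \<tau>] prod.distrib)
    also have "(\<Prod>y\<in>(UNIV::eta_kind set). sqrt (norm (den A \<tau>))) = sqrt (norm (den A \<tau>)) ^ 3"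
      by (simp add: eta_kind_UNIV power3_eq_cube)
    finally show "norm (dedekind_eta (moebius A \<tau>)) ^ 3 = (\<Prod>y\<in>UNIV. C y) * sqrt (norm (den A \<tau>)) ^ 3 * norm (dedekind_eta \<tau>) ^ 3"
      by (simp only: eta_fn_prod[OF \<tau>])
  qed
qed

lemma eta_cubed_lower: "\<exists>B. \<forall>\<tau>. Im \<tau> > B \<longrightarrow> norm (dedekind_eta \<tau>) ^ 3 \<ge> exp (- (pi / 4) * Im \<tau>) / 8"
proof -
  obtain B1 where 1: "\<And>\<tau>. Im \<tau> > B1 \<Longrightarrow> norm (eta_natural \<tau>) \<ge> 1 / 2" using eta_lower_bounds(1)[of Natural] by auto
  obtain B2 where 2: "\<And>\<tau>. Im \<tau> > B2 \<Longrightarrow> norm (eta_flat \<tau>) \<ge> 1 / 2" using eta_lower_bounds(1)[of Flat] by auto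
  obtain B3 where 3: "\<And>\<tau>. Im \<tau> > B3 \<Longrightarrow> norm (eta_sharp \<tau>) \<ge> exp (- (pi / 4) * Im \<tau>) / 2" using eta_lower_bounds(2) by blast
  have "norm (dedekind_eta \<tau>) ^ 3 \<ge> exp (- (pi / 4) * Im \<tau>) / 8" if "Im \<tau> > Max {B1, B2, B3, 0}" for \<tau>
  proof -
    have \<tau>: "Im \<tau> > B1" "Im \<tau> > B2" "Im \<tau> > B3" "Im \<tau> > 0" using that by auto
    have "(1 / 2) * (1 / 2) * (exp (- (pi / 4) * Im \<tau>) / 2) \<le> norm (eta_natural \<tau>) * norm (eta_flat \<tau>) * norm (eta_sharp \<tau>)"
      by (intro mult_mono 1 2 3 \<tau> mult_nonneg_nonneg) auto
    also have "\<dots> = norm (dedekind_eta \<tau>) ^ 3"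
      using arg_cong[OF eta_product[OF \<tau>(4)], of norm] by (simp add: norm_mult norm_power)
    finally show ?thesis by simp
  qed
  thus ?thesis by blast
qed

lemma eta_cubed_tendsto_0: "((\<lambda>\<tau>. norm (dedekind_eta \<tau>) ^ 3) \<longlongrightarrow> 0) at_i_infinity"
proof -
  have "((\<lambda>\<tau>. eta_natural \<tau> * eta_flat \<tau> * eta_sharp \<tau>) \<longlongrightarrow> 1 * 1 * 0) at_i_infinity"
    by (intro tendsto_mult eta_tendsto eta_sharp_tendsto_0)
  hence "((\<lambda>\<tau>. norm (eta_natural \<tau> * eta_flat \<tau> * eta_sharp \<tau>)) \<longlongrightarrow> 0) at_i_infinity"
    using tendsto_norm_zero by fastforce
  thus ?thesis
  proof (rule Lim_transform_eventually)
    show "\<forall>\<^sub>F \<tau> in at_i_infinity. norm (eta_natural \<tau> * eta_flat \<tau> * eta_sharp \<tau>) = norm (dedekind_eta \<tau>) ^ 3"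
      using at_i_infinity_upper[of 0] by eventually_elim (simp add: eta_product norm_power)
  qed
qed

lemma slash_tendsto_iff:
  assumes "A \<in> SL2Z"
  shows "(slash k f A \<longlongrightarrow> 0) at_i_infinity \<longleftrightarrow> (slash_abs k f A \<longlongrightarrow> 0) at_i_infinity"
proof -
  have "slash_abs k f A = (\<lambda>\<tau>. norm (slash k f A \<tau>))" using norm_slash[OF assms] by (simp add: fun_eq_iff)
  thus ?thesis by (simp add: tendsto_norm_zero_iff)
qed

lemma cusps_Gamma8_iff:
  "f \<in> cusps_Gamma8 k \<longleftrightarrow> f \<in> theta_forms UNIV k \<and> (\<forall>A\<in>SL2Z. (slash_abs k f A \<longlongrightarrow> 0) at_i_infinity)"
  using forms_Gamma8_eq[of k] by (auto simp: cusps_Gamma8_def cusp_forms_def forms_Gamma8_def slash_tendsto_iff)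

lemma mult_eta_cubed_cusp:
  assumes f: "f \<in> theta_forms UNIV k"
  shows "f * dedekind_eta ^ 3 \<in> cusps_Gamma8 (k + 3)"
proof -
  have adm: "admissible k f" using f by (simp add: theta_forms_def)
  have eq: "f * dedekind_eta ^ 3 = f * eta_natural * eta_flat * eta_sharp"
  proof
    fix \<tau>
    show "(f * dedekind_eta ^ 3) \<tau> = (f * eta_natural * eta_flat * eta_sharp) \<tau>"
      using eta_product[of \<tau>] adm by (cases "Im \<tau> > 0") (simp_all add: power3_eq_cube admissible_def mult_ac)
  qed
  have "f * eta_fn Natural * eta_fn Flat * eta_fn Sharp \<in> theta_forms (insert Sharp (insert Flat (insert Natural UNIV))) (Suc (Suc (Suc k)))"
    by (intro theta_forms_mult_eta f[THEN subsetD[OF theta_forms_antimono, rotated]]) auto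
  hence "f * eta_natural * eta_flat * eta_sharp \<in> theta_forms UNIV (k + 3)"
    by (simp add: numeral_3_eq_3)
  hence "f * dedekind_eta ^ 3 \<in> theta_forms UNIV (k + 3)" unfolding eq .
  moreover have "(slash_abs (k + 3) (f * dedekind_eta ^ 3) A \<longlongrightarrow> 0) at_i_infinity" if A: "A \<in> SL2Z" for A
  proof -
    obtain B K where K: "\<And>\<tau>. Im \<tau> > B \<Longrightarrow> slash_abs k f A \<tau> \<le> K"
      using adm A unfolding admissible_def bounded_at_cusps_def by blast
    obtain C where C: "C > 0" "\<And>\<tau>. Im \<tau> > 0 \<Longrightarrow> norm (dedekind_eta (moebius A \<tau>)) ^ 3 = C * sqrt (norm (den A \<tau>)) ^ 3 * norm (dedekind_eta \<tau>) ^ 3"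
      using eta_cubed_at_cusp[OF A] by blast
    have eq: "slash_abs (k + 3) (f * dedekind_eta ^ 3) A \<tau> = slash_abs k f A \<tau> * (C * norm (dedekind_eta \<tau>) ^ 3)" if \<tau>: "Im \<tau> > 0" for \<tau>
    proof -
      have "sqrt (norm (den A \<tau>)) \<noteq> 0" using SL2Z_moebius(2)[OF A \<tau>] by simp
      moreover have "norm ((f * dedekind_eta ^ 3) (moebius A \<tau>)) = norm (f (moebius A \<tau>)) * norm (dedekind_eta (moebius A \<tau>)) ^ 3"
        by (simp add: power3_eq_cube norm_mult)
      ultimately show ?thesis by (simp add: slash_abs_def C(2)[OF \<tau>] power_add)
    qed
    have "((\<lambda>\<tau>. K * (C * norm (dedekind_eta \<tau>) ^ 3)) \<longlongrightarrow> K * (C * 0)) at_i_infinity"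
      by (intro tendsto_mult tendsto_const eta_cubed_tendsto_0)
    hence lim: "((\<lambda>\<tau>. K * (C * norm (dedekind_eta \<tau>) ^ 3)) \<longlongrightarrow> 0) at_i_infinity" by simp
    show ?thesis
    proof (rule tendsto_sandwich[OF _ _ tendsto_const lim])
      show "\<forall>\<^sub>F \<tau> in at_i_infinity. 0 \<le> slash_abs (k + 3) (f * dedekind_eta ^ 3) A \<tau>"
        by (simp add: slash_abs_nonneg)
      show "\<forall>\<^sub>F \<tau> in at_i_infinity. slash_abs (k + 3) (f * dedekind_eta ^ 3) A \<tau> \<le> K * (C * norm (dedekind_eta \<tau>) ^ 3)"
        using at_i_infinity_upper[of "max B 0"]
      proof eventually_elim
        case (elim \<tau>)
        thus ?case using eq[of \<tau>] K[of \<tau>] C(1) by (simp add: mult_right_mono)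
      qed
    qed
  qed
  ultimately show ?thesis by (simp add: cusps_Gamma8_iff)
qed

lemma eta_cubed_over_theta:
  assumes "D \<in> char_group UNIV" "Im \<tau> > 0"
  shows "dedekind_eta (moebius D \<tau>) ^ 3 / theta (moebius D \<tau>) ^ 3 = dedekind_eta \<tau> ^ 3 / theta \<tau> ^ 3"
proof -
  have D: "D \<in> Gamma4" "\<And>x. eta_char x D = 1" using assms(1) by (auto simp: char_group_def)
  have eq: "dedekind_eta \<sigma> ^ 3 / theta \<sigma> ^ 3 = (eta_fn Natural \<sigma> / theta \<sigma>) * (eta_fn Flat \<sigma> / theta \<sigma>) * (eta_fn Sharp \<sigma> / theta \<sigma>)"
    if "Im \<sigma> > 0" for \<sigma>
    using eta_product[OF that] by (simp add: power3_eq_cube)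
  show ?thesis
    unfolding eq[OF assms(2)] eq[OF SL2Z_moebius(1)[OF Gamma4_SL2Z[OF D(1)] assms(2)]]
      eta_over_theta_char[OF D(1) assms(2)] D(2) by simp
qed

text \<open>
  At every cusp f is bounded by a multiple of exp(-\<pi> Im \<tau> / 4), which is the exact
  order of the cube of eta. In weight below 3/2 the quotient would have negative weight; instead
  f^3 is divided by the k-th power of the cube of eta, which yields an invariant function of
  weight 0 that vanishes at the cusps.
\<close>
lemma cusp_div_eta_cubed:
  assumes f: "f \<in> cusps_Gamma8 k"
  shows "f = 0 \<or> (\<exists>j. \<exists>h\<in>theta_forms UNIV j. f = h * dedekind_eta ^ 3)"
proof -
  have fT: "f \<in> theta_forms UNIV k" using f by (simp add: cusps_Gamma8_iff)
  have adm: "admissible k f" using fT by (simp add: theta_forms_def)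
  have inv: "normalized k f (moebius D \<tau>) = normalized k f \<tau>" if "D \<in> char_group UNIV" "Im \<tau> > 0" for D \<tau>
    using fT that by (simp add: theta_forms_def)
  have f0: "f \<tau> = 0" if "\<not> Im \<tau> > 0" for \<tau> using adm that by (simp add: admissible_def)
  have fhol: "f holomorphic_on upper_half_plane" using adm by (simp add: admissible_def)
  have nz: "dedekind_eta \<tau> \<noteq> 0" if "\<tau> \<in> upper_half_plane" for \<tau>
    using dedekind_eta_nonzero that by (simp add: upper_half_plane_def)
  have decay: "\<exists>B K. \<forall>\<tau>. Im \<tau> > B \<longrightarrow> slash_abs k f A \<tau> \<le> K * exp (- (pi / 4) * Im \<tau>)" if A: "A \<in> SL2Z" for A
    using f A inv Gamma8_subset(1) by (intro cusp_decay[OF adm A]) (auto simp: cusps_Gamma8_iff)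
  obtain Bl where Bl: "\<And>\<tau>. Im \<tau> > Bl \<Longrightarrow> norm (dedekind_eta \<tau>) ^ 3 \<ge> exp (- (pi / 4) * Im \<tau>) / 8"
    using eta_cubed_lower by blast
  show ?thesis
  proof (cases "k \<ge> 3")
    case True
    then obtain j where k: "k = j + 3" by (metis add.commute le_Suc_ex)
    define h where "h = (\<lambda>\<tau>. if Im \<tau> > 0 then f \<tau> / dedekind_eta \<tau> ^ 3 else 0)"
    have fh: "f = h * dedekind_eta ^ 3"
    proof
      fix \<tau> show "f \<tau> = (h * dedekind_eta ^ 3) \<tau>"
        using f0 dedekind_eta_nonzero[of \<tau>] by (cases "Im \<tau> > 0") (simp_all add: h_def power3_eq_cube)
    qed
    have "(\<lambda>\<tau>. f \<tau> / dedekind_eta \<tau> ^ 3) holomorphic_on upper_half_plane"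
      using nz by (intro holomorphic_intros fhol dedekind_eta_holomorphic) auto
    hence hol: "h holomorphic_on upper_half_plane"
      by (rule holomorphic_transform) (simp add: h_def upper_half_plane_def)
    have "bounded_at_cusps j h"
      unfolding bounded_at_cusps_def
    proof
      fix A :: "int^2^2" assume A: "A \<in> SL2Z"
      obtain B K where K: "\<And>\<tau>. Im \<tau> > B \<Longrightarrow> slash_abs k f A \<tau> \<le> K * exp (- (pi / 4) * Im \<tau>)" using decay[OF A] by blast
      obtain C where C: "C > 0" "\<And>\<tau>. Im \<tau> > 0 \<Longrightarrow> norm (dedekind_eta (moebius A \<tau>)) ^ 3 = C * sqrt (norm (den A \<tau>)) ^ 3 * norm (dedekind_eta \<tau>) ^ 3"
        using eta_cubed_at_cusp[OF A] by blast
      have "slash_abs j h A \<tau> \<le> K * 8 / C" if \<tau>: "Im \<tau> > max (max B Bl) 0" for \<tau>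
      proof -
        define e where "e = exp (- (pi / 4) * Im \<tau>)"
        have e: "e > 0" by (simp add: e_def)
        have \<tau>0: "Im \<tau> > 0" using \<tau> by simp
        have "sqrt (norm (den A \<tau>)) \<noteq> 0" using SL2Z_moebius(2)[OF A \<tau>0] by simp
        hence "slash_abs j h A \<tau> = slash_abs k f A \<tau> / (C * norm (dedekind_eta \<tau>) ^ 3)"
          using SL2Z_moebius(1)[OF A \<tau>0] by (simp add: slash_abs_def h_def norm_divide norm_power C(2)[OF \<tau>0] k power_add)
        also have "\<dots> \<le> (K * e) / (C * (e / 8))"
        proof (intro frac_le mult_left_mono)
          show le: "slash_abs k f A \<tau> \<le> K * e" using K[of \<tau>] \<tau> by (simp add: e_def)
          show "0 \<le> K * e" using le slash_abs_nonneg[of k f A \<tau>] by linarith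
          show "e / 8 \<le> norm (dedekind_eta \<tau>) ^ 3" using Bl[of \<tau>] \<tau> by (simp add: e_def)
        qed (use C e in auto)
        finally show ?thesis using e by (simp add: mult_ac)
      qed
      thus "\<exists>B C. \<forall>\<tau>. Im \<tau> > B \<longrightarrow> slash_abs j h A \<tau> \<le> C" by blast
    qed
    hence ah: "admissible j h" using hol by (simp add: admissible_def h_def)
    have nh: "normalized j h \<tau> = normalized k f \<tau> / (dedekind_eta \<tau> ^ 3 / theta \<tau> ^ 3)" if "Im \<tau> > 0" for \<tau>
      using theta_nonzero[OF that] that by (simp add: normalized_def h_def k power_add)
    have "normalized j h (moebius D \<tau>) = normalized j h \<tau>" if D: "D \<in> char_group UNIV" and \<tau>: "Im \<tau> > 0" for D \<tau>
      unfolding nh[OF \<tau>] nh[OF SL2Z_moebius(1)[OF char_group_SL2Z[OF D] \<tau>]] inv[OF D \<tau>] eta_cubed_over_theta[OF D \<tau>] ..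
    hence "h \<in> theta_forms UNIV j" using ah by (simp add: theta_forms_def)
    thus ?thesis using fh by blast
  next
    case False
    (* the weight 0 quotient of f^3 by the k-th power of eta^3 vanishes at every cusp *)
    define P where "P = (\<lambda>\<tau>. if Im \<tau> > 0 then f \<tau> ^ 3 / (dedekind_eta \<tau> ^ 3) ^ k else 0)"
    have "(\<lambda>\<tau>. f \<tau> ^ 3 / (dedekind_eta \<tau> ^ 3) ^ k) holomorphic_on upper_half_plane"
      using nz by (intro holomorphic_intros fhol dedekind_eta_holomorphic) auto
    hence hol: "P holomorphic_on upper_half_plane"
      by (rule holomorphic_transform) (simp add: P_def upper_half_plane_def)
    have bd: "\<exists>B M. \<forall>\<tau>. Im \<tau> > B \<longrightarrow> slash_abs 0 P A \<tau> \<le> M * exp (- (pi / 4) * Im \<tau>) \<and> M \<ge> 0" if A: "A \<in> SL2Z" for A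
    proof -
      obtain B K where K: "\<And>\<tau>. Im \<tau> > B \<Longrightarrow> slash_abs k f A \<tau> \<le> K * exp (- (pi / 4) * Im \<tau>)" using decay[OF A] by blast
      obtain C where C: "C > 0" "\<And>\<tau>. Im \<tau> > 0 \<Longrightarrow> norm (dedekind_eta (moebius A \<tau>)) ^ 3 = C * sqrt (norm (den A \<tau>)) ^ 3 * norm (dedekind_eta \<tau>) ^ 3"
        using eta_cubed_at_cusp[OF A] by blast
      have "slash_abs 0 P A \<tau> \<le> (K ^ 3 / (C / 8) ^ k) * exp (- (pi / 4) * Im \<tau>) \<and> K ^ 3 / (C / 8) ^ k \<ge> 0"
        if \<tau>: "Im \<tau> > max (max B Bl) 0" for \<tau>
      proof -
        define e where "e = exp (- (pi / 4) * Im \<tau>)"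
        have \<tau>0: "Im \<tau> > 0" using \<tau> by simp
        have e: "e > 0" "e \<le> 1" using \<tau>0 by (simp_all add: e_def)
        have le: "slash_abs k f A \<tau> \<le> K * e" using K[of \<tau>] \<tau> by (simp add: e_def)
        have Ke: "0 \<le> K * e" using le slash_abs_nonneg[of k f A \<tau>] by linarith
        hence K0: "K \<ge> 0" using e by (simp add: zero_le_mult_iff)
        define s where "s = sqrt (norm (den A \<tau>))"
        have s: "s \<noteq> 0" using SL2Z_moebius(2)[OF A \<tau>0] by (simp add: s_def)
        have nf: "norm (f (moebius A \<tau>)) = slash_abs k f A \<tau> * s ^ k" using s by (simp add: slash_abs_def s_def)
        have "slash_abs 0 P A \<tau> = (slash_abs k f A \<tau> * s ^ k) ^ 3 / (C * s ^ 3 * norm (dedekind_eta \<tau>) ^ 3) ^ k"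
          using SL2Z_moebius(1)[OF A \<tau>0] C(2)[OF \<tau>0]
          by (simp add: slash_abs_def[of 0] P_def norm_divide norm_power nf s_def[symmetric])
        also have "\<dots> = slash_abs k f A \<tau> ^ 3 / (C * norm (dedekind_eta \<tau>) ^ 3) ^ k"
        proof -
          define D where "D = (s ^ 3) ^ k"
          have D: "(s ^ k) ^ 3 = D" by (simp add: D_def mult.commute flip: power_mult)
          have "(x * s ^ k) ^ 3 = x ^ 3 * D" "(C * s ^ 3 * y) ^ k = (C * y) ^ k * D" for x y
            by (simp_all only: power_mult_distrib D) (simp add: D_def)
          moreover have "D \<noteq> 0" using s by (simp add: D_def)
          hence "u * D / (v * D) = u / v" for u v by simp
          ultimately show ?thesis by (simp only:)
        qed
        also have "\<dots> \<le> (K * e) ^ 3 / (C * (e / 8)) ^ k"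
        proof (intro frac_le power_mono mult_left_mono le)
          show "e / 8 \<le> norm (dedekind_eta \<tau>) ^ 3" using Bl[of \<tau>] \<tau> by (simp add: e_def)
        qed (use C e Ke slash_abs_nonneg in auto)
        also have "\<dots> = (K ^ 3 / (C / 8) ^ k) * (e ^ 3 / e ^ k)"
          by (simp add: power_mult_distrib power_divide)
        also have "e ^ 3 / e ^ k = e ^ (3 - k)" using False e by (simp add: power_diff)
        also have "(K ^ 3 / (C / 8) ^ k) * e ^ (3 - k) \<le> (K ^ 3 / (C / 8) ^ k) * e ^ 1"
          using False e K0 C by (intro mult_left_mono power_decreasing) auto
        finally show ?thesis using K0 C by (simp add: e_def)
      qed
      thus ?thesis by blast
    qed
    have "bounded_at_cusps 0 P"
      unfolding bounded_at_cusps_def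
    proof
      fix A :: "int^2^2" assume A: "A \<in> SL2Z"
      obtain B M where M: "\<And>\<tau>. Im \<tau> > B \<Longrightarrow> slash_abs 0 P A \<tau> \<le> M * exp (- (pi / 4) * Im \<tau>) \<and> M \<ge> 0" using bd[OF A] by blast
      have "slash_abs 0 P A \<tau> \<le> M" if \<tau>: "Im \<tau> > max B 0" for \<tau>
      proof -
        have "exp (- (pi / 4) * Im \<tau>) \<le> 1" using \<tau> by simp
        hence "M * exp (- (pi / 4) * Im \<tau>) \<le> M * 1" using M[of \<tau>] \<tau> by (intro mult_left_mono) auto
        thus ?thesis using M[of \<tau>] \<tau> by auto
      qed
      thus "\<exists>B C. \<forall>\<tau>. Im \<tau> > B \<longrightarrow> slash_abs 0 P A \<tau> \<le> C" by blast
    qed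
    hence aP: "admissible 0 P" using hol by (simp add: admissible_def P_def)
    have nP: "normalized 0 P \<tau> = normalized k f \<tau> ^ 3 / (dedekind_eta \<tau> ^ 3 / theta \<tau> ^ 3) ^ k" if "Im \<tau> > 0" for \<tau>
    proof -
      have "(theta \<tau> ^ k) ^ 3 = (theta \<tau> ^ 3) ^ k" by (simp add: mult.commute flip: power_mult)
      moreover have "(theta \<tau> ^ 3) ^ k \<noteq> 0" using theta_nonzero[OF that] by simp
      ultimately show ?thesis using that by (simp add: normalized_def P_def power_divide)
    qed
    have "normalized 0 P (moebius D \<tau>) = normalized 0 P \<tau>" if D: "D \<in> char_group UNIV" and \<tau>: "Im \<tau> > 0" for D \<tau>
      unfolding nP[OF \<tau>] nP[OF SL2Z_moebius(1)[OF char_group_SL2Z[OF D] \<tau>]] inv[OF D \<tau>] eta_cubed_over_theta[OF D \<tau>] ..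
    hence "P \<in> theta_forms UNIV 0" using aP by (simp add: theta_forms_def)
    then obtain c where c: "\<And>\<tau>. Im \<tau> > 0 \<Longrightarrow> P \<tau> = c" using weight_zero_constant by blast
    define I where "I = mat2 1 0 0 1"
    have I: "I \<in> SL2Z" "slash_abs 0 P I \<tau> = norm (P \<tau>)" for \<tau>
      by (simp_all add: I_def SL2Z_iff slash_abs_def moebius_def)
    obtain B M where M: "\<And>\<tau>. Im \<tau> > B \<Longrightarrow> norm (P \<tau>) \<le> M * exp (- (pi / 4) * Im \<tau>)" using bd[OF I(1)] I(2) by metis
    have "norm c \<le> M * exp (- (pi / 4) * y)" if "y > max B 0" for y
      using M[of "Complex 0 y"] c[of "Complex 0 y"] that by simp
    hence "eventually (\<lambda>y. norm c \<le> M * exp (- (pi / 4) * y)) at_top"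
      using eventually_gt_at_top[of "max B 0"] by (auto elim: eventually_mono)
    moreover have "((\<lambda>y. M * exp (- (pi / 4) * y)) \<longlongrightarrow> M * 0) at_top"
    proof (intro tendsto_mult tendsto_const)
      show "((\<lambda>y. exp (- (pi / 4) * y)) \<longlongrightarrow> 0) at_top" by real_asymp
    qed
    ultimately have "norm c \<le> M * 0"
      by (intro tendsto_le[OF _ _ tendsto_const]) auto
    hence "c = 0" by simp
    have "f \<tau> = 0" for \<tau>
    proof (cases "Im \<tau> > 0")
      case True
      thus ?thesis using c[OF True] \<open>c = 0\<close> dedekind_eta_nonzero[OF True] by (simp add: P_def)
    qed (rule f0)
    hence "f = 0" by (simp add: fun_eq_iff)
    thus ?thesis ..
  qed
qed

section \<open>Graded sums\<close>

lemma subspace_mult_image: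
  assumes "cfun.subspace V" shows "cfun.subspace ((\<lambda>f. f * g) ` V)"
proof (rule cfun.subspaceI)
  show "0 \<in> (\<lambda>f. f * g) ` V" using cfun.subspace_0[OF assms] by (intro image_eqI[of _ _ 0]) auto
  show "x + y \<in> (\<lambda>f. f * g) ` V" if xy: "x \<in> (\<lambda>f. f * g) ` V" "y \<in> (\<lambda>f. f * g) ` V" for x y
  proof -
    obtain f1 f2 where "f1 \<in> V" "f2 \<in> V" "x = f1 * g" "y = f2 * g" using xy by blast
    thus ?thesis using cfun.subspace_add[OF assms] by (intro image_eqI[of _ _ "f1 + f2"]) (auto simp: distrib_right)
  qed
  show "fun_scale c x \<in> (\<lambda>f. f * g) ` V" if x: "x \<in> (\<lambda>f. f * g) ` V" for c x
  proof -
    obtain f1 where "f1 \<in> V" "x = f1 * g" using x by blast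
    thus ?thesis using cfun.subspace_scale[OF assms]
      by (intro image_eqI[of _ _ "fun_scale c f1"]) (auto simp: fun_scale_def fun_eq_iff)
  qed
qed

text \<open>
  Multiplication by a fixed function is linear.
\<close>
lemma span_mult:
  assumes "f \<in> cfun.span V" "\<And>h. h \<in> V \<Longrightarrow> h * g \<in> cfun.span W"
  shows "f * g \<in> cfun.span W"
  using assms(1)
proof (induction rule: cfun.span_induct)
  case base
  show ?case
  proof (rule cfun.subspaceI)
    show "0 \<in> {f. f * g \<in> cfun.span W}" using cfun.span_zero by simp
    show "x + y \<in> {f. f * g \<in> cfun.span W}" if "x \<in> {f. f * g \<in> cfun.span W}" "y \<in> {f. f * g \<in> cfun.span W}" for x y
      using that cfun.span_add by (auto simp: distrib_right)
    show "fun_scale c x \<in> {f. f * g \<in> cfun.span W}" if "x \<in> {f. f * g \<in> cfun.span W}" for c x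
    proof -
      have "fun_scale c x * g = fun_scale c (x * g)" by (simp add: fun_scale_def fun_eq_iff)
      thus ?thesis using that cfun.span_scale by simp
    qed
  qed
next
  case (step x)
  thus ?case by (rule assms(2))
qed

text \<open>
  Padding with zeros makes it possible to add two such decompositions termwise.
\<close>
lemma span_graded_sum:
  fixes V :: "nat \<Rightarrow> (complex \<Rightarrow> complex) set"
  assumes V: "\<And>k. cfun.subspace (V k)" and f: "f \<in> cfun.span (\<Union>k. V k)"
  shows "\<exists>n g. (\<forall>k. g k \<in> V k) \<and> (\<forall>k\<ge>n. g k = 0) \<and> f = (\<Sum>k<n. g k)"
  using f
proof (induction rule: cfun.span_induct)
  case base
  show ?case
  proof (rule cfun.subspaceI; clarify)
    show "\<exists>n g. (\<forall>k. g k \<in> V k) \<and> (\<forall>k\<ge>n. g k = 0) \<and> 0 = (\<Sum>k<n. g k)"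
      using cfun.subspace_0[OF V] by (intro exI[of _ 0] exI[of _ "\<lambda>_. 0"]) auto
  next
    fix n g n' g' assume g: "\<forall>k. g k \<in> V k" "\<forall>k\<ge>n::nat. g k = 0" and g': "\<forall>k. g' k \<in> V k" "\<forall>k\<ge>n'::nat. g' k = 0"
    have "(\<Sum>k<n. g k) = (\<Sum>k<max n n'. g k)" "(\<Sum>k<n'. g' k) = (\<Sum>k<max n n'. g' k)"
      using g g' by (auto intro!: sum.mono_neutral_left)
    hence "(\<Sum>k<n. g k) + (\<Sum>k<n'. g' k) = (\<Sum>k<max n n'. g k + g' k)" by (simp add: sum.distrib)
    thus "\<exists>m h. (\<forall>k. h k \<in> V k) \<and> (\<forall>k\<ge>m. h k = 0) \<and> (\<Sum>k<n. g k) + (\<Sum>k<n'. g' k) = (\<Sum>k<m. h k)"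
      using g g' cfun.subspace_add[OF V] by (intro exI[of _ "max n n'"] exI[of _ "\<lambda>k. g k + g' k"]) auto
  next
    fix c n g assume g: "\<forall>k. g k \<in> V k" "\<forall>k\<ge>n::nat. g k = 0"
    have "fun_scale c (\<Sum>k<n. g k) = (\<Sum>k<n. fun_scale c (g k))" by (rule cfun.scale_sum_right)
    thus "\<exists>m h. (\<forall>k. h k \<in> V k) \<and> (\<forall>k\<ge>m. h k = 0) \<and> fun_scale c (\<Sum>k<n. g k) = (\<Sum>k<m. h k)"
      using g cfun.subspace_scale[OF V] by (intro exI[of _ n] exI[of _ "\<lambda>k. fun_scale c (g k)"]) auto
  qed
next
  case (step x)
  then obtain j where j: "x \<in> V j" by blast
  have "x = (\<Sum>k<Suc j. if k = j then x else 0)" by simp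
  thus ?case using j cfun.subspace_0[OF V] by (intro exI[of _ "Suc j"] exI[of _ "\<lambda>k. if k = j then x else 0"]) auto
qed

lemma sum_fun_apply: "(\<Sum>k\<in>K. f k) x = (\<Sum>k\<in>K. f k x)"
  by (induction K rule: infinite_finite_induct) auto

text \<open>
  At the images of \<tau> under the matrices with lower row (8n, 1) the relation becomes a
  polynomial identity at r = sqrt(8n\<tau> + 1), with the values at \<tau> as coefficients.
  There are infinitely many such r.
\<close>
lemma forms_Gamma8_weights_independent:
  assumes K: "finite K" and f: "\<And>k. k \<in> K \<Longrightarrow> f k \<in> forms_Gamma8 k" and sum: "(\<Sum>k\<in>K. f k) = 0"
    and k: "k \<in> K"
  shows "f k = 0"
proof
  fix \<tau>
  show "f k \<tau> = 0 \<tau>"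
  proof (cases "Im \<tau> > 0")
    case False
    thus ?thesis using f[OF k] by (simp add: forms_Gamma8_def modular_forms_def upper_half_plane_def)
  next
    case \<tau>: True
    define p where "p = (\<Sum>j\<in>K. Polynomial.monom (f j \<tau>) j)"
    define r where "r = (\<lambda>n::nat. csqrt (of_nat (8 * n) * \<tau> + 1))"
    have root: "poly p (r n) = 0" for n
    proof -
      define A where "A = mat2 1 0 (8 * int n) 1"
      have A: "A \<in> Gamma_principal 8" by (simp add: A_def Gamma_principal_def SL2Z_iff cong_def)
      have kr: "kronecker (8 * int n) 1 = 1" by (simp add: kronecker_odd)
      have fA: "f j (moebius A \<tau>) = f j \<tau> * r n ^ j" if "j \<in> K" for j
      proof -
        have "slash j (f j) A \<tau> = f j \<tau>"
          using f[OF that] A \<tau> by (simp add: forms_Gamma8_def modular_forms_iff)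
        moreover have "weight_factor j A \<tau> = r n ^ j"
          by (simp add: weight_factor_def A_def kr r_def)
        moreover have "weight_factor j A \<tau> \<noteq> 0"
          using A \<tau> by (intro weight_factor_nonzero) (auto simp: Gamma_principal_def)
        ultimately show ?thesis by (simp add: slash_def divide_eq_eq)
      qed
      have "poly p (r n) = (\<Sum>j\<in>K. f j (moebius A \<tau>))"
        by (simp add: p_def poly_sum poly_monom fA)
      also have "\<dots> = (\<Sum>j\<in>K. f j) (moebius A \<tau>)" by (simp add: sum_fun_apply)
      finally show ?thesis using sum by simp
    qed
    have "inj r"
    proof (rule injI)
      fix m n assume "r m = r n"
      hence "r m ^ 2 = r n ^ 2" by simp
      hence "of_nat (8 * m) * \<tau> = of_nat (8 * n) * \<tau>" by (simp only: r_def power2_csqrt add_right_cancel)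
      moreover have "\<tau> \<noteq> 0" using \<tau> by auto
      ultimately have "(of_nat (8 * m) :: complex) = of_nat (8 * n)" by simp
      thus "m = n" by (simp only: of_nat_eq_iff)
    qed
    hence "infinite (range r)" by (rule range_inj_infinite)
    moreover have "range r \<subseteq> {z. poly p z = 0}" using root by auto
    ultimately have "infinite {z. poly p z = 0}" using finite_subset by auto
    hence "p = 0" using poly_roots_finite by blast
    moreover have "Polynomial.coeff p k = f k \<tau>"
      using K k by (simp add: p_def coeff_sum)
    ultimately show ?thesis by simp
  qed
qed

definition graded_forms :: "eta_kind set \<Rightarrow> (complex \<Rightarrow> complex) set" where
  "graded_forms S = cfun.span (\<Union>k. theta_forms S k)"

lemma graded_forms_mult_eta:
  assumes "f \<in> graded_forms S" shows "f * eta_fn x \<in> graded_forms (insert x S)"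
  using assms unfolding graded_forms_def
proof (rule span_mult)
  fix h assume "h \<in> (\<Union>k. theta_forms S k)"
  then obtain k where "h \<in> theta_forms S k" by blast
  from theta_forms_mult_eta[OF this] show "h * eta_fn x \<in> cfun.span (\<Union>k. theta_forms (insert x S) k)"
    by (intro cfun.span_base) blast
qed

lemma graded_forms_mono: "S \<subseteq> S' \<Longrightarrow> graded_forms S \<subseteq> graded_forms S'"
  unfolding graded_forms_def using theta_forms_antimono[of S S'] by (intro cfun.span_mono) blast

lemma graded_forms_split:
  assumes x: "x \<notin> S" and f: "f \<in> graded_forms (insert x S)"
  shows "\<exists>g\<in>graded_forms S. \<exists>h\<in>graded_forms S. f = g + h * eta_fn x"
proof -
  define W where "W = graded_forms S"
  have W: "cfun.subspace W" by (simp add: W_def graded_forms_def)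
  define Y where "Y = {g + h | g h. g \<in> W \<and> h \<in> (\<lambda>f. f * eta_fn x) ` W}"
  have "cfun.subspace Y" unfolding Y_def by (rule cfun.subspace_sums[OF W subspace_mult_image[OF W]])
  moreover have "(\<Union>k. theta_forms (insert x S) k) \<subseteq> Y"
  proof
    fix f assume "f \<in> (\<Union>k. theta_forms (insert x S) k)"
    then obtain k where "f \<in> theta_forms (insert x S) k" by blast
    from theta_forms_split[OF x this] obtain g h where g: "g \<in> theta_forms S k"
      and h: "if k = 0 then h = 0 else h \<in> theta_forms S (k - 1)" and fgh: "f = g + h * eta_fn x" by blast
    have "g \<in> W" unfolding W_def graded_forms_def using g by (intro cfun.span_base) blast
    moreover have "h \<in> W"
    proof (cases "k = 0")
      case True thus ?thesis using h cfun.subspace_0[OF W] by simp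
    next
      case False thus ?thesis unfolding W_def graded_forms_def using h by (intro cfun.span_base) auto
    qed
    ultimately show "f \<in> Y" unfolding Y_def using fgh by blast
  qed
  ultimately have "graded_forms (insert x S) \<subseteq> Y" unfolding graded_forms_def by (rule cfun.span_minimal[rotated])
  thus ?thesis using f unfolding Y_def W_def by blast
qed

text \<open>
  Within one weight, an element on which only the character of x is -1 changes the sign of the
  second summand and fixes the first.
\<close>
lemma graded_forms_independent:
  assumes x: "x \<notin> S" and g: "g \<in> graded_forms S" and h: "h \<in> graded_forms S"
    and sum: "g + h * eta_fn x = 0"
  shows "g = 0" "h = 0"
proof -
  obtain n a where a: "\<And>k. a k \<in> theta_forms S k" "\<And>k. k \<ge> n \<Longrightarrow> a k = 0" "g = (\<Sum>k<n. a k)"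
    using span_graded_sum[OF subspace_theta_forms g[unfolded graded_forms_def]] by blast
  obtain n' b where b: "\<And>k. b k \<in> theta_forms S k" "\<And>k. k \<ge> n' \<Longrightarrow> b k = 0" "h = (\<Sum>k<n'. b k)"
    using span_graded_sum[OF subspace_theta_forms h[unfolded graded_forms_def]] by blast
  define N where "N = Suc (max n n')"
  (* b' k is the coefficient of eta_fn x in total weight k / 2, hence the shift of b by one *)
  define b' where "b' = (\<lambda>k. if k = 0 then 0 else b (k - 1))"
  have gN: "g = (\<Sum>k<N. a k)" unfolding a(3) N_def using a(2) by (intro sum.mono_neutral_left) auto
  have "h = (\<Sum>k<max n n'. b k)" unfolding b(3) using b(2) by (intro sum.mono_neutral_left) auto
  also have "\<dots> = (\<Sum>k<N. b' k)" unfolding N_def by (subst sum.lessThan_Suc_shift) (simp add: b'_def)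
  finally have hN: "h = (\<Sum>k<N. b' k)" .
  have b'eta: "b' k * eta_fn x \<in> theta_forms (insert x S) k" for k
  proof (cases k)
    case 0
    thus ?thesis using cfun.subspace_0[OF subspace_theta_forms] by (simp add: b'_def)
  next
    case (Suc j)
    thus ?thesis using theta_forms_mult_eta[OF b(1)[of j], of x] by (simp add: b'_def)
  qed
  have mem: "a k + b' k * eta_fn x \<in> forms_Gamma8 k" for k
    unfolding forms_Gamma8_eq
    using a(1)[of k] b'eta[of k] theta_forms_antimono[of S UNIV k] theta_forms_antimono[of "insert x S" UNIV k]
    by (intro cfun.subspace_add[OF subspace_theta_forms]) auto
  have sum0: "(\<Sum>k<N. a k + b' k * eta_fn x) = 0"
    using sum by (simp add: sum.distrib gN hN sum_distrib_right)
  have zero: "a k + b' k * eta_fn x = 0" if "k < N" for k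
  proof (rule forms_Gamma8_weights_independent[where K = "{..<N}" and f = "\<lambda>k. a k + b' k * eta_fn x"])
    show "k \<in> {..<N}" using that by simp
  qed (rule finite_lessThan mem sum0)+
  have b'form: "b' k = 0 \<or> (\<exists>j. k = Suc j \<and> b' k \<in> theta_forms S j)" for k
    using b(1) by (cases k) (auto simp: b'_def)
  define G where "G = eta_gen x"
  have G: "G \<in> Gamma4" "G \<in> SL2Z" "G \<in> char_group S" "eta_char x G = -1"
    using eta_gen_Gamma4[of x] Gamma4_SL2Z x by (auto simp: G_def char_group_def eta_char_gen)
  have both: "a k = 0 \<and> b' k = 0" if k: "k < N" for k
    using b'form[of k]
  proof
    assume "b' k = 0"
    thus ?thesis using zero[OF k] by simp
  next
    assume "\<exists>j. k = Suc j \<and> b' k \<in> theta_forms S j"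
    then obtain j where j: "k = Suc j" "b' k \<in> theta_forms S j" by blast
    have zp: "a k \<tau> + b' k \<tau> * eta_fn x \<tau> = 0" for \<tau> using fun_cong[OF zero[OF k], of \<tau>] by simp
    have "b' k \<tau> = 0" for \<tau>
    proof (cases "Im \<tau> > 0")
      case False
      thus ?thesis using j(2) by (simp add: theta_forms_def admissible_def)
    next
      case \<tau>: True
      have n: "normalized k (a k) \<sigma> + normalized j (b' k) \<sigma> * (eta_fn x \<sigma> / theta \<sigma>) = 0" for \<sigma>
      proof -
        have "normalized k (a k) \<sigma> + normalized j (b' k) \<sigma> * (eta_fn x \<sigma> / theta \<sigma>) =
              (a k \<sigma> + b' k \<sigma> * eta_fn x \<sigma>) / theta \<sigma> ^ k"
          by (simp add: normalized_def j(1) add_divide_distrib mult.commute)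
        thus ?thesis by (simp only: zp div_0)
      qed
      have "normalized k (a k) (moebius G \<tau>) = normalized k (a k) \<tau>"
        "normalized j (b' k) (moebius G \<tau>) = normalized j (b' k) \<tau>"
        using a(1)[of k] j(2) G(3) \<tau> by (simp_all add: theta_forms_def)
      hence "normalized k (a k) \<tau> - normalized j (b' k) \<tau> * (eta_fn x \<tau> / theta \<tau>) = 0"
        using n[of "moebius G \<tau>"] eta_over_theta_char[OF G(1) \<tau>, of x] by (simp add: G(4))
      hence "normalized j (b' k) \<tau> * (eta_fn x \<tau> / theta \<tau>) = 0"
        using n[of \<tau>] by (auto simp: eq_neg_iff_add_eq_0[symmetric])
      thus ?thesis using theta_nonzero[OF \<tau>] eta_fn_nonzero[OF \<tau>] by (simp add: normalized_def)
    qed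
    hence "b' k = 0" by (simp add: fun_eq_iff)
    thus ?thesis using zero[OF k] by simp
  qed
  show "g = 0" unfolding gN using both by simp
  show "h = 0" unfolding hN using both by simp
qed

section \<open>Characters modulo eight\<close>

definition Gamma8_diag :: "(int^2^2) set" where
  "Gamma8_diag = Gamma\<^sub>0 8 \<inter> Gamma\<^sup>0 8"

lemma Gamma8_diag_iff: "A \<in> Gamma8_diag \<longleftrightarrow> A \<in> SL2Z \<and> 8 dvd A $ 2 $ 1 \<and> 8 dvd A $ 1 $ 2"
  by (auto simp: Gamma8_diag_def Gamma_lower_def Gamma_upper_def)

lemma Gamma8_diag_Gamma4: "A \<in> Gamma8_diag \<Longrightarrow> A \<in> Gamma4"
  unfolding Gamma8_diag_iff Gamma4_iff by (auto elim!: dvd_trans[rotated])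

lemma sgn8_cong: "a mod 8 = b mod 8 \<Longrightarrow> sgn8 a = sgn8 b"
  by (simp add: sgn8_def)

text \<open>
  On this group the three characters coincide, since b and c vanish and a, d are inverse to each
  other modulo 8.
\<close>
lemma eta_char_Gamma8_diag:
  assumes "A \<in> Gamma8_diag"
  shows "eta_char x A = sgn8 (A $ 2 $ 2)"
proof -
  define a b c d where "a = A $ 1 $ 1" and "b = A $ 1 $ 2" and "c = A $ 2 $ 1" and "d = A $ 2 $ 2"
  have A: "a * d - b * c = 1" "8 dvd c" "8 dvd b" using assms
    by (simp_all add: Gamma8_diag_iff SL2Z_iff a_def b_def c_def d_def)
  have odd: "odd a" "odd d" using Gamma4_odd[OF Gamma8_diag_Gamma4[OF assms]] by (simp_all add: a_def d_def)
  have "8 dvd b * c" using A(3) by simp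
  moreover have "a * d = b * c + 1" using A(1) by simp
  ultimately have "(a * d) mod 8 = 1 mod 8" by auto
  hence "sgn8 (a * d) = sgn8 1" by (rule sgn8_cong)
  hence "sgn8 a * sgn8 d = 1" using sgn8_mult[OF odd] by (simp add: sgn8_def[of 1])
  hence ad: "sgn8 a = sgn8 d" using sgn8_odd_sq[OF odd(2)] by (auto simp: zmult_eq_1_iff)
  have "sgn8 (d - c) = sgn8 d" using A(2) by (intro sgn8_cong) presburger
  moreover have "sgn8 (a + b) = sgn8 a" using A(3) by (intro sgn8_cong) presburger
  ultimately show ?thesis using ad by (cases x) (simp_all add: a_def b_def c_def d_def)
qed

lemma chi8_eq: "chi8 d = of_int (sgn8 d)"
  by (simp add: chi8_def sgn8_def)

text \<open>
  The character xi8^k chi8^j differs from the k-th power of the theta multiplier by the sign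
  chi8^(k+j).
\<close>
lemma forms8_iff:
  "f \<in> forms8 k j \<longleftrightarrow> admissible k f \<and> (\<forall>A\<in>Gamma8_diag. \<forall>\<tau>. Im \<tau> > 0 \<longrightarrow>
     normalized k f (moebius A \<tau>) = of_int (sgn8 (A $ 2 $ 2)) ^ (k + j) * normalized k f \<tau>)"
proof -
  have "(slash k f A \<tau> = xi8 (A $ 2 $ 2) ^ k * chi8 (A $ 2 $ 2) ^ j * f \<tau>) \<longleftrightarrow>
     (normalized k f (moebius A \<tau>) = of_int (sgn8 (A $ 2 $ 2)) ^ (k + j) * normalized k f \<tau>)"
    if A: "A \<in> Gamma8_diag" and \<tau>: "Im \<tau> > 0" for A \<tau>
  proof -
    define d where "d = A $ 2 $ 2"
    have "sgn8 d * sgn8 d = 1" using Gamma4_odd(2)[OF Gamma8_diag_Gamma4[OF A]] by (simp add: d_def sgn8_odd_sq)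
    hence "chi8 d * chi8 d = 1" unfolding chi8_eq by (metis of_int_1 of_int_mult)
    hence "(chi8 d * chi8 d) ^ k = 1" by simp
    hence "theta_mult d ^ k * chi8 d ^ (k + j) = xi8 d ^ k * chi8 d ^ j"
      by (simp add: theta_mult_def power_mult_distrib power_add mult.assoc mult.left_commute[of "chi8 d ^ j"])
    thus ?thesis using slash_eq_iff_normalized[OF Gamma8_diag_Gamma4[OF A] \<tau>, of k f "chi8 d ^ (k + j)"]
      by (simp add: d_def chi8_eq)
  qed
  thus ?thesis unfolding forms8_def modular_forms_iff Gamma8_diag_def by blast
qed

lemma Gamma8_diag_char_group:
  assumes "A \<in> Gamma8_diag" "sgn8 (A $ 2 $ 2) = 1" shows "A \<in> char_group UNIV"
  using assms Gamma8_diag_Gamma4 eta_char_Gamma8_diag by (simp add: char_group_def)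

lemma forms8_subset: "forms8 k j \<subseteq> forms_Gamma8 k"
proof
  fix f assume f: "f \<in> forms8 k j"
  have "slash k f A \<tau> = f \<tau>" if A: "A \<in> Gamma_principal 8" and \<tau>: "Im \<tau> > 0" for A \<tau>
  proof -
    have G: "A \<in> Gamma8_diag" using A by (simp add: Gamma_principal_def Gamma8_diag_iff cong_0_iff)
    have "sgn8 (A $ 2 $ 2) = 1"
      using Gamma8_subset(1)[OF A, of UNIV] eta_char.simps(1)[of A] by (simp add: char_group_def del: eta_char.simps)
    hence "normalized k f (moebius A \<tau>) = 1 * normalized k f \<tau>" using f G \<tau> by (simp add: forms8_iff)
    hence "slash k f A \<tau> = theta_mult (A $ 2 $ 2) ^ k * 1 * f \<tau>"
      using slash_eq_iff_normalized[OF Gamma8_diag_Gamma4[OF G] \<tau>, of k f 1] by simp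
    thus ?thesis using Gamma8_subset(2)[OF A] by simp
  qed
  thus "f \<in> forms_Gamma8 k" using f by (simp add: forms_Gamma8_def modular_forms_iff forms8_iff)
qed

text \<open>
  It represents the nontrivial coset of \<plusminus>Gamma(8) in Gamma_0(8) \<inter> Gamma^0(8).
\<close>
definition odd_generator :: "int^2^2" where "odd_generator = mat2 43 8 16 3"

lemma odd_generator: "odd_generator \<in> Gamma8_diag" "odd_generator \<in> Gamma4" "odd_generator \<in> SL2Z" "sgn8 (odd_generator $ 2 $ 2) = -1" "eta_char x odd_generator = -1"
proof -
  show *: "odd_generator \<in> Gamma8_diag" by (simp add: odd_generator_def Gamma8_diag_iff SL2Z_iff)
  show "odd_generator \<in> Gamma4" "odd_generator \<in> SL2Z" using Gamma8_diag_Gamma4[OF *] Gamma4_SL2Z by blast+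
  show **: "sgn8 (odd_generator $ 2 $ 2) = -1" by (simp add: odd_generator_def sgn8_def)
  show "eta_char x odd_generator = -1" using eta_char_Gamma8_diag[OF *] ** by simp
qed

text \<open>
  The even and odd parts under the nontrivial coset of \<plusminus>Gamma(8). Even means that the
  exponent k + j of chi8 is even, hence the parities of the two indices.
\<close>
lemma forms_Gamma8_split:
  assumes f: "f \<in> forms_Gamma8 k"
  shows "\<exists>g\<in>forms8 k (k mod 2). \<exists>m\<in>forms8 k ((k + 1) mod 2). f = g + m"
proof -
  have f': "f \<in> theta_forms UNIV k" using f by (simp add: forms_Gamma8_eq)
  have adm: "admissible k f" using f' by (simp add: theta_forms_def)
  have inv: "normalized k f (moebius D \<tau>) = normalized k f \<tau>" if "D \<in> char_group UNIV" "Im \<tau> > 0" for D \<tau>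
    using f' that by (simp add: theta_forms_def)
  note si = SL2Z_inv_mult(3)[OF odd_generator(3)]
  have sgn: "sgn8 (D $ 2 $ 2) = 1 \<or> sgn8 (D $ 2 $ 2) = -1" if "D \<in> Gamma8_diag" for D
    using eta_char_cases[OF Gamma8_diag_Gamma4[OF that], of Natural] by simp
  have char: "D ** E \<in> char_group UNIV" if "D \<in> Gamma4" "E \<in> Gamma4" "\<And>x. eta_char x D * eta_char x E = 1" for D E
    using that by (simp add: char_group_def Gamma4_mult eta_char_mult)
  have 1: "normalized k f (moebius D \<tau>) = (if sgn8 (D $ 2 $ 2) = 1 then normalized k f \<tau> else normalized k f (moebius odd_generator \<tau>))"
    if D: "D \<in> Gamma8_diag" and \<tau>: "Im \<tau> > 0" for D \<tau>
  proof (cases "sgn8 (D $ 2 $ 2) = 1")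
    case True
    thus ?thesis using inv[OF Gamma8_diag_char_group[OF D True] \<tau>] by simp
  next
    case False
    hence m: "sgn8 (D $ 2 $ 2) = -1" using sgn[OF D] by simp
    have "D ** SL2Z_inv odd_generator \<in> char_group UNIV"
      using m by (intro char Gamma8_diag_Gamma4 D Gamma4_sinv odd_generator)
        (simp add: eta_char_sinv[OF odd_generator(2)] odd_generator eta_char_Gamma8_diag[OF D])
    from inv[OF this SL2Z_moebius(1)[OF odd_generator(3) \<tau>]]
    have "normalized k f (moebius (D ** SL2Z_inv odd_generator ** odd_generator) \<tau>) = normalized k f (moebius odd_generator \<tau>)"
      by (simp add: moebius_mult(1)[OF odd_generator(3) \<tau>])
    thus ?thesis using False by (simp add: si)
  qed
  have 2: "normalized k f (moebius odd_generator (moebius D \<tau>)) = (if sgn8 (D $ 2 $ 2) = 1 then normalized k f (moebius odd_generator \<tau>) else normalized k f \<tau>)"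
    if D: "D \<in> Gamma8_diag" and \<tau>: "Im \<tau> > 0" for D \<tau>
  proof -
    have DG: "D \<in> Gamma4" "D \<in> SL2Z" using Gamma8_diag_Gamma4[OF D] Gamma4_SL2Z by blast+
    have eq: "moebius odd_generator (moebius D \<tau>) = moebius (odd_generator ** D) \<tau>"
      by (rule moebius_mult(1)[OF DG(2) \<tau>, symmetric])
    show ?thesis
    proof (cases "sgn8 (D $ 2 $ 2) = 1")
      case False
      hence m: "sgn8 (D $ 2 $ 2) = -1" using sgn[OF D] by simp
      have "odd_generator ** D \<in> char_group UNIV"
        using m by (intro char DG odd_generator) (simp add: odd_generator eta_char_Gamma8_diag[OF D])
      from inv[OF this \<tau>] show ?thesis using False eq by simp
    next
      case True
      have "odd_generator ** D ** SL2Z_inv odd_generator \<in> char_group UNIV"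
        using True by (intro char DG Gamma4_mult Gamma4_sinv odd_generator)
          (simp add: eta_char_sinv[OF odd_generator(2)] odd_generator eta_char_Gamma8_diag[OF D] eta_char_mult[OF odd_generator(2) DG(1)])
      from inv[OF this SL2Z_moebius(1)[OF odd_generator(3) \<tau>]]
      have "normalized k f (moebius (odd_generator ** D ** SL2Z_inv odd_generator ** odd_generator) \<tau>) = normalized k f (moebius odd_generator \<tau>)"
        by (simp add: moebius_mult(1)[OF odd_generator(3) \<tau>])
      thus ?thesis using True eq by (simp add: si)
    qed
  qed
  have L: "Gamma8_diag \<subseteq> SL2Z" by (auto simp: Gamma8_diag_iff)
  obtain g m where gm: "f = g + m" "admissible k g" "admissible k m"
    "\<And>D \<tau>. D \<in> Gamma8_diag \<Longrightarrow> Im \<tau> > 0 \<Longrightarrow> normalized k g (moebius D \<tau>) = normalized k g \<tau>"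
    "\<And>D \<tau>. D \<in> Gamma8_diag \<Longrightarrow> Im \<tau> > 0 \<Longrightarrow> normalized k m (moebius D \<tau>) = of_int (sgn8 (D $ 2 $ 2)) * normalized k m \<tau>"
    using eigen_split[OF adm odd_generator(2) sgn L 1 2] by blast
  have pw: "(of_int (sgn8 (D $ 2 $ 2)) :: complex) ^ n = (if even n then 1 else of_int (sgn8 (D $ 2 $ 2)))"
    if "D \<in> Gamma8_diag" for D n
    using sgn[OF that] by auto
  have "g \<in> forms8 k (k mod 2)"
    using gm(2,4) by (simp add: forms8_iff pw)
  moreover have "m \<in> forms8 k ((k + 1) mod 2)"
  proof -
    have "odd (k + (k + 1) mod 2)" by presburger
    thus ?thesis using gm(3,5) by (simp add: forms8_iff pw)
  qed
  ultimately show ?thesis using gm(1) by blast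
qed

lemma forms8_independent:
  assumes f0: "f0 \<in> forms8 k 0" and f1: "f1 \<in> forms8 k 1" and sum: "f0 + f1 = 0"
  shows "f0 = 0 \<and> f1 = 0"
proof -
  have s: "f0 \<tau> + f1 \<tau> = 0" for \<tau> using fun_cong[OF sum, of \<tau>] by simp
  have "f0 \<tau> = 0" for \<tau>
  proof (cases "Im \<tau> > 0")
    case False
    thus ?thesis using f0 by (simp add: forms8_iff admissible_def)
  next
    case \<tau>: True
    have n: "normalized k f0 \<sigma> = - normalized k f1 \<sigma>" for \<sigma>
      using s[of \<sigma>] by (simp add: normalized_def eq_neg_iff_add_eq_0 add_divide_distrib[symmetric])
    have "normalized k f0 (moebius odd_generator \<tau>) = (-1) ^ k * normalized k f0 \<tau>"
      "normalized k f1 (moebius odd_generator \<tau>) = - ((-1) ^ k) * normalized k f1 \<tau>"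
      using f0 f1 \<tau> odd_generator(1,4) by (auto simp: forms8_iff)
    hence "(-1) ^ k * normalized k f0 \<tau> = (-1) ^ k * normalized k f1 \<tau>" using n[of "moebius odd_generator \<tau>"] by simp
    hence "normalized k f0 \<tau> = normalized k f1 \<tau>" by simp
    hence "normalized k f0 \<tau> = 0" using n[of \<tau>] by simp
    thus ?thesis using theta_nonzero[OF \<tau>] by (simp add: normalized_def)
  qed
  hence "f0 = 0" by (simp add: fun_eq_iff)
  thus ?thesis using sum by simp
qed

lemma subspace_forms8: "cfun.subspace (forms8 k j)"
  unfolding forms8_def by (rule subspace_modular_forms)

lemma subspace_forms_Gamma8: "cfun.subspace (forms_Gamma8 k)"
  unfolding forms_Gamma8_def by (rule subspace_modular_forms)

lemma forms_Gamma8_span: "forms_Gamma8 k = cfun.span (\<Union>j\<in>{0, 1}. forms8 k j)"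
proof
  show "cfun.span (\<Union>j\<in>{0, 1}. forms8 k j) \<subseteq> forms_Gamma8 k"
    by (rule cfun.span_minimal[OF _ subspace_forms_Gamma8]) (use forms8_subset in blast)
  show "forms_Gamma8 k \<subseteq> cfun.span (\<Union>j\<in>{0, 1}. forms8 k j)"
  proof
    fix f assume "f \<in> forms_Gamma8 k"
    from forms_Gamma8_split[OF this] obtain g m where gm: "g \<in> forms8 k (k mod 2)" "m \<in> forms8 k ((k + 1) mod 2)" "f = g + m" by blast
    have "i mod 2 \<in> {0, 1}" for i :: nat by auto
    hence "g \<in> (\<Union>j\<in>{0, 1}. forms8 k j)" "m \<in> (\<Union>j\<in>{0, 1}. forms8 k j)"
      using gm(1,2) by blast+
    thus "f \<in> cfun.span (\<Union>j\<in>{0, 1}. forms8 k j)"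
      unfolding gm(3) by (intro cfun.span_add cfun.span_base)
  qed
qed

lemma weight_direct_sum:
  assumes "\<And>k. cfun.subspace (V k)" "\<And>k. V k \<subseteq> forms_Gamma8 k" "W = cfun.span (\<Union>k. V k)"
  shows "internal_direct_sum UNIV V W"
  unfolding internal_direct_sum_def
proof (intro conjI ballI allI impI assms(1))
  fix K f k assume "finite K \<and> K \<subseteq> UNIV \<and> (\<forall>i\<in>K. f i \<in> V i) \<and> (\<Sum>i\<in>K. f i) = 0" "k \<in> K"
  thus "f k = 0" using assms(2) by (intro forms_Gamma8_weights_independent[of K f k]) blast+
qed (use assms(3) in simp)

lemma forms8_direct_sum: "internal_direct_sum {0, 1} (forms8 k) (forms_Gamma8 k)"
  unfolding internal_direct_sum_def
proof (intro conjI ballI allI impI subspace_forms8)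
  show "forms_Gamma8 k = cfun.span (\<Union>j\<in>{0, 1}. forms8 k j)" by (rule forms_Gamma8_span)
  fix K f j assume K: "finite K \<and> K \<subseteq> {0, 1} \<and> (\<forall>i\<in>K. f i \<in> forms8 k i) \<and> (\<Sum>i\<in>K. f i) = 0" and j: "j \<in> K"
  define F where "F = (\<lambda>i. if i \<in> K then f i else 0)"
  have F: "F i \<in> forms8 k i" for i using K cfun.subspace_0[OF subspace_forms8] by (simp add: F_def)
  have "(\<Sum>i\<in>K. f i) = (\<Sum>i\<in>K. F i)" by (intro sum.cong) (auto simp: F_def)
  also have "\<dots> = (\<Sum>i\<in>{0, 1}. F i)" using K by (intro sum.mono_neutral_left) (auto simp: F_def)
  also have "\<dots> = F 0 + F 1" by simp
  finally have "F 0 = 0 \<and> F 1 = 0" using K forms8_independent[OF F F] by simp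
  hence "F j = 0" using K j by auto
  thus "f j = 0" using j by (simp add: F_def)
qed

lemma forms8_weight_direct_sum:
  "internal_direct_sum (UNIV \<times> {0, 1}) (\<lambda>(k, j). forms8 k j) all_forms8"
  unfolding internal_direct_sum_def
proof (intro conjI ballI allI impI)
  show "cfun.subspace (case i of (k, j) \<Rightarrow> forms8 k j)" for i by (cases i) (simp add: subspace_forms8)
  have "(\<Union>k. \<Union>j\<in>{0, 1}. forms8 k j) = (\<Union>i\<in>UNIV \<times> {0, 1}. case i of (k, j) \<Rightarrow> forms8 k j)" by auto
  thus "all_forms8 = cfun.span (\<Union>i\<in>UNIV \<times> {0, 1}. case i of (k, j) \<Rightarrow> forms8 k j)"
    by (simp only: all_forms8_def)
  fix K :: "(nat \<times> nat) set" and f i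
  assume K: "finite K \<and> K \<subseteq> UNIV \<times> {0, 1} \<and> (\<forall>i\<in>K. f i \<in> (case i of (k, j) \<Rightarrow> forms8 k j)) \<and> (\<Sum>i\<in>K. f i) = 0"
    and i: "i \<in> K"
  define F where "F = (\<lambda>i. if i \<in> K then f i else 0)"
  define N where "N = fst ` K"
  have F: "F (k, j) \<in> forms8 k j" for k j using K cfun.subspace_0[OF subspace_forms8] by (auto simp: F_def)
  have "(\<Sum>i\<in>K. f i) = (\<Sum>i\<in>K. F i)" by (intro sum.cong) (auto simp: F_def)
  also have "\<dots> = (\<Sum>i\<in>N \<times> {0, 1}. F i)"
  proof (intro sum.mono_neutral_left)
    show "finite (N \<times> {0, 1})" using K by (simp add: N_def)
    show "K \<subseteq> N \<times> {0, 1}" using K by (force simp: N_def)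
  qed (auto simp: F_def)
  also have "\<dots> = (\<Sum>k\<in>N. \<Sum>j\<in>{0, 1}. F (k, j))" by (rule sum.cartesian_product')
  also have "\<dots> = (\<Sum>k\<in>N. F (k, 0) + F (k, 1))" by simp
  finally have z: "(\<Sum>k\<in>N. F (k, 0) + F (k, 1)) = 0" using K by simp
  obtain k j where kj: "i = (k, j)" "k \<in> N" "j = 0 \<or> j = 1" using K i by (force simp: N_def)
  have "F (k, 0) + F (k, 1) \<in> forms_Gamma8 k" for k
    using F forms8_subset by (intro cfun.subspace_add[OF subspace_forms_Gamma8]) blast+
  hence "F (k, 0) + F (k, 1) = 0"
    using K z kj(2) by (intro forms_Gamma8_weights_independent[of N "\<lambda>k. F (k, 0) + F (k, 1)" k]) (auto simp: N_def)
  from forms8_independent[OF F F this] have "F i = 0" using kj by auto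
  thus "f i = 0" using i by (simp add: F_def)
qed

lemma all_forms_Gamma8_graded: "all_forms_Gamma8 = graded_forms UNIV"
  by (simp add: all_forms_Gamma8_def graded_forms_def forms_Gamma8_eq)

lemma all_forms4_w2_graded: "all_forms4_w2 = graded_forms {}"
  by (simp add: all_forms4_w2_def graded_forms_def forms4_w2_eq)

lemma all_forms_eq: "all_forms_Gamma8 = all_forms8"
proof
  show "all_forms8 \<subseteq> all_forms_Gamma8"
    unfolding all_forms8_def all_forms_Gamma8_def using forms8_subset by (intro cfun.span_mono) blast
  show "all_forms_Gamma8 \<subseteq> all_forms8"
    unfolding all_forms_Gamma8_def
  proof (rule cfun.span_minimal)
    show "cfun.subspace all_forms8" by (simp add: all_forms8_def)
    show "(\<Union>k. forms_Gamma8 k) \<subseteq> all_forms8"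
      unfolding forms_Gamma8_span all_forms8_def by (intro UN_least cfun.span_mono) blast
  qed
qed

lemma subspace_graded_forms: "cfun.subspace (graded_forms S)"
  by (simp add: graded_forms_def)

text \<open>
  Each summand is reached by splitting off the three eta quotients one after the other, and the
  same order of steps proves independence.
\<close>
theorem eta_direct_sum:
  "internal_direct_sum ({0, 1} \<times> {0, 1} \<times> {0, 1})
     (\<lambda>(a :: nat, b :: nat, c :: nat).
        (\<lambda>f. f * eta_natural ^ a * eta_flat ^ b * eta_sharp ^ c) ` graded_forms {})
     (graded_forms UNIV)"
  (is "internal_direct_sum ?I ?V ?W")
  unfolding internal_direct_sum_def
proof (intro conjI ballI allI impI)
  have sub: "cfun.subspace (?V i)" for i
  proof -
    obtain a b c where i: "i = (a, b, c)" by (cases i) auto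
    have "?V i = (\<lambda>f. f * (eta_natural ^ a * eta_flat ^ b * eta_sharp ^ c)) ` graded_forms {}"
      by (simp add: i mult.assoc)
    thus ?thesis using subspace_mult_image[OF subspace_graded_forms] by simp
  qed
  show "cfun.subspace (?V i)" for i by (rule sub)
  show "?W = cfun.span (\<Union>i\<in>?I. ?V i)"
  proof
    have pw: "f * eta_fn x ^ a \<in> graded_forms (insert x S)"
      if "f \<in> graded_forms S" "a = 0 \<or> a = 1" for f x S and a :: nat
      using that graded_forms_mult_eta[OF that(1), of x] graded_forms_mono[OF subset_insertI[of S x]] by auto
    have V: "?V (a, b, c) \<subseteq> ?W" if "a = 0 \<or> a = 1" "b = 0 \<or> b = 1" "c = 0 \<or> c = 1" for a b c
    proof
      fix f assume "f \<in> ?V (a, b, c)"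
      then obtain g where g: "g \<in> graded_forms {}" "f = g * eta_fn Natural ^ a * eta_fn Flat ^ b * eta_fn Sharp ^ c" by auto
      have "f \<in> graded_forms (insert Sharp (insert Flat (insert Natural {})))"
        unfolding g(2) by (intro pw g(1) that)
      thus "f \<in> ?W" using graded_forms_mono by blast
    qed
    have "(\<Union>i\<in>?I. ?V i) \<subseteq> ?W"
    proof (rule UN_least)
      fix i :: "nat \<times> nat \<times> nat" assume i: "i \<in> ?I"
      obtain a b c where abc: "i = (a, b, c)" by (cases i) auto
      have "a = 0 \<or> a = 1" "b = 0 \<or> b = 1" "c = 0 \<or> c = 1" using i unfolding abc by auto
      from V[OF this] show "?V i \<subseteq> ?W" unfolding abc .
    qed
    thus "cfun.span (\<Union>i\<in>?I. ?V i) \<subseteq> ?W" by (rule cfun.span_minimal[OF _ subspace_graded_forms])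
    show "?W \<subseteq> cfun.span (\<Union>i\<in>?I. ?V i)"
    proof
      fix f assume "f \<in> ?W"
      hence f: "f \<in> graded_forms (insert Natural (insert Flat (insert Sharp {})))" by (simp add: eta_kind_UNIV)
      obtain f0 f1 where 1: "f0 \<in> graded_forms (insert Flat (insert Sharp {}))" "f1 \<in> graded_forms (insert Flat (insert Sharp {}))"
        "f = f0 + f1 * eta_natural" using graded_forms_split[OF _ f] by auto
      obtain f00 f01 where 2: "f00 \<in> graded_forms (insert Sharp {})" "f01 \<in> graded_forms (insert Sharp {})"
        "f0 = f00 + f01 * eta_flat" using graded_forms_split[OF _ 1(1)] by auto
      obtain f10 f11 where 3: "f10 \<in> graded_forms (insert Sharp {})" "f11 \<in> graded_forms (insert Sharp {})"
        "f1 = f10 + f11 * eta_flat" using graded_forms_split[OF _ 1(2)] by auto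
      have last: "\<exists>g\<in>graded_forms {}. \<exists>h\<in>graded_forms {}. u = g + h * eta_sharp" if "u \<in> graded_forms (insert Sharp {})" for u
        using graded_forms_split[OF _ that] by auto
      have V: "g * eta_natural ^ a * eta_flat ^ b * eta_sharp ^ c \<in> cfun.span (\<Union>i\<in>?I. ?V i)"
        if "g \<in> graded_forms {}" "a \<in> {0, 1}" "b \<in> {0, 1}" "c \<in> {0, 1}" for g and a b c :: nat
        using that by (intro cfun.span_base UN_I[of "(a, b, c)"]) auto
      have part: "u * eta_natural ^ a * eta_flat ^ b \<in> cfun.span (\<Union>i\<in>?I. ?V i)"
        if u: "u \<in> graded_forms (insert Sharp {})" and ab: "a \<in> {0, 1}" "b \<in> {0, 1}" for u and a b :: nat
      proof -
        obtain g h where gh: "g \<in> graded_forms {}" "h \<in> graded_forms {}" "u = g + h * eta_sharp" using last[OF u] by blast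
        have "u * eta_natural ^ a * eta_flat ^ b = g * eta_natural ^ a * eta_flat ^ b * eta_sharp ^ 0 + h * eta_natural ^ a * eta_flat ^ b * eta_sharp ^ 1"
          unfolding gh(3) by (simp add: algebra_simps)
        thus ?thesis using cfun.span_add[OF V[OF gh(1) ab, of 0] V[OF gh(2) ab, of 1]] by simp
      qed
      have "f = (f00 * eta_natural ^ 0 * eta_flat ^ 0 + f01 * eta_natural ^ 0 * eta_flat ^ 1) +
                (f10 * eta_natural ^ 1 * eta_flat ^ 0 + f11 * eta_natural ^ 1 * eta_flat ^ 1)"
        unfolding 1(3) 2(3) 3(3) by (simp add: algebra_simps)
      also have "\<dots> \<in> cfun.span (\<Union>i\<in>?I. ?V i)"
        by (intro cfun.span_add part 2(1,2) 3(1,2)) auto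
      finally show "f \<in> cfun.span (\<Union>i\<in>?I. ?V i)" .
    qed
  qed
  fix K :: "(nat \<times> nat \<times> nat) set" and f i
  assume K: "finite K \<and> K \<subseteq> ?I \<and> (\<forall>i\<in>K. f i \<in> ?V i) \<and> (\<Sum>i\<in>K. f i) = 0" and i: "i \<in> K"
  define F where "F = (\<lambda>i. if i \<in> K then f i else 0)"
  have "F i \<in> ?V i" for i using K cfun.subspace_0[OF sub, of i] by (auto simp: F_def)
  hence "\<exists>g\<in>graded_forms {}. F (a, b, c) = g * eta_natural ^ a * eta_flat ^ b * eta_sharp ^ c" for a b c
    by (force dest: spec[of _ "(a, b, c)"])
  then obtain g where g: "\<And>a b c. g a b c \<in> graded_forms {}"
    "\<And>a b c. F (a, b, c) = g a b c * eta_natural ^ a * eta_flat ^ b * eta_sharp ^ c" by metis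
  have "(\<Sum>i\<in>K. f i) = (\<Sum>i\<in>K. F i)" by (intro sum.cong) (auto simp: F_def)
  also have "\<dots> = (\<Sum>i\<in>?I. F i)" using K by (intro sum.mono_neutral_left) (auto simp: F_def)
  also have "\<dots> = (\<Sum>a\<in>{0, 1}. \<Sum>b\<in>{0, 1}. \<Sum>c\<in>{0, 1}. F (a, b, c))"
    by (simp only: sum.cartesian_product')
  also have "\<dots> = ((g 0 0 0 + g 0 0 1 * eta_fn Sharp) + (g 0 1 0 + g 0 1 1 * eta_fn Sharp) * eta_fn Flat) +
     ((g 1 0 0 + g 1 0 1 * eta_fn Sharp) + (g 1 1 0 + g 1 1 1 * eta_fn Sharp) * eta_fn Flat) * eta_fn Natural"
    by (simp add: g(2) algebra_simps)
  finally have z: "((g 0 0 0 + g 0 0 1 * eta_fn Sharp) + (g 0 1 0 + g 0 1 1 * eta_fn Sharp) * eta_fn Flat) +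
     ((g 1 0 0 + g 1 0 1 * eta_fn Sharp) + (g 1 1 0 + g 1 1 1 * eta_fn Sharp) * eta_fn Flat) * eta_fn Natural = 0"
    using K by simp
  have m1: "u + v * eta_fn x \<in> graded_forms (insert x S)" if "u \<in> graded_forms S" "v \<in> graded_forms S" for u v x S
    using that graded_forms_mult_eta[OF that(2), of x] graded_forms_mono[of S "insert x S"]
    by (intro cfun.subspace_add[OF subspace_graded_forms]) auto
  have n1: "Sharp \<notin> {}" and n2: "Flat \<notin> {Sharp}" and n3: "Natural \<notin> {Flat, Sharp}" by auto
  note mem1 = m1[OF g(1) g(1), where x = Sharp]
  note mem2 = m1[OF mem1 mem1, where x = Flat]
  note i3 = graded_forms_independent[OF n3 mem2 mem2 z]
  note i2 = graded_forms_independent[OF n2 mem1 mem1 i3(1)] graded_forms_independent[OF n2 mem1 mem1 i3(2)]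
  have all: "g a b c = 0" if "a \<in> {0, 1}" "b \<in> {0, 1}" "c \<in> {0, 1}" for a b c
    using that graded_forms_independent[OF n1 g(1) g(1) i2(1)] graded_forms_independent[OF n1 g(1) g(1) i2(2)]
      graded_forms_independent[OF n1 g(1) g(1) i2(3)] graded_forms_independent[OF n1 g(1) g(1) i2(4)] by auto
  obtain a b c where abc: "i = (a, b, c)" by (cases i) auto
  hence "a \<in> {0, 1}" "b \<in> {0, 1}" "c \<in> {0, 1}" using K i by auto
  hence "F i = 0" using g(2)[of a b c] all abc by simp
  thus "f i = 0" using i by (simp add: F_def)
qed

lemma all_cusps_eq: "all_cusps_Gamma8 = (\<lambda>f. f * dedekind_eta ^ 3) ` all_forms_Gamma8"
proof
  have sub: "cfun.subspace ((\<lambda>f. f * dedekind_eta ^ 3) ` all_forms_Gamma8)"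
    unfolding all_forms_Gamma8_graded by (rule subspace_mult_image[OF subspace_graded_forms])
  have "f \<in> (\<lambda>f. f * dedekind_eta ^ 3) ` all_forms_Gamma8" if "f \<in> cusps_Gamma8 k" for f k
    using cusp_div_eta_cubed[OF that]
  proof
    assume "f = 0"
    thus ?thesis using cfun.subspace_0[OF sub] by simp
  next
    assume "\<exists>j. \<exists>h\<in>theta_forms UNIV j. f = h * dedekind_eta ^ 3"
    then obtain j h where h: "h \<in> theta_forms UNIV j" "f = h * dedekind_eta ^ 3" by blast
    have "h \<in> all_forms_Gamma8" unfolding all_forms_Gamma8_graded graded_forms_def using h(1) by (intro cfun.span_base) blast
    thus ?thesis using h(2) by blast
  qed
  thus "all_cusps_Gamma8 \<subseteq> (\<lambda>f. f * dedekind_eta ^ 3) ` all_forms_Gamma8"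
    unfolding all_cusps_Gamma8_def by (intro cfun.span_minimal sub) blast
  show "(\<lambda>f. f * dedekind_eta ^ 3) ` all_forms_Gamma8 \<subseteq> all_cusps_Gamma8"
  proof
    fix u assume "u \<in> (\<lambda>f. f * dedekind_eta ^ 3) ` all_forms_Gamma8"
    then obtain f where f: "f \<in> cfun.span (\<Union>k. forms_Gamma8 k)" "u = f * dedekind_eta ^ 3"
      unfolding all_forms_Gamma8_def by blast
    have "h * dedekind_eta ^ 3 \<in> cfun.span (\<Union>k. cusps_Gamma8 k)" if h: "h \<in> (\<Union>k. forms_Gamma8 k)" for h
    proof -
      obtain k where "h \<in> theta_forms UNIV k" using h by (auto simp: forms_Gamma8_eq)
      from mult_eta_cubed_cusp[OF this] show ?thesis by (intro cfun.span_base) blast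
    qed
    from span_mult[OF f(1) this] show "u \<in> all_cusps_Gamma8" unfolding all_cusps_Gamma8_def f(2) .
  qed
qed

theorem theorem30:
  shows
    "internal_direct_sum UNIV forms_Gamma8 all_forms_Gamma8 \<and>
     internal_direct_sum UNIV cusps_Gamma8 all_cusps_Gamma8 \<and>
     internal_direct_sum (UNIV \<times> {0, 1}) (\<lambda>(k, j). forms8 k j) all_forms8 \<and>
     internal_direct_sum UNIV forms4_w2 all_forms4_w2 \<and>
     (\<forall>k. internal_direct_sum {0, 1} (forms8 k) (forms_Gamma8 k)) \<and>
     all_forms_Gamma8 = all_forms8 \<and>
     internal_direct_sum ({0, 1} \<times> {0, 1} \<times> {0, 1})
       (\<lambda>(a :: nat, b :: nat, c :: nat).
          (\<lambda>f. f * eta_natural ^ a * eta_flat ^ b * eta_sharp ^ c) ` all_forms4_w2)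
       all_forms8 \<and>
     all_cusps_Gamma8 = (\<lambda>f. f * dedekind_eta ^ 3) ` all_forms_Gamma8"
proof (intro conjI allI)
  show "internal_direct_sum UNIV forms_Gamma8 all_forms_Gamma8"
    by (rule weight_direct_sum[OF subspace_forms_Gamma8 order_refl all_forms_Gamma8_def])
  show "internal_direct_sum UNIV cusps_Gamma8 all_cusps_Gamma8"
  proof (rule weight_direct_sum[OF _ _ all_cusps_Gamma8_def])
    show "cfun.subspace (cusps_Gamma8 k)" for k unfolding cusps_Gamma8_def by (rule subspace_cusp_forms)
    show "cusps_Gamma8 k \<subseteq> forms_Gamma8 k" for k by (auto simp: cusps_Gamma8_iff forms_Gamma8_eq)
  qed
  show "internal_direct_sum (UNIV \<times> {0, 1}) (\<lambda>(k, j). forms8 k j) all_forms8"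
    by (rule forms8_weight_direct_sum)
  show "internal_direct_sum UNIV forms4_w2 all_forms4_w2"
  proof (rule weight_direct_sum[OF _ _ all_forms4_w2_def])
    show "cfun.subspace (forms4_w2 k)" for k unfolding forms4_w2_eq by (rule subspace_theta_forms)
    show "forms4_w2 k \<subseteq> forms_Gamma8 k" for k unfolding forms4_w2_eq forms_Gamma8_eq by (rule theta_forms_antimono) simp
  qed
  show "internal_direct_sum {0, 1} (forms8 k) (forms_Gamma8 k)" for k by (rule forms8_direct_sum)
  show "all_forms_Gamma8 = all_forms8" by (rule all_forms_eq)
  show "internal_direct_sum ({0, 1} \<times> {0, 1} \<times> {0, 1})
       (\<lambda>(a :: nat, b :: nat, c :: nat).
          (\<lambda>f. f * eta_natural ^ a * eta_flat ^ b * eta_sharp ^ c) ` all_forms4_w2)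
       all_forms8"
    using eta_direct_sum unfolding all_forms_eq[symmetric] all_forms_Gamma8_graded all_forms4_w2_graded .
  show "all_cusps_Gamma8 = (\<lambda>f. f * dedekind_eta ^ 3) ` all_forms_Gamma8" by (rule all_cusps_eq)
qed

end
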